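(* Let $\mathcal{G} = \langle a,b,c,d\rangle$ be the group of automorphisms of the binary rooted tree defined in the context (Grigorchuk's infinite torsion group of intermediate growth), let $\pi$ be its Koopman representation on $L^2(\partial T,\mu)$, extended to a $^*$-representation of $\mathbb{C}[\mathcal{G}]$, let $B = \pi(\mathbb{C}[\mathcal{G}])$, and let $C^*_\pi(\mathcal{G})$ be the norm closure of $B$. Then: (i) $B$ is self-similar, infinite dimensional and residually finite dimensional. (ii) $C^*_\pi(\mathcal{G})$ is self-similar, infinite dimensional, residually finite dimensional, and it possesses a faithful trace. (iii) The natural surjection $\pi \colon \mathbb{C}[\mathcal{G}] \to B$ is not injective, whence $\mathbb{C}[\mathcal{G}]$ is not $^*$-just-infinite. (iv) $B$ is just-infinite.
   Context: The group. Let $T$ be the binary rooted tree with vertex set $\{0,1\}^*$, the set of finite words in $0,1$ (the root is the empty word; level $n$ is $\{0,1\}^n$). Define automorphisms $a,b,c,d$ of $T$, all fixing the root, recursively by: for every $w \in \{0,1\}^*$, $$a(0w)=1w,\quad a(1w)=0w,\qquad b(0w)=0\,a(w),\quad b(1w)=1\,c(w),$$ $$c(0w)=0\,a(w),\quad c(1w)=1\,d(w),\qquad d(0w)=0w,\quad d(1w)=1\,b(w).$$ $\mathcal{G}$ is the subgroup of $\mathrm{Aut}(T)$ generated by $a,b,c,d$. For $g \in \mathcal{G}$ and $v \in \{0,1\}^*$ there is a unique $g|_v \in \mathcal{G}$ (the section of $g$ at $v$) with $g(vw) = g(v)\, g|_v(w)$ for all words $w$. Koopman representation. $\partial T = \{0,1\}^{\mathbb{N}}$,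 with the induced action of $\mathcal{G}$ by homeomorphisms, and $\mu$ is the product of the uniform measures $\{\frac12,\frac12\}$, which is $\mathcal{G}$-invariant. The Koopman representation is $(\pi(g)f)(x) = f(g^{-1}x)$ for $g \in \mathcal{G}$, $f \in L^2(\partial T,\mu)$, $x \in \partial T$. Self-similarity. Let $s_0, s_1$ be the isometries on $L^2(\partial T,\mu)$ given by $(s_i f)(jx) = \sqrt{2}\, f(x)$ if $j=i$ and $(s_if)(jx) = 0$ if $j \neq i$, for $i,j \in \{0,1\}$, $x \in \partial T$; they satisfy $s_0s_0^* + s_1s_1^* = 1$. For a word $v = i_1 i_2\cdots i_n$ put $S_v = s_{i_1}s_{i_2}\cdots s_{i_n}$. A unitary representation $\rho$ of $\mathcal{G}$ on $L^2(\partial T,\mu)$ is self-similar (with respect to $s_0,s_1$) if $\rho(g)S_v = S_{g(v)}\rho(g|_v)$ for all $g \in \mathcal{G}$ and all words $v$. The algebra $\rho(\mathbb{C}[\mathcal{G}])$ and the $C^*$-algebra $C^*_\rho(\mathcal{G})$ are called self-similar if they arise in this way from a self-similar representation $\rho$; thus (i) and (ii) assert that $\pi$ is self-similar with respect to $s_0,s_1$. Other definitions. A $^*$-algebra or $C^*$-algebra is residually finite dimensional if it admits a separating family of finite dimensional $^*$-representations. The algebra $B$ is just-infinite if it is infinite dimensional and $B/J$ is finite dimensional for every non-zero two-sided ideal $J$ of $B$ (no closedness or self-adjointness assumed). $\mathbb{C}[\mathcal{G}]$ is $^*$-just-infinite if each (unital) $^*$-representation of $\mathbb{C}[\mathcal{G}]$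 on a Hilbert space either is injective or has finite dimensional image. *)

theory Defs
  imports "HOL-Probability.Probability" "HOL-Algebra.QuotRing" "HOL-Algebra.Generated_Groups"
    "HOL-Library.Poly_Mapping" "HOL-Library.Function_Algebras"
begin

section \<open>The Grigorchuk group\<close>

text \<open>
  The vertices of the binary rooted tree are the words \<open>bool list\<close>, with \<open>False\<close> for 0 and
  \<open>True\<close> for 1; the children of \<open>v\<close> are the words \<open>v @ [i]\<close>. An automorphism is a bijection that
  preserves the relation ``\<open>w\<close> is a child of \<open>v\<close>'' in both directions; it fixes the root because
  the root is the only vertex that is not a child.
\<close>

definition tree_aut :: "(bool list \<Rightarrow> bool list) monoid" where
  "tree_aut =
    \<lparr>carrier = {g. bij g \<and> (\<forall>v w. (\<exists>i. w = v @ [i]) \<longleftrightarrow> (\<exists>i. g w = g v @ [i]))},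
     mult = (\<circ>), one = id\<rparr>"

fun gen_a :: "bool list \<Rightarrow> bool list" where
  "gen_a [] = []"
| "gen_a (False # w) = True # w"
| "gen_a (True # w) = False # w"

fun gen_b gen_c gen_d :: "bool list \<Rightarrow> bool list" where
  "gen_b [] = []"
| "gen_b (False # w) = False # gen_a w"
| "gen_b (True # w) = True # gen_c w"
| "gen_c [] = []"
| "gen_c (False # w) = False # gen_a w"
| "gen_c (True # w) = True # gen_d w"
| "gen_d [] = []"
| "gen_d (False # w) = False # w"
| "gen_d (True # w) = True # gen_b w"

lemma in_tree_aut:
  "g \<in> carrier tree_aut \<longleftrightarrow>
    bij g \<and> (\<forall>v w. (\<exists>i. w = v @ [i]) \<longleftrightarrow> (\<exists>i. g w = g v @ [i]))"
  by (simp add: tree_aut_def)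

lemma group_tree_aut: "group tree_aut"
proof (rule groupI)
  fix g assume g: "g \<in> carrier tree_aut"
  then have b: "bij g" and e: "\<And>v w. (\<exists>i. w = v @ [i]) \<longleftrightarrow> (\<exists>i. g w = g v @ [i])"
    unfolding in_tree_aut by blast+
  have gi: "g (inv_into UNIV g u) = u" for u using b by (simp add: bij_is_surj surj_f_inv_f)
  have "inv_into UNIV g \<in> carrier tree_aut"
  proof -
    have "(\<exists>i. w = v @ [i]) \<longleftrightarrow> (\<exists>i. inv_into UNIV g w = inv_into UNIV g v @ [i])" for v w
      using e[of "inv_into UNIV g w" "inv_into UNIV g v"] gi by simp
    then show ?thesis using bij_imp_bij_inv[OF b] unfolding in_tree_aut by blast
  qed
  moreover have "inv_into UNIV g \<otimes>\<^bsub>tree_aut\<^esub> g = \<one>\<^bsub>tree_aut\<^esub>"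
    using b by (simp add: tree_aut_def bij_is_inj)
  ultimately show "\<exists>h\<in>carrier tree_aut. h \<otimes>\<^bsub>tree_aut\<^esub> g = \<one>\<^bsub>tree_aut\<^esub>" by blast
next
  fix g h assume "g \<in> carrier tree_aut" "h \<in> carrier tree_aut"
  then have "bij (g \<circ> h)" "\<forall>v w. (\<exists>i. w = v @ [i]) \<longleftrightarrow> (\<exists>i. (g \<circ> h) w = (g \<circ> h) v @ [i])"
    unfolding in_tree_aut by (blast intro: bij_comp, metis comp_apply)
  then have "g \<circ> h \<in> carrier tree_aut" unfolding in_tree_aut by blast
  moreover have "g \<otimes>\<^bsub>tree_aut\<^esub> h = g \<circ> h" by (simp add: tree_aut_def)
  ultimately show "g \<otimes>\<^bsub>tree_aut\<^esub> h \<in> carrier tree_aut" by (simp only:)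
qed (simp_all add: tree_aut_def o_assoc)

lemma tree_aut_length:
  assumes g: "g \<in> carrier tree_aut" shows "length (g v) = length v"
proof -
  have b: "bij g" and e: "\<And>v w. (\<exists>i. w = v @ [i]) \<longleftrightarrow> (\<exists>i. g w = g v @ [i])"
    using g unfolding in_tree_aut by blast+
  have "g [] = []"
  proof (cases "g []" rule: rev_cases)
    case (snoc u i)
    obtain u' where "u = g u'" using b by (metis bij_pointE)
    then have "\<exists>i. g [] = g u' @ [i]" using snoc by blast
    with e[of "[]" u'] show ?thesis by simp
  qed
  then show ?thesis
  proof (induction v rule: rev_induct)
    case (snoc i v)
    from e[of "v @ [i]" v] obtain j where "g (v @ [i]) = g v @ [j]" by auto
    with snoc show ?case by simp
  qed simp
qed

lemma tree_aut_append:
  assumes g: "g \<in> carrier tree_aut" shows "take (length v) (g (v @ w)) = g v"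
proof (induction w rule: rev_induct)
  case Nil
  then show ?case using tree_aut_length[OF g] by simp
next
  case (snoc i w)
  have "(\<exists>j. (v @ w) @ [i] = (v @ w) @ [j])" by blast
  with g obtain j where "g ((v @ w) @ [i]) = g (v @ w) @ [j]"
    unfolding in_tree_aut by blast
  with snoc show ?case using tree_aut_length[OF g] by simp
qed

lemma gen_involution:
  "gen_a (gen_a w) = w" "gen_b (gen_b w) = w" "gen_c (gen_c w) = w" "gen_d (gen_d w) = w"
proof -
  have a: "gen_a (gen_a w) = w" for w by (cases w rule: gen_a.cases) auto
  show "gen_a (gen_a w) = w" by (rule a)
  have "gen_b (gen_b w) = w \<and> gen_c (gen_c w) = w \<and> gen_d (gen_d w) = w"
  proof (induction w)
    case (Cons x w) then show ?case by (cases x) (auto simp: a)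
  qed simp
  then show "gen_b (gen_b w) = w" "gen_c (gen_c w) = w" "gen_d (gen_d w) = w" by auto
qed

lemma gen_section:
  "g \<in> {gen_a, gen_b, gen_c, gen_d} \<Longrightarrow>
    \<exists>h \<in> {id, gen_a, gen_b, gen_c, gen_d}. \<forall>w. g (v @ w) = g v @ h w"
proof (induction v arbitrary: g)
  case Nil
  then show ?case by (auto)
next
  case (Cons x v)
  have A: "\<And>x v w. gen_a (x # v @ w) = gen_a (x # v) @ id w"
    by (case_tac x) auto
  have I: "\<And>g. g \<in> {gen_a, gen_b, gen_c, gen_d} \<Longrightarrow>
     \<exists>h \<in> {id, gen_a, gen_b, gen_c, gen_d}. \<forall>w. g (v @ w) = g v @ h w" by fact
  have D: "\<And>w. gen_d (False # v @ w) = gen_d (False # v) @ id w" by simp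
  from Cons.prems consider "g = gen_a" | "g = gen_d" "x = False" 
    | k where "k \<in> {gen_a, gen_b, gen_c, gen_d}" "\<And>w. g (x # w) = x # k w"
    by (cases x) force+
  then show ?case
  proof cases
    case 1 then show ?thesis using A by auto
  next
    case 2 then show ?thesis using D by auto
  next
    case 3 then show ?thesis using I[OF 3(1)] by auto
  qed
qed

lemma gen_in_tree_aut: "{gen_a, gen_b, gen_c, gen_d} \<subseteq> carrier tree_aut"
proof
  fix g assume g: "g \<in> {gen_a, gen_b, gen_c, gen_d}"
  have gg: "g (g w) = w" for w using g gen_involution by auto
  have lid: "length (g v) = length v" if "g \<in> {id, gen_a, gen_b, gen_c, gen_d}" for g v
  proof -
    have "length (gen_a v) = length v" for v by (cases v rule: gen_a.cases) auto
    moreover from this have "length (gen_b v) = length v \<and> length (gen_c v) = length v \<and> length (gen_d v) = length v" for v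
    proof (induction v)
      case (Cons x w) then show ?case by (cases x) auto
    qed simp
    ultimately show ?thesis using that by auto
  qed
  have ap: "\<exists>j. g (v @ [i]) = g v @ [j]" for v i
  proof -
    obtain h where h: "h \<in> {id, gen_a, gen_b, gen_c, gen_d}" "\<forall>w. g (v @ w) = g v @ h w"
      using gen_section[OF g] by blast
    have "length (h [i]) = 1" using lid[OF h(1)] by simp
    then obtain j where "h [i] = [j]" by (auto simp: length_Suc_conv)
    then show ?thesis using h(2) by auto
  qed
  have "bij g" by (rule o_bij[of g]) (auto simp: gg)
  moreover have "(\<exists>i. w = v @ [i]) \<longleftrightarrow> (\<exists>i. g w = g v @ [i])" for v w
  proof
    assume "\<exists>i. g w = g v @ [i]"
    then obtain i where "g (g w) = g (g v @ [i])" by auto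
    with ap[of "g v" i] show "\<exists>i. w = v @ [i]" by (auto simp: gg)
  qed (use ap in auto)
  ultimately show "g \<in> carrier tree_aut" unfolding in_tree_aut by blast
qed

typedef grigorchuk = "generate tree_aut {gen_a, gen_b, gen_c, gen_d}" morphisms act Abs_grigorchuk
  by (blast intro: generate.one)

setup_lifting type_definition_grigorchuk

text \<open>
  The library's type class for (not necessarily commutative) groups is the additively written
  \<open>group_add\<close>; so \<open>g + h\<close> is the composition \<open>g \<circ> h\<close> and \<open>- g\<close> is the inverse of \<open>g\<close>. With this
  instance, the multiplication of \<open>grigorchuk \<Rightarrow>\<^sub>0 complex\<close> (finitely supported functions) is
  convolution, i.e. this type is the group algebra.
\<close>

instantiation grigorchuk :: group_add
begin

lift_definition zero_grigorchuk :: grigorchuk is "\<one>\<^bsub>tree_aut\<^esub>" by (rule generate.one)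

lift_definition plus_grigorchuk :: "grigorchuk \<Rightarrow> grigorchuk \<Rightarrow> grigorchuk"
  is "\<lambda>g h. g \<otimes>\<^bsub>tree_aut\<^esub> h" by (rule generate.eng)

lift_definition uminus_grigorchuk :: "grigorchuk \<Rightarrow> grigorchuk" is "\<lambda>g. inv\<^bsub>tree_aut\<^esub> g"
  by (rule group.generate_m_inv_closed[OF group_tree_aut gen_in_tree_aut])

definition minus_grigorchuk :: "grigorchuk \<Rightarrow> grigorchuk \<Rightarrow> grigorchuk"
  where "minus_grigorchuk g h = g + (- h)"

instance
proof
  fix g h k :: grigorchuk
  interpret group tree_aut by (rule group_tree_aut)
  note c = generate_in_carrier[OF gen_in_tree_aut]
  show "g + h + k = g + (h + k)" by transfer (simp add: c m_assoc)
  show "0 + g = g" by transfer (simp add: c)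
  show "g + 0 = g" by transfer (simp add: c)
  show "- g + g = 0" by transfer (simp add: c)
  show "g + (- h) = g - h" by (simp add: minus_grigorchuk_def)
qed

end

lemma act_in_tree_aut: "act g \<in> carrier tree_aut"
  by (rule group.generate_in_carrier[OF group_tree_aut gen_in_tree_aut act])

lemma act_zero: "act 0 = id" by transfer (simp add: tree_aut_def)

lemma act_add: "act (g + h) = act g \<circ> act h" by transfer (simp add: tree_aut_def)

lemma act_uminus: "act (- g) (act g v) = v" "act g (act (- g) v) = v"
  using act_add[of "-g" g] act_add[of g "-g"] by (auto simp: act_zero fun_eq_iff)

lemma length_act [simp]: "length (act g v) = length v"
  by (rule tree_aut_length[OF act_in_tree_aut])

lemma take_act: "take (length v) (act g (v @ w)) = act g v"
  by (rule tree_aut_append[OF act_in_tree_aut])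

definition section_at :: "grigorchuk \<Rightarrow> bool list \<Rightarrow> grigorchuk" where
  "section_at g v = (THE h. \<forall>w. act g (v @ w) = act g v @ act h w)"

lemma ex1_section: "\<exists>!h. \<forall>w. act g (v @ w) = act g v @ act h w"
proof -
  let ?S = "{gen_a, gen_b, gen_c, gen_d}"
  have gen: "\<exists>h \<in> generate tree_aut ?S. \<forall>w. g (v @ w) = g v @ h w" if g: "g \<in> ?S" for g v
  proof -
    have "id \<in> generate tree_aut ?S" using generate.one[of tree_aut] by (simp add: tree_aut_def)
    then have "{id, gen_a, gen_b, gen_c, gen_d} \<subseteq> generate tree_aut ?S"
      by (auto intro: generate.incl)
    then show ?thesis using gen_section[OF g] by blast
  qed
  have "\<exists>h \<in> generate tree_aut ?S. \<forall>w. g (v @ w) = g v @ h w"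
    if "g \<in> generate tree_aut ?S" for g v
    using that
  proof (induction g arbitrary: v rule: generate.induct)
    case one
    show ?case by (rule bexI[OF _ generate.one]) (simp add: tree_aut_def)
  next
    case (incl h)
    then show ?case by (rule gen)
  next
    case (inv h)
    have "inv\<^bsub>tree_aut\<^esub> h = h"
    proof (rule group.inv_equality[OF group_tree_aut])
      show "h \<otimes>\<^bsub>tree_aut\<^esub> h = \<one>\<^bsub>tree_aut\<^esub>"
        using inv gen_involution by (auto simp: tree_aut_def fun_eq_iff)
    qed (use inv gen_in_tree_aut in auto)
    then show ?case using gen[OF inv] by simp
  next
    case (eng h1 h2)
    obtain k2 where k2: "k2 \<in> generate tree_aut ?S" "\<forall>w. h2 (v @ w) = h2 v @ k2 w"
      using eng.IH(2) by blast
    obtain k1 where k1: "k1 \<in> generate tree_aut ?S" "\<forall>w. h1 (h2 v @ w) = h1 (h2 v) @ k1 w"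
      using eng.IH(1) by blast
    show ?case
      by (rule bexI[OF _ generate.eng[OF k1(1) k2(1)]]) (use k1 k2 in \<open>simp add: tree_aut_def\<close>)
  qed
  from this[OF act, of g v] obtain h where "h \<in> generate tree_aut ?S" "\<forall>w. act g (v @ w) = act g v @ h w"
    by blast
  then have "\<forall>w. act g (v @ w) = act g v @ act (Abs_grigorchuk h) w"
    by (simp add: Abs_grigorchuk_inverse)
  moreover have "k = k'"
    if "\<forall>w. act g (v @ w) = act g v @ act k w" "\<forall>w. act g (v @ w) = act g v @ act k' w" for k k'
  proof -
    have "act k w = act k' w" for w using that by simp
    then show ?thesis by (simp add: act_inject[symmetric] fun_eq_iff)
  qed
  ultimately show ?thesis by blast
qed

lemma act_append: "act g (v @ w) = act g v @ act (section_at g v) w"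
  using theI'[OF ex1_section[of g v]] unfolding section_at_def by blast

section \<open>The boundary and its measure\<close>

text \<open>
  \<open>boundary_act g x\<close> is the boundary point whose prefixes are the images under \<open>g\<close> of the prefixes
  of \<open>x\<close>; its \<open>n\<close>-th letter is the last letter of the image of the prefix of length \<open>n + 1\<close>
  (see \<open>stake_boundary_act\<close> below).
\<close>

definition boundary_act :: "grigorchuk \<Rightarrow> bool stream \<Rightarrow> bool stream" where
  "boundary_act g x = to_stream (\<lambda>n. act g (stake (Suc n) x) ! n)"

lemma stake_boundary_act: "stake n (boundary_act g x) = act g (stake n x)"
proof (rule nth_equalityI)
  fix i assume i: "i < length (stake n (boundary_act g x))"
  then have t: "take (Suc i) (stake n x) = stake (Suc i) x" by (simp add: take_stake min_def)
  have "take (Suc i) (act g (take (Suc i) (stake n x) @ drop (Suc i) (stake n x))) = act g (take (Suc i) (stake n x))"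
    using take_act[of "take (Suc i) (stake n x)" g "drop (Suc i) (stake n x)"] i by simp
  then have "take (Suc i) (act g (stake n x)) = act g (stake (Suc i) x)"
    unfolding append_take_drop_id unfolding t .
  then have "act g (stake n x) ! i = act g (stake (Suc i) x) ! i" by (metis lessI nth_take)
  then show "stake n (boundary_act g x) ! i = act g (stake n x) ! i"
    using i by (simp add: boundary_act_def to_stream_def)
qed simp

definition mu :: "bool stream measure" where
  "mu = stream_space (measure_pmf (pmf_of_set UNIV))"

lemma prob_space_mu: "prob_space mu"
  unfolding mu_def by (rule prob_space.prob_space_stream_space[OF prob_space_measure_pmf])

interpretation mu: prob_space mu by (rule prob_space_mu)

lemma sets_mu: "sets mu = sets (stream_space (count_space UNIV))"
  unfolding mu_def by (rule sets_stream_space_cong) simp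

lemma space_mu [simp]: "space mu = UNIV"
  by (simp add: mu_def space_stream_space)

lemma sstart_UNIV: "sstart UNIV w = {x. stake (length w) x = w}"
proof (induction w)
  case (Cons a w)
  show ?case
  proof (rule Set.set_eqI)
    fix x show "x \<in> sstart UNIV (a # w) \<longleftrightarrow> x \<in> {x. stake (length (a # w)) x = a # w}"
      using Cons by simp
  qed
qed simp

lemma emeasure_mu_cylinder: "emeasure mu (sstart UNIV w) = ennreal ((1/2) ^ length w)"
proof (induction w)
  case Nil
  then show ?case using mu.emeasure_space_1 by simp
next
  case (Cons i w)
  have S: "sstart UNIV w \<in> sets mu" for w by (simp add: sets_mu sets_sstart)
  have "emeasure mu (sstart UNIV (i # w)) =
    (\<integral>\<^sup>+t. emeasure mu {x. t ## x \<in> sstart UNIV (i # w)} \<partial>measure_pmf (pmf_of_set UNIV))"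
    using prob_space.emeasure_stream_space[OF prob_space_measure_pmf, of "sstart UNIV (i # w)" "pmf_of_set UNIV"] S[of "i # w"]
    by (simp add: mu_def space_stream_space)
  also have "\<dots> = (\<integral>\<^sup>+t. ennreal ((1/2) ^ length w) * indicator {i} t \<partial>measure_pmf (pmf_of_set UNIV))"
  proof (rule nn_integral_cong)
    fix t :: bool
    have "{x. t ## x \<in> sstart UNIV (i # w)} = (if t = i then sstart UNIV w else {})" by auto
    then show "emeasure mu {x. t ## x \<in> sstart UNIV (i # w)} = ennreal ((1/2) ^ length w) * indicator {i} t"
      using Cons.IH by (simp only: if_split) (simp add: indicator_def)
  qed
  also have "\<dots> = ennreal ((1/2) ^ length w) * ennreal (1/2)"
    by (subst nn_integral_cmult_indicator) (auto simp: emeasure_pmf_single pmf_of_set)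
  also have "\<dots> = ennreal ((1/2) ^ length (i # w))"
    by (subst ennreal_mult[symmetric]) (auto simp: mult.commute)
  finally show ?case .
qed

lemma measurable_boundary_act: "boundary_act g \<in> measurable mu mu"
proof -
  have "boundary_act g \<in> measurable (stream_space (count_space UNIV)) (stream_space (count_space UNIV))"
  proof (rule measurable_stream_space2)
    fix n
    have "(\<lambda>x. act g (stake (Suc n) x) ! n) \<in> measurable (stream_space (count_space UNIV)) (count_space UNIV)"
    proof -
      have s: "stake (Suc n) \<in> measurable (stream_space (count_space UNIV)) (count_space (UNIV :: bool list set))"
        by (rule measurable_stake)
      show ?thesis by (rule measurable_compose[OF s]) simp
    qed
    then show "(\<lambda>x. boundary_act g x !! n) \<in> measurable (stream_space (count_space UNIV)) (count_space UNIV)"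
      by (simp add: boundary_act_def to_stream_def)
  qed
  then show ?thesis unfolding measurable_cong_sets[OF sets_mu sets_mu] .
qed

lemma boundary_act_measure_preserving: "distr mu mu (boundary_act g) = mu"
proof (rule stream_space_eq_sstart[where S = UNIV])
  fix w :: "bool list"
  have "boundary_act g -` sstart UNIV w \<inter> space mu = sstart UNIV (act (- g) w)"
  proof -
    have "act g v = w \<longleftrightarrow> v = act (- g) w" for v using act_uminus by metis
    then show ?thesis by (auto simp: sstart_UNIV stake_boundary_act)
  qed
  then show "emeasure (distr mu mu (boundary_act g)) (sstart UNIV w) = emeasure mu (sstart UNIV w)"
    by (simp add: emeasure_distr measurable_boundary_act sets_mu sets_sstart emeasure_mu_cylinder)
qed (simp_all add: sets_mu prob_space_mu mu.prob_space_distr measurable_boundary_act)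


section \<open>Complex vector spaces and complex inner product spaces\<close>

class complex_vector = ab_group_add +
  fixes scaleC :: "complex \<Rightarrow> 'a \<Rightarrow> 'a"  (infixr \<open>*\<^sub>C\<close> 75)
  assumes scaleC_add_right: "c *\<^sub>C (x + y) = c *\<^sub>C x + c *\<^sub>C y"
    and scaleC_add_left: "(c + d) *\<^sub>C x = c *\<^sub>C x + d *\<^sub>C x"
    and scaleC_scaleC: "c *\<^sub>C d *\<^sub>C x = (c * d) *\<^sub>C x"
    and scaleC_one: "1 *\<^sub>C x = x"

global_interpretation cvec: vector_space "scaleC :: complex \<Rightarrow> 'a \<Rightarrow> 'a::complex_vector"
  by unfold_locales (simp_all add: scaleC_add_right scaleC_add_left scaleC_scaleC scaleC_one)

text \<open>
  The norm and topology are those of the underlying real inner product space, so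
  \<open>norm x = sqrt (Re (cinner x x))\<close>. The inner product is linear in its first argument.
\<close>

class complex_inner = complex_vector + real_inner +
  fixes cinner :: "'a \<Rightarrow> 'a \<Rightarrow> complex"
  assumes scaleR_scaleC: "r *\<^sub>R x = complex_of_real r *\<^sub>C x"
    and cinner_commute: "cinner x y = cnj (cinner y x)"
    and cinner_add_left: "cinner (x + y) z = cinner x z + cinner y z"
    and cinner_scaleC_left: "cinner (c *\<^sub>C x) y = c * cinner x y"
    and inner_eq_Re_cinner: "inner x y = Re (cinner x y)"

lemma norm_scaleC: "norm (c *\<^sub>C x) = cmod c * norm (x :: 'a::complex_inner)"
proof -
  have "cinner x (c *\<^sub>C x) = cnj c * cinner x x" for x :: 'a
    by (metis cinner_commute cinner_scaleC_left complex_cnj_mult)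
  then have "cinner (c *\<^sub>C x) (c *\<^sub>C x) = (c * cnj c) * cinner x x"
    by (simp add: cinner_scaleC_left)
  also have "c * cnj c = complex_of_real ((cmod c)\<^sup>2)" by (rule complex_norm_square[symmetric])
  finally have "inner (c *\<^sub>C x) (c *\<^sub>C x) = (cmod c)\<^sup>2 * inner x x"
    by (simp add: inner_eq_Re_cinner)
  then show ?thesis by (simp add: norm_eq_sqrt_inner real_sqrt_mult)
qed

instantiation complex :: complex_vector
begin
definition scaleC_complex :: "complex \<Rightarrow> complex \<Rightarrow> complex" where "scaleC_complex = (*)"
instance by standard (simp_all add: scaleC_complex_def algebra_simps)
end

text \<open>
  Pointwise structure on functions: the operators \<open>'h \<Rightarrow> 'h\<close> in the image of a
  representation are elements of this vector space.
\<close>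

instantiation "fun" :: (type, complex_vector) complex_vector
begin
definition scaleC_fun :: "complex \<Rightarrow> ('a \<Rightarrow> 'b) \<Rightarrow> 'a \<Rightarrow> 'b" where "scaleC_fun c f = (\<lambda>x. c *\<^sub>C f x)"
instance
  by standard (simp_all add: scaleC_fun_def fun_eq_iff scaleC_add_right scaleC_add_left scaleC_scaleC scaleC_one)
end

instantiation poly_mapping :: (type, complex_vector) complex_vector
begin
lift_definition scaleC_poly_mapping :: "complex \<Rightarrow> ('a \<Rightarrow>\<^sub>0 'b) \<Rightarrow> 'a \<Rightarrow>\<^sub>0 'b" is "\<lambda>c f k. c *\<^sub>C f k"
proof -
  fix c and f :: "'a \<Rightarrow> 'b" assume "finite {k. f k \<noteq> 0}"
  then show "finite {k. c *\<^sub>C f k \<noteq> 0}" by (rule rev_finite_subset) auto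
qed
instance
  by (standard; transfer) (simp_all add: fun_eq_iff scaleC_add_right scaleC_add_left scaleC_scaleC scaleC_one)
end

instantiation blinfun :: (real_normed_vector, complex_inner) complex_vector
begin
lift_definition scaleC_blinfun :: "complex \<Rightarrow> ('a \<Rightarrow>\<^sub>L 'b) \<Rightarrow> 'a \<Rightarrow>\<^sub>L 'b" is "\<lambda>c T x. c *\<^sub>C T x"
proof -
  fix c and T :: "'a \<Rightarrow> 'b" assume "bounded_linear T"
  then interpret T: bounded_linear T .
  obtain K where K: "\<And>x. norm (T x) \<le> norm x * K" using T.bounded by blast
  show "bounded_linear (\<lambda>x. c *\<^sub>C T x)"
  proof (rule bounded_linear_intro)
    show "c *\<^sub>C T (x + y) = c *\<^sub>C T x + c *\<^sub>C T y" for x y by (simp add: T.add scaleC_add_right)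
    show "c *\<^sub>C T (r *\<^sub>R x) = r *\<^sub>R c *\<^sub>C T x" for r x
      by (simp add: T.scaleR scaleR_scaleC scaleC_scaleC mult.commute)
    show "norm (c *\<^sub>C T x) \<le> norm x * (cmod c * K)" for x
      using mult_left_mono[OF K, of "cmod c" x] by (simp add: norm_scaleC algebra_simps)
  qed
qed
instance
  by (standard; transfer) (simp_all add: fun_eq_iff scaleC_add_right scaleC_add_left scaleC_scaleC scaleC_one)
end

section \<open>The Hilbert space of square integrable functions\<close>

definition square_integrable :: "(bool stream \<Rightarrow> complex) \<Rightarrow> bool" where
  "square_integrable f \<longleftrightarrow> f \<in> borel_measurable mu \<and> integrable mu (\<lambda>x. (cmod (f x))\<^sup>2)"

definition l2_rel :: "(bool stream \<Rightarrow> complex) \<Rightarrow> (bool stream \<Rightarrow> complex) \<Rightarrow> bool" where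
  "l2_rel f g \<longleftrightarrow> square_integrable f \<and> square_integrable g \<and> (AE x in mu. f x = g x)"

lemma square_integrable_bounded_by:
  assumes "square_integrable f" "square_integrable g" "h \<in> borel_measurable mu"
    and "\<And>x. (cmod (h x))\<^sup>2 \<le> K * ((cmod (f x))\<^sup>2 + (cmod (g x))\<^sup>2)"
  shows "square_integrable h"
  unfolding square_integrable_def
proof
  show "integrable mu (\<lambda>x. (cmod (h x))\<^sup>2)"
  proof (rule Bochner_Integration.integrable_bound)
    show "integrable mu (\<lambda>x. K * ((cmod (f x))\<^sup>2 + (cmod (g x))\<^sup>2))"
      using assms by (auto simp: square_integrable_def)
    show "AE x in mu. norm ((cmod (h x))\<^sup>2) \<le> norm (K * ((cmod (f x))\<^sup>2 + (cmod (g x))\<^sup>2))"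
      using assms(4) by (auto intro!: AE_I2 order_trans[OF _ abs_ge_self])
  qed (use assms(3) in measurable)
qed (rule assms(3))

lemma measurable_cnj:
  "f \<in> borel_measurable M \<Longrightarrow> (\<lambda>x. cnj (f x)) \<in> borel_measurable M"
  by (rule borel_measurable_continuous_on[where f = cnj]) (auto intro: continuous_intros)

lemma square_integrable_zero: "square_integrable (\<lambda>x. 0)"
  by (simp add: square_integrable_def)

lemma square_integrable_add:
  assumes "square_integrable f" "square_integrable g"
  shows "square_integrable (\<lambda>x. f x + g x)"
proof (rule square_integrable_bounded_by[OF assms, where K = 2])
  show "(cmod (f x + g x))\<^sup>2 \<le> 2 * ((cmod (f x))\<^sup>2 + (cmod (g x))\<^sup>2)" for x
  proof -
    have "(cmod (f x + g x))\<^sup>2 \<le> (cmod (f x) + cmod (g x))\<^sup>2"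
      by (intro power_mono norm_triangle_ineq) auto
    also have "\<dots> \<le> 2 * ((cmod (f x))\<^sup>2 + (cmod (g x))\<^sup>2)"
      using sum_squares_bound[of "cmod (f x)" "cmod (g x)"] by (simp add: power2_sum)
    finally show ?thesis .
  qed
qed (use assms in \<open>auto simp: square_integrable_def\<close>)

lemma square_integrable_mult:
  assumes "square_integrable f"
  shows "square_integrable (\<lambda>x. c * f x)"
  using assms by (auto simp: square_integrable_def norm_mult power_mult_distrib)

lemma square_integrable_product:
  assumes f: "square_integrable f" and g: "square_integrable g"
  shows "integrable mu (\<lambda>x. f x * cnj (g x))"
proof (rule Bochner_Integration.integrable_bound)
  show "integrable mu (\<lambda>x. (cmod (f x))\<^sup>2 + (cmod (g x))\<^sup>2)"
    using assms by (auto simp: square_integrable_def)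
  show "AE x in mu. norm (f x * cnj (g x)) \<le> norm ((cmod (f x))\<^sup>2 + (cmod (g x))\<^sup>2)"
  proof (rule AE_I2)
    fix x
    have "0 \<le> cmod (f x) * cmod (g x)" by simp
    then have "cmod (f x) * cmod (g x) \<le> (cmod (f x))\<^sup>2 + (cmod (g x))\<^sup>2"
      using sum_squares_bound[of "cmod (f x)" "cmod (g x)"] by linarith
    then show "norm (f x * cnj (g x)) \<le> norm ((cmod (f x))\<^sup>2 + (cmod (g x))\<^sup>2)"
      by (simp add: norm_mult)
  qed
  show "(\<lambda>x. f x * cnj (g x)) \<in> borel_measurable mu"
    using assms by (auto simp: square_integrable_def intro!: borel_measurable_times measurable_cnj)
qed

text \<open>
  The elements of \<open>l2\<close> are the classes, modulo equality almost everywhere, of the square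
  integrable functions on the boundary.
\<close>

quotient_type l2 = "bool stream \<Rightarrow> complex" / partial: l2_rel
proof (rule part_equivpI)
  show "\<exists>f. l2_rel f f"
    using square_integrable_zero by (auto simp: l2_rel_def)
  show "symp l2_rel" by (auto simp: l2_rel_def symp_def)
  show "transp l2_rel"
  proof (rule transpI)
    fix f g h assume a: "l2_rel f g" "l2_rel g h"
    then have "AE x in mu. f x = g x" "AE x in mu. g x = h x" by (auto simp: l2_rel_def)
    then have "AE x in mu. f x = h x" by eventually_elim simp
    with a show "l2_rel f h" by (simp add: l2_rel_def)
  qed
qed

instantiation l2 :: complex_inner
begin

lift_definition zero_l2 :: l2 is "\<lambda>x. 0"
  using square_integrable_zero by (simp add: l2_rel_def)

lift_definition plus_l2 :: "l2 \<Rightarrow> l2 \<Rightarrow> l2" is "\<lambda>f g x. f x + g x"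
  unfolding l2_rel_def by (auto intro: square_integrable_add)

lift_definition scaleC_l2 :: "complex \<Rightarrow> l2 \<Rightarrow> l2" is "\<lambda>c f x. c * f x"
  unfolding l2_rel_def by (auto intro: square_integrable_mult)

lift_definition cinner_l2 :: "l2 \<Rightarrow> l2 \<Rightarrow> complex" is "\<lambda>f g. \<integral>x. f x * cnj (g x) \<partial>mu"
proof -
  fix f f' g g' assume a: "l2_rel f f'" "l2_rel g g'"
  then have "AE x in mu. f x = f' x" "AE x in mu. g x = g' x" by (auto simp: l2_rel_def)
  then have "AE x in mu. f x * cnj (g x) = f' x * cnj (g' x)" by eventually_elim simp
  then show "(\<integral>x. f x * cnj (g x) \<partial>mu) = (\<integral>x. f' x * cnj (g' x) \<partial>mu)"
    using a by (intro integral_cong_AE)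
      (auto simp: l2_rel_def square_integrable_def intro!: borel_measurable_times measurable_cnj)
qed

definition uminus_l2 :: "l2 \<Rightarrow> l2" where "uminus_l2 f = (- 1) *\<^sub>C f"
definition minus_l2 :: "l2 \<Rightarrow> l2 \<Rightarrow> l2" where "minus_l2 f g = f + (- g)"
definition scaleR_l2 :: "real \<Rightarrow> l2 \<Rightarrow> l2" where "scaleR_l2 r f = complex_of_real r *\<^sub>C f"
definition inner_l2 :: "l2 \<Rightarrow> l2 \<Rightarrow> real" where "inner_l2 f g = Re (cinner f g)"
definition norm_l2 :: "l2 \<Rightarrow> real" where "norm_l2 f = sqrt (inner f f)"
definition dist_l2 :: "l2 \<Rightarrow> l2 \<Rightarrow> real" where "dist_l2 f g = norm (f - g)"
definition sgn_l2 :: "l2 \<Rightarrow> l2" where "sgn_l2 f = inverse (norm f) *\<^sub>R f"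
definition uniformity_l2 :: "(l2 \<times> l2) filter" where
  "uniformity_l2 = (INF e\<in>{0<..}. principal {(f, g). dist f g < e})"
definition open_l2 :: "l2 set \<Rightarrow> bool" where
  "open_l2 U = (\<forall>f\<in>U. eventually (\<lambda>(f', g). f' = f \<longrightarrow> g \<in> U) uniformity)"

instance
proof
  fix f g h :: l2 and c d :: complex and r s :: real
  show assoc: "f + g + h = f + (g + h)"
    by transfer (auto simp: l2_rel_def add.assoc intro!: square_integrable_add)
  show "f + g = g + f"
    by transfer (auto simp: l2_rel_def add.commute intro!: square_integrable_add)
  show "0 + f = f" by transfer (auto simp: l2_rel_def)
  show "- f + f = 0" unfolding uminus_l2_def
    by transfer (auto simp: l2_rel_def intro!: square_integrable_zero)
  show "f - g = f + - g" by (rule minus_l2_def)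
  show add_right: "c *\<^sub>C (f + g) = c *\<^sub>C f + c *\<^sub>C g" for c f and g :: l2
    by transfer (auto simp: l2_rel_def algebra_simps intro!: square_integrable_mult square_integrable_add)
  show add_left: "(c + d) *\<^sub>C f = c *\<^sub>C f + d *\<^sub>C f" for c d and f :: l2
    by transfer (auto simp: l2_rel_def algebra_simps intro!: square_integrable_mult square_integrable_add)
  show scale: "c *\<^sub>C d *\<^sub>C f = (c * d) *\<^sub>C f" for c d and f :: l2
    by transfer (auto simp: l2_rel_def algebra_simps intro!: square_integrable_mult)
  show one: "1 *\<^sub>C f = f" for f :: l2
    by transfer (auto simp: l2_rel_def)
  show "r *\<^sub>R (f + g) = r *\<^sub>R f + r *\<^sub>R g" by (simp add: scaleR_l2_def add_right)
  show "(r + s) *\<^sub>R f = r *\<^sub>R f + s *\<^sub>R f" by (simp add: scaleR_l2_def add_left)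
  show "r *\<^sub>R s *\<^sub>R f = (r * s) *\<^sub>R f" by (simp add: scaleR_l2_def scale)
  show "1 *\<^sub>R f = f" by (simp add: scaleR_l2_def one)
  show "r *\<^sub>R f = complex_of_real r *\<^sub>C f" by (rule scaleR_l2_def)
  show comm: "cinner f g = cnj (cinner g f)" for f g :: l2
  proof transfer
    fix f g :: "bool stream \<Rightarrow> complex" assume "l2_rel f f" "l2_rel g g"
    have "(\<integral>x. f x * cnj (g x) \<partial>mu) = (\<integral>x. cnj (g x * cnj (f x)) \<partial>mu)"
      by (simp add: mult.commute)
    also have "\<dots> = cnj (\<integral>x. g x * cnj (f x) \<partial>mu)" by (rule Bochner_Integration.integral_cnj)
    finally show "(\<integral>x. f x * cnj (g x) \<partial>mu) = cnj (\<integral>x. g x * cnj (f x) \<partial>mu)" .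
  qed
  show cadd: "cinner (f + g) h = cinner f h + cinner g h" for f g h :: l2
    by transfer (simp add: l2_rel_def distrib_right square_integrable_product)
  show cscale: "cinner (c *\<^sub>C f) g = c * cinner f g" for c and f g :: l2
    by transfer (simp add: mult.assoc)
  show "inner f g = Re (cinner f g)" by (rule inner_l2_def)
  show "inner f g = inner g f" unfolding inner_l2_def by (subst comm) simp
  show "inner (f + g) h = inner f h + inner g h" by (simp add: inner_l2_def cadd)
  show "inner (r *\<^sub>R f) g = r * inner f g" by (simp add: inner_l2_def scaleR_l2_def cscale)
  show "0 \<le> inner f f" unfolding inner_l2_def
  proof transfer
    fix f assume "l2_rel f f"
    have "(\<integral>x. f x * cnj (f x) \<partial>mu) = (\<integral>x. complex_of_real ((cmod (f x))\<^sup>2) \<partial>mu)"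
      by (simp only: complex_norm_square)
    also have "\<dots> = complex_of_real (\<integral>x. (cmod (f x))\<^sup>2 \<partial>mu)" by (rule integral_complex_of_real)
    finally show "0 \<le> Re (\<integral>x. f x * cnj (f x) \<partial>mu)" by simp
  qed
  show "(inner f f = 0) = (f = 0)" unfolding inner_l2_def
  proof transfer
    fix f assume f: "l2_rel f f"
    have "(\<integral>x. f x * cnj (f x) \<partial>mu) = (\<integral>x. complex_of_real ((cmod (f x))\<^sup>2) \<partial>mu)"
      by (simp only: complex_norm_square)
    also have "\<dots> = complex_of_real (\<integral>x. (cmod (f x))\<^sup>2 \<partial>mu)" by (rule integral_complex_of_real)
    finally have "Re (\<integral>x. f x * cnj (f x) \<partial>mu) = 0 \<longleftrightarrow> (\<integral>x. (cmod (f x))\<^sup>2 \<partial>mu) = 0" by simp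
    also have "\<dots> \<longleftrightarrow> (AE x in mu. (cmod (f x))\<^sup>2 = 0)"
      using f by (intro integral_nonneg_eq_0_iff_AE) (auto simp: l2_rel_def square_integrable_def)
    also have "\<dots> \<longleftrightarrow> l2_rel f (\<lambda>x. 0)"
      using f square_integrable_zero by (simp add: l2_rel_def)
    finally show "(Re (\<integral>x. f x * cnj (f x) \<partial>mu) = 0) = l2_rel f (\<lambda>x. 0)" .
  qed
  show "norm f = sqrt (inner f f)" by (rule norm_l2_def)
  show "dist f g = norm (f - g)" by (rule dist_l2_def)
  show "sgn f = inverse (norm f) *\<^sub>R f" by (rule sgn_l2_def)
  show "uniformity = (INF e\<in>{0<..}. principal {(f::l2, g). dist f g < e})"
    by (rule uniformity_l2_def)
  show "open U = (\<forall>f\<in>U. \<forall>\<^sub>F (f', g) in uniformity. f' = f \<longrightarrow> g \<in> U)" for U :: "l2 set"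
    by (rule open_l2_def)
qed

end

section \<open>The Koopman representation and the isometries\<close>

lift_definition koopman_fun :: "grigorchuk \<Rightarrow> l2 \<Rightarrow> l2" is "\<lambda>g f x. f (boundary_act (- g) x)"
proof -
  fix g and f f' :: "bool stream \<Rightarrow> complex" assume a: "l2_rel f f'"
  let ?b = "boundary_act (- g)"
  have m [measurable]: "?b \<in> measurable mu mu" by (rule measurable_boundary_act)
  have "square_integrable (\<lambda>x. h (?b x))" if "square_integrable h" for h
  proof -
    have [measurable]: "h \<in> borel_measurable mu" using that by (simp add: square_integrable_def)
    have "integrable (distr mu mu ?b) (\<lambda>x. (cmod (h x))\<^sup>2)"
      using that by (simp add: boundary_act_measure_preserving square_integrable_def)
    then have "integrable mu (\<lambda>x. (cmod (h (?b x)))\<^sup>2)" by (subst (asm) integrable_distr_eq) simp_all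
    then show ?thesis by (simp add: square_integrable_def)
  qed
  moreover have "AE x in mu. f (?b x) = f' (?b x)"
  proof -
    have [measurable]: "f \<in> borel_measurable mu" "f' \<in> borel_measurable mu"
      using a by (auto simp: l2_rel_def square_integrable_def)
    have "AE x in distr mu mu ?b. f x = f' x"
      unfolding boundary_act_measure_preserving using a by (simp add: l2_rel_def)
    then show ?thesis by (rule AE_distrD[OF m])
  qed
  ultimately show "l2_rel (\<lambda>x. f (?b x)) (\<lambda>x. f' (?b x))" using a by (simp add: l2_rel_def)
qed

lemma norm_l2_eqI:
  fixes f g :: l2 assumes "cinner f f = cinner g g" shows "norm f = norm g"
  using assms by (simp add: norm_l2_def inner_l2_def)

lift_definition koopman :: "grigorchuk \<Rightarrow> l2 \<Rightarrow>\<^sub>L l2" is koopman_fun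
proof (rule bounded_linear_intro[where K = 1])
  fix g and f f' :: l2 and r :: real
  show "koopman_fun g (f + f') = koopman_fun g f + koopman_fun g f'"
  proof transfer
    show "l2_rel (\<lambda>x. f (boundary_act (- g) x) + f' (boundary_act (- g) x)) (\<lambda>x. f (boundary_act (- g) x) + f' (boundary_act (- g) x))"
      if "l2_rel f f" "l2_rel f' f'" for g f f'
      using koopman_fun.rsp plus_l2.rsp that unfolding rel_fun_def by fast
  qed
  show "koopman_fun g (r *\<^sub>R f) = r *\<^sub>R koopman_fun g f" unfolding scaleR_l2_def
  proof transfer
    show "l2_rel (\<lambda>x. complex_of_real r * f (boundary_act (- g) x)) (\<lambda>x. complex_of_real r * f (boundary_act (- g) x))"
      if "l2_rel f f" for g r f
      using koopman_fun.rsp scaleC_l2.rsp that unfolding rel_fun_def by fast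
  qed
  have "cinner (koopman_fun g f) (koopman_fun g f) = cinner f f"
  proof transfer
    fix g f assume "l2_rel f f"
    then have "f \<in> borel_measurable mu" by (simp add: l2_rel_def square_integrable_def)
    have "(\<integral>x. f (boundary_act (- g) x) * cnj (f (boundary_act (- g) x)) \<partial>mu) =
      (\<integral>x. f x * cnj (f x) \<partial>distr mu mu (boundary_act (- g)))"
      by (subst integral_distr[OF measurable_boundary_act])
        (auto intro!: borel_measurable_times measurable_cnj \<open>f \<in> borel_measurable mu\<close>)
    then show "(\<integral>x. f (boundary_act (- g) x) * cnj (f (boundary_act (- g) x)) \<partial>mu) = (\<integral>x. f x * cnj (f x) \<partial>mu)"
      by (simp add: boundary_act_measure_preserving)
  qed
  then show "norm (koopman_fun g f) \<le> norm f * 1" using norm_l2_eqI[of "koopman_fun g f" f] by simp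
qed

lemma stl_measure_preserving: "distr mu mu stl = mu"
proof (rule stream_space_eq_sstart[where S = UNIV])
  have stl: "stl \<in> measurable mu mu" unfolding mu_def by (rule measurable_stl)
  fix w :: "bool list"
  have S: "sstart UNIV w \<in> sets mu" for w by (simp add: sets_mu sets_sstart)
  have "stl -` sstart UNIV w \<inter> space mu = sstart UNIV (False # w) \<union> sstart UNIV (True # w)" by auto
  then have "emeasure (distr mu mu stl) (sstart UNIV w) =
      emeasure mu (sstart UNIV (False # w) \<union> sstart UNIV (True # w))"
    using S by (simp add: emeasure_distr stl)
  also have "\<dots> = emeasure mu (sstart UNIV (False # w)) + emeasure mu (sstart UNIV (True # w))"
    by (rule plus_emeasure[symmetric]) (use S in auto)
  also have "\<dots> = ennreal ((1/2) ^ length w)"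
    unfolding emeasure_mu_cylinder by (subst ennreal_plus[symmetric]) auto
  finally show "emeasure (distr mu mu stl) (sstart UNIV w) = emeasure mu (sstart UNIV w)"
    by (simp only: emeasure_mu_cylinder)
  show "prob_space (distr mu mu stl)" by (rule mu.prob_space_distr[OF stl])
qed (simp_all add: sets_mu prob_space_mu)

lemma integrable_stl:
  fixes h :: "bool stream \<Rightarrow> real"
  assumes "integrable mu h"
  shows "integrable mu (\<lambda>x. h (stl x))" "(\<integral>x. h (stl x) \<partial>mu) = (\<integral>x. h x \<partial>mu)"
proof -
  have stl: "stl \<in> measurable mu mu" unfolding mu_def by (rule measurable_stl)
  have h: "h \<in> borel_measurable mu" using assms by simp
  show "integrable mu (\<lambda>x. h (stl x))"
    using integrable_distr_eq[OF stl h] assms by (simp add: stl_measure_preserving)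
  show "(\<integral>x. h (stl x) \<partial>mu) = (\<integral>x. h x \<partial>mu)"
    using integral_distr[OF stl h] by (simp add: stl_measure_preserving)
qed

lift_definition branch_fun :: "bool \<Rightarrow> l2 \<Rightarrow> l2"
  is "\<lambda>i f x. if shd x = i then complex_of_real (sqrt 2) * f (stl x) else 0"
proof -
  fix i and f f' :: "bool stream \<Rightarrow> complex" assume a: "l2_rel f f'"
  let ?s = "\<lambda>(f :: bool stream \<Rightarrow> complex) x. if shd x = i then complex_of_real (sqrt 2) * f (stl x) else 0"
  have stl [measurable]: "stl \<in> measurable mu mu" unfolding mu_def by (rule measurable_stl)
  have shd [measurable]: "shd \<in> measurable mu (count_space UNIV)"
    using measurable_shd[of "measure_pmf (pmf_of_set UNIV)"] by (simp add: mu_def)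
  have "square_integrable (?s h)" if h: "square_integrable h" for h
  proof -
    have [measurable]: "h \<in> borel_measurable mu" using h by (simp add: square_integrable_def)
    have m: "?s h \<in> borel_measurable mu" by measurable
    have "integrable mu (\<lambda>x. (cmod (?s h x))\<^sup>2)"
    proof (rule Bochner_Integration.integrable_bound)
      show "integrable mu (\<lambda>x. 2 * (cmod (h (stl x)))\<^sup>2)"
        using h integrable_stl(1)[of "\<lambda>x. (cmod (h x))\<^sup>2"] by (simp add: square_integrable_def)
      show "AE x in mu. norm ((cmod (?s h x))\<^sup>2) \<le> norm (2 * (cmod (h (stl x)))\<^sup>2)"
        by (rule AE_I2) (simp add: norm_mult power_mult_distrib)
    qed (use m in measurable)
    with m show ?thesis by (simp add: square_integrable_def)
  qed
  moreover have "AE x in mu. ?s f x = ?s f' x"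
  proof -
    have [measurable]: "f \<in> borel_measurable mu" "f' \<in> borel_measurable mu"
      using a by (auto simp: l2_rel_def square_integrable_def)
    have "AE x in distr mu mu stl. f x = f' x"
      unfolding stl_measure_preserving using a by (simp add: l2_rel_def)
    then have "AE x in mu. f (stl x) = f' (stl x)" by (rule AE_distrD[OF stl])
    then show ?thesis by eventually_elim simp
  qed
  ultimately show "l2_rel (?s f) (?s f')" using a by (simp add: l2_rel_def)
qed

lift_definition branch :: "bool \<Rightarrow> l2 \<Rightarrow>\<^sub>L l2" is branch_fun
proof (rule bounded_linear_intro[where K = "sqrt 2"])
  fix i and f f' :: l2 and r :: real
  have rsp: "l2_rel (\<lambda>x. if shd x = i then complex_of_real (sqrt 2) * f (stl x) else 0)
      (\<lambda>x. if shd x = i then complex_of_real (sqrt 2) * f (stl x) else 0)" if "l2_rel f f" for i f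
    by (rule branch_fun.rsp[unfolded rel_fun_def, rule_format, OF refl that])
  show "branch_fun i (f + f') = branch_fun i f + branch_fun i f'"
  proof transfer
    fix i f f' assume "l2_rel f f" "l2_rel f' f'"
    then have "l2_rel (\<lambda>x. f x + f' x) (\<lambda>x. f x + f' x)"
      by (rule plus_l2.rsp[unfolded rel_fun_def, rule_format])
    note r = rsp[OF this, of i]
    have "(\<lambda>x. (if shd x = i then complex_of_real (sqrt 2) * f (stl x) else 0) +
        (if shd x = i then complex_of_real (sqrt 2) * f' (stl x) else 0)) =
      (\<lambda>x. if shd x = i then complex_of_real (sqrt 2) * (f (stl x) + f' (stl x)) else 0)"
      by (rule ext) (simp add: distrib_left)
    then show "l2_rel (\<lambda>x. if shd x = i then complex_of_real (sqrt 2) * (f (stl x) + f' (stl x)) else 0)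
      (\<lambda>x. (if shd x = i then complex_of_real (sqrt 2) * f (stl x) else 0) +
        (if shd x = i then complex_of_real (sqrt 2) * f' (stl x) else 0))"
      by (rule ssubst) (rule r)
  qed
  show "branch_fun i (r *\<^sub>R f) = r *\<^sub>R branch_fun i f" unfolding scaleR_l2_def
  proof transfer
    fix i f and r :: real assume "l2_rel f f"
    then have "l2_rel (\<lambda>x. complex_of_real r * f x) (\<lambda>x. complex_of_real r * f x)"
      by (rule scaleC_l2.rsp[unfolded rel_fun_def, rule_format, OF refl])
    note q = rsp[OF this, of i]
    have "(\<lambda>x. complex_of_real r * (if shd x = i then complex_of_real (sqrt 2) * f (stl x) else 0)) =
      (\<lambda>x. if shd x = i then complex_of_real (sqrt 2) * (complex_of_real r * f (stl x)) else 0)"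
      by (rule ext) simp
    then show "l2_rel (\<lambda>x. if shd x = i then complex_of_real (sqrt 2) * (complex_of_real r * f (stl x)) else 0)
      (\<lambda>x. complex_of_real r * (if shd x = i then complex_of_real (sqrt 2) * f (stl x) else 0))"
      by (rule ssubst) (rule q)
  qed
  have "Re (cinner (branch_fun i f) (branch_fun i f)) \<le> 2 * Re (cinner f f)"
  proof transfer
    fix i f assume f: "l2_rel f f"
    let ?s = "\<lambda>x. if shd x = i then complex_of_real (sqrt 2) * f (stl x) else 0"
    have *: "Re (\<integral>x. h x * cnj (h x) \<partial>mu) = (\<integral>x. (cmod (h x))\<^sup>2 \<partial>mu)" for h
    proof -
      have "(\<integral>x. h x * cnj (h x) \<partial>mu) = (\<integral>x. complex_of_real ((cmod (h x))\<^sup>2) \<partial>mu)"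
        by (simp only: complex_norm_square)
      also have "\<dots> = complex_of_real (\<integral>x. (cmod (h x))\<^sup>2 \<partial>mu)" by (rule integral_complex_of_real)
      finally show ?thesis by simp
    qed
    have i: "integrable mu (\<lambda>x. (cmod (f x))\<^sup>2)" "integrable mu (\<lambda>x. (cmod (?s x))\<^sup>2)"
      using f rsp[OF f, of i] unfolding l2_rel_def square_integrable_def by blast+
    have "(\<integral>x. (cmod (?s x))\<^sup>2 \<partial>mu) \<le> (\<integral>x. 2 * (cmod (f (stl x)))\<^sup>2 \<partial>mu)"
    proof (rule integral_mono[OF i(2)])
      show "integrable mu (\<lambda>x. 2 * (cmod (f (stl x)))\<^sup>2)" using integrable_stl(1)[OF i(1)] by simp
      show "(cmod (?s x))\<^sup>2 \<le> 2 * (cmod (f (stl x)))\<^sup>2" for x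
        by (simp add: norm_mult power_mult_distrib)
    qed
    also have "\<dots> = 2 * (\<integral>x. (cmod (f x))\<^sup>2 \<partial>mu)" using integrable_stl(2)[OF i(1)] by simp
    finally show "Re (\<integral>x. ?s x * cnj (?s x) \<partial>mu) \<le> 2 * Re (\<integral>x. f x * cnj (f x) \<partial>mu)"
      unfolding * .
  qed
  then have "sqrt (Re (cinner (branch_fun i f) (branch_fun i f))) \<le> sqrt (2 * Re (cinner f f))"
    by (rule real_sqrt_le_mono)
  then show "norm (branch_fun i f) \<le> norm f * sqrt 2"
    by (simp add: norm_l2_def inner_l2_def real_sqrt_mult mult.commute)
qed

text \<open>\<open>S\<^sub>v = s\<^bsub>i\<^sub>1\<^esub> \<dots> s\<^bsub>i\<^sub>n\<^esub>\<close> for \<open>v = i\<^sub>1 \<dots> i\<^sub>n\<close>, where \<open>branch i\<close> is \<open>s\<^sub>i\<close>.\<close>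

definition word_isometry :: "bool list \<Rightarrow> l2 \<Rightarrow>\<^sub>L l2" where
  "word_isometry v = foldr (\<lambda>i T. branch i o\<^sub>L T) v id_blinfun"

text \<open>
  Unitarity: each \<open>\<rho> g\<close> is linear over the complex numbers, preserves the inner product, and is
  onto because \<open>\<rho> (- g)\<close> is its inverse.
\<close>

definition unitary_rep :: "(grigorchuk \<Rightarrow> l2 \<Rightarrow>\<^sub>L l2) \<Rightarrow> bool" where
  "unitary_rep \<rho> \<longleftrightarrow>
    \<rho> 0 = id_blinfun \<and> (\<forall>g h. \<rho> (g + h) = \<rho> g o\<^sub>L \<rho> h) \<and>
    (\<forall>g c f. \<rho> g (c *\<^sub>C f) = c *\<^sub>C \<rho> g f) \<and>
    (\<forall>g f k. cinner (\<rho> g f) (\<rho> g k) = cinner f k)"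

definition self_similar :: "(grigorchuk \<Rightarrow> l2 \<Rightarrow>\<^sub>L l2) \<Rightarrow> bool" where
  "self_similar \<rho> \<longleftrightarrow>
    unitary_rep \<rho> \<and>
    (\<forall>g v. \<rho> g o\<^sub>L word_isometry v = word_isometry (act g v) o\<^sub>L \<rho> (section_at g v))"

section \<open>The group algebra and the operator algebras\<close>

type_synonym group_algebra = "grigorchuk \<Rightarrow>\<^sub>0 complex"

lift_definition group_algebra_star :: "('g::group_add \<Rightarrow>\<^sub>0 complex) \<Rightarrow> 'g \<Rightarrow>\<^sub>0 complex" is "\<lambda>x g. cnj (x (- g))"
proof -
  fix x :: "'g \<Rightarrow> complex" assume "finite {g. x g \<noteq> 0}"
  then have "finite (uminus ` {g. x g \<noteq> 0})" by (rule finite_imageI)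
  moreover have "{g. cnj (x (- g)) \<noteq> 0} \<subseteq> uminus ` {g. x g \<noteq> 0}"
  proof
    fix g assume "g \<in> {g. cnj (x (- g)) \<noteq> 0}"
    then have "g = - (- g)" "- g \<in> {g. x g \<noteq> 0}" by auto
    then show "g \<in> uminus ` {g. x g \<noteq> 0}" by (rule image_eqI)
  qed
  ultimately show "finite {g. cnj (x (- g)) \<noteq> 0}" by (rule rev_finite_subset)
qed

definition extend_rep :: "(grigorchuk \<Rightarrow> l2 \<Rightarrow>\<^sub>L l2) \<Rightarrow> group_algebra \<Rightarrow> l2 \<Rightarrow>\<^sub>L l2" where
  "extend_rep \<rho> x = (\<Sum>g\<in>Poly_Mapping.keys x. Poly_Mapping.lookup x g *\<^sub>C \<rho> g)"

definition koopman_algebra :: "(l2 \<Rightarrow>\<^sub>L l2) set" where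
  "koopman_algebra = range (extend_rep koopman)"

definition koopman_cstar :: "(l2 \<Rightarrow>\<^sub>L l2) set" where
  "koopman_cstar = closure koopman_algebra"

text \<open>
  The type \<open>'h \<Rightarrow>\<^sub>L 'h\<close> consists of the bounded real-linear operators with the operator norm. All
  operators that occur below, in particular those in \<open>koopman_cstar\<close>, are complex-linear, and the
  adjoint is taken with respect to the complex inner product.
\<close>

definition cadjoint :: "('h::complex_inner \<Rightarrow>\<^sub>L 'h) \<Rightarrow> 'h \<Rightarrow>\<^sub>L 'h" where
  "cadjoint T = (THE S :: 'h \<Rightarrow>\<^sub>L 'h. \<forall>x y. cinner (T x) y = cinner x (S y))"

definition cfinite_dim :: "'a::complex_vector set \<Rightarrow> bool" where
  "cfinite_dim V \<longleftrightarrow> (\<exists>F. finite F \<and> V \<subseteq> cvec.span F)"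

text \<open>
  A Hilbert space is given as a complete complex subspace \<open>H\<close> of a complex inner product space
  \<open>'h\<close>, so that one can quantify over Hilbert spaces of varying dimension. Operators on \<open>H\<close> are
  represented by functions \<open>'h \<Rightarrow> 'h\<close> that vanish outside \<open>H\<close>, so that two of them are equal
  iff they agree on \<open>H\<close>.
\<close>

definition hilbert_space_on :: "'h::complex_inner set \<Rightarrow> bool" where
  "hilbert_space_on H \<longleftrightarrow> cvec.subspace H \<and> Topological_Spaces.complete H"

definition bounded_operator_on :: "'h::complex_inner set \<Rightarrow> ('h \<Rightarrow> 'h) \<Rightarrow> bool" where
  "bounded_operator_on H T \<longleftrightarrow>
    (\<forall>x\<in>H. T x \<in> H) \<and> (\<forall>x. x \<notin> H \<longrightarrow> T x = 0) \<and>
    (\<forall>x\<in>H. \<forall>y\<in>H. T (x + y) = T x + T y) \<and> (\<forall>c. \<forall>x\<in>H. T (c *\<^sub>C x) = c *\<^sub>C T x) \<and>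
    (\<exists>K. \<forall>x\<in>H. norm (T x) \<le> K * norm x)"

text \<open>
  \<open>\<phi>\<close> is a unital *-representation on \<open>H\<close> of the unital *-algebra with carrier \<open>A\<close>,
  multiplication \<open>mul\<close>, unit \<open>e\<close> and involution \<open>star\<close>; addition and scalar multiplication are
  those of the ambient complex vector space.
\<close>

definition star_rep ::
  "'a::complex_vector set \<Rightarrow> ('a \<Rightarrow> 'a \<Rightarrow> 'a) \<Rightarrow> 'a \<Rightarrow> ('a \<Rightarrow> 'a) \<Rightarrow>
    'h::complex_inner set \<Rightarrow> ('a \<Rightarrow> 'h \<Rightarrow> 'h) \<Rightarrow> bool" where
  "star_rep A mul e star H \<phi> \<longleftrightarrow>
    hilbert_space_on H \<and>
    (\<forall>a\<in>A. bounded_operator_on H (\<phi> a)) \<and>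
    (\<forall>a\<in>A. \<forall>b\<in>A. \<phi> (a + b) = \<phi> a + \<phi> b) \<and>
    (\<forall>c. \<forall>a\<in>A. \<phi> (c *\<^sub>C a) = c *\<^sub>C \<phi> a) \<and>
    (\<forall>a\<in>A. \<forall>b\<in>A. \<phi> (mul a b) = \<phi> a \<circ> \<phi> b) \<and>
    \<phi> e = (\<lambda>x. if x \<in> H then x else 0) \<and>
    (\<forall>a\<in>A. \<forall>x\<in>H. \<forall>y\<in>H. cinner (\<phi> a x) y = cinner x (\<phi> (star a) y))"

text \<open>
  HOL cannot quantify over types inside a definition, so the type \<open>'h\<close> whose complete subspaces
  serve as Hilbert spaces is a parameter in the next two definitions. For \<open>'h = l2\<close> nothing is lost:
  up to isometry the complete subspaces of \<open>l2\<close> are all separable Hilbert spaces, in particular all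
  finite dimensional ones; and the group algebra has countable dimension, so every
  *-representation of it has the same kernel (hence an isomorphic image) as one on a separable
  Hilbert space.
\<close>

definition residually_finite_dim :: "'h::complex_inner itself \<Rightarrow> (l2 \<Rightarrow>\<^sub>L l2) set \<Rightarrow> bool" where
  "residually_finite_dim _ A \<longleftrightarrow>
    (\<exists>\<F> :: ('h set \<times> ((l2 \<Rightarrow>\<^sub>L l2) \<Rightarrow> 'h \<Rightarrow> 'h)) set.
      (\<forall>(H, \<phi>)\<in>\<F>. star_rep A (o\<^sub>L) id_blinfun cadjoint H \<phi> \<and> cfinite_dim H) \<and>
      (\<forall>x\<in>A. x \<noteq> 0 \<longrightarrow> (\<exists>(H, \<phi>)\<in>\<F>. \<phi> x \<noteq> 0)))"

definition star_just_infinite :: "'h::complex_inner itself \<Rightarrow> bool" where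
  "star_just_infinite _ \<longleftrightarrow>
    (\<forall>(H :: 'h set) (\<phi> :: group_algebra \<Rightarrow> 'h \<Rightarrow> 'h).
      star_rep UNIV (*) 1 group_algebra_star H \<phi> \<longrightarrow> inj \<phi> \<or> cfinite_dim (range \<phi>))"

definition operator_ring :: "(l2 \<Rightarrow>\<^sub>L l2) set \<Rightarrow> (l2 \<Rightarrow>\<^sub>L l2) ring" where
  "operator_ring B = \<lparr>carrier = B, monoid.mult = (o\<^sub>L), one = id_blinfun, zero = 0, add = (+)\<rparr>"

text \<open>
  The quotient of \<open>B\<close> by \<open>J\<close> is spanned by the classes of the finitely many elements of \<open>F\<close>: a
  linear combination of classes is the class of the linear combination.
\<close>

definition finite_dim_quotient :: "(l2 \<Rightarrow>\<^sub>L l2) set \<Rightarrow> (l2 \<Rightarrow>\<^sub>L l2) set \<Rightarrow> bool" where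
  "finite_dim_quotient B J \<longleftrightarrow>
    (\<exists>F. finite F \<and> F \<subseteq> B \<and>
      carrier (operator_ring B Quot J) = (\<lambda>x. J +>\<^bsub>operator_ring B\<^esub> x) ` cvec.span F)"

text \<open>
  The ideals here are the two-sided ideals of the library. Since \<open>koopman_algebra\<close> contains the
  scalar multiples of the identity, its ring ideals are automatically complex subspaces.
\<close>

definition just_infinite :: "(l2 \<Rightarrow>\<^sub>L l2) set \<Rightarrow> bool" where
  "just_infinite B \<longleftrightarrow>
    \<not> cfinite_dim B \<and>
    (\<forall>J. ideal J (operator_ring B) \<and> J \<noteq> {0} \<longrightarrow> finite_dim_quotient B J)"

text \<open>
  A trace is a tracial state. Boundedness is not required separately: it is automatic for positive
  functionals on a unital C*-algebra.
\<close>

definition faithful_trace :: "(l2 \<Rightarrow>\<^sub>L l2) set \<Rightarrow> ((l2 \<Rightarrow>\<^sub>L l2) \<Rightarrow> complex) \<Rightarrow> bool" where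
  "faithful_trace A \<tau> \<longleftrightarrow>
    (\<forall>x\<in>A. \<forall>y\<in>A. \<tau> (x + y) = \<tau> x + \<tau> y) \<and> (\<forall>c. \<forall>x\<in>A. \<tau> (c *\<^sub>C x) = c * \<tau> x) \<and>
    (\<forall>x\<in>A. Im (\<tau> (cadjoint x o\<^sub>L x)) = 0 \<and> 0 \<le> Re (\<tau> (cadjoint x o\<^sub>L x))) \<and>
    \<tau> id_blinfun = 1 \<and>
    (\<forall>x\<in>A. \<forall>y\<in>A. \<tau> (x o\<^sub>L y) = \<tau> (y o\<^sub>L x)) \<and>
    (\<forall>x\<in>A. \<tau> (cadjoint x o\<^sub>L x) = 0 \<longrightarrow> x = 0)"

end

theory Submission
  imports Defs
begin

text \<open>
  The space \<open>L\<^sup>2\<close> is the closure of the increasing union of the invariant spaces of functions that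
  depend on the first \<open>n\<close> letters only; these give the finite dimensional representations, and the
  normalised traces on them converge to a trace. This trace is faithful because the generators have
  only two nontrivial sections at each level: the isometries \<open>V\<^sup>n\<close>, \<open>V = (s\<^sub>0 + s\<^sub>1) / \<surd>2\<close>, are
  asymptotically invariant, so a nonzero matrix coefficient \<open>t\<close> of \<open>T\<close> with respect to the
  cylinder functions makes a matrix entry of \<open>T\<close> act on \<open>V\<^sup>n\<close> almost as the scalar \<open>t\<close>, which bounds
  the trace of \<open>T\<^sup>*T\<close> from below.

  For just-infiniteness, let \<open>K\<close> be the ideal of \<open>B\<close> generated by \<open>ab - ba\<close>. It satisfies
  \<open>s\<^sub>i K s\<^sub>j\<^sup>* \<subseteq> K\<close>, and both \<open>K\<close> and \<open>K\<^sup>2\<close> have finite codimension. All sections of a given finite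
  set of group elements at a suitable deep vertex are trivial, so a nonzero element of an ideal \<open>J\<close>
  has a nonzero scalar matrix entry at some level \<open>n\<close>; hence \<open>S\<^sub>p K\<^sup>2 S\<^sub>q\<^sup>* \<subseteq> J\<close> for all words
  \<open>p\<close>, \<open>q\<close> of length \<open>n\<close>.
\<close>

section \<open>Complex inner product spaces\<close>

text \<open>The square of K appears for the following reason. If x in J has a scalar entry at p, q,
  one would like to multiply it by S_r S_p^* and S_q S_s^*, but for nonempty words these operators
  do not lie in B: elements of B preserve the constant functions. Elements z, z' of K serve as
  carriers, S_r z S_p^* and S_q z' S_s^* being in B, and what reaches J is S_r z z' S_s^*.

  The commutator comes from the group: ab - ba and (ab)^2 - 1 differ by an invertible factor, and
  the normal closure of (ab)^2 is the classical branching subgroup. The generator d, trivial below 0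
  and equal to b below 1, separates the two halves.

  Exact scalar entries are available only for finitely supported combinations, since a common vertex
  with trivial sections is required. For limits the isometries V^n are the substitute: they give
  scalars asymptotically, with an error bounded by the operator norm uniformly in n.

  Cylinder functions are shown to be total only in the sense that nothing nonzero is orthogonal to
  all of them. Adjoints inside the closure turn this into a criterion for operators to
  vanish.\<close>

lemma cinner_add_right: "cinner x (y + z) = cinner x y + cinner x (z :: 'a::complex_inner)"
  by (metis cinner_add_left cinner_commute complex_cnj_add)

lemma cinner_scaleC_right: "cinner x (c *\<^sub>C y) = cnj c * cinner x (y :: 'a::complex_inner)"
  by (metis cinner_commute cinner_scaleC_left complex_cnj_mult)

lemma cinner_zero [simp]: "cinner 0 y = 0" "cinner y 0 = 0" for y :: "'a::complex_inner"
  using cinner_add_left[of 0 0 y] cinner_add_right[of y 0 0] by auto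

lemma cinner_sum_left: "cinner (sum f A) y = (\<Sum>i\<in>A. cinner (f i) (y :: 'a::complex_inner))"
  by (induction A rule: infinite_finite_induct) (auto simp: cinner_add_left)

lemma cinner_diff_left: "cinner (x - y) z = cinner x z - cinner y (z :: 'a::complex_inner)"
  using cinner_add_left[of "x - y" y z] by simp

lemma cinner_diff_right: "cinner z (x - y) = cinner z x - cinner (z :: 'a::complex_inner) y"
  using cinner_add_right[of z "x - y" y] by simp

lemma cinner_self: "cinner x x = complex_of_real ((norm (x :: 'a::complex_inner))\<^sup>2)"
proof (rule complex_eqI)
  show "Re (cinner x x) = Re (complex_of_real ((norm x)\<^sup>2))"
    by (simp add: inner_eq_Re_cinner[symmetric] power2_norm_eq_inner)
  have "Im (cinner x x) = Im (cnj (cinner x x))" by (metis cinner_commute)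
  then show "Im (cinner x x) = Im (complex_of_real ((norm x)\<^sup>2))" by simp
qed

lemma cinner_cauchy_schwarz: "cmod (cinner x y) \<le> norm x * norm (y :: 'a::complex_inner)"
proof (cases "cinner x y = 0")
  case False
  \<comment> \<open>This phase makes the product of the rotated x with y real and nonnegative, which
    reduces the claim to the real Cauchy-Schwarz inequality.\<close>
  define c where "c = cnj (cinner x y) / complex_of_real (cmod (cinner x y))"
  have c: "cmod c = 1" using False by (simp add: c_def norm_divide)
  have "cinner (c *\<^sub>C x) y = complex_of_real (cmod (cinner x y))"
    using False complex_norm_square[of "cinner x y"]
    by (simp add: c_def cinner_scaleC_left power2_eq_square field_simps)
  then have "cmod (cinner x y) = inner (c *\<^sub>C x) y" by (simp add: inner_eq_Re_cinner)
  also have "\<dots> \<le> norm (c *\<^sub>C x) * norm y" by (rule norm_cauchy_schwarz)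
  finally show ?thesis using c by (simp add: norm_scaleC)
qed simp

lemma bounded_bilinear_cinner: "bounded_bilinear (cinner :: 'a::complex_inner \<Rightarrow> 'a \<Rightarrow> complex)"
proof
  show "cinner (r *\<^sub>R x) y = r *\<^sub>R cinner x y" for r and x y :: 'a
    by (simp add: scaleR_scaleC cinner_scaleC_left scaleR_conv_of_real)
  show "cinner x (r *\<^sub>R y) = r *\<^sub>R cinner x y" for r and x y :: 'a
    by (simp add: scaleR_scaleC cinner_scaleC_right scaleR_conv_of_real)
  show "\<exists>K. \<forall>x y :: 'a. norm (cinner x y) \<le> norm x * norm y * K"
    using cinner_cauchy_schwarz by (intro exI[of _ 1]) auto
qed (simp_all add: cinner_add_left cinner_add_right)

lemma cinner_eqI:
  fixes x y :: "'a::complex_inner"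
  assumes "\<And>z. cinner x z = cinner y z" shows "x = y"
proof -
  have "cinner (x - y) (x - y) = 0" using assms by (simp add: cinner_diff_left)
  then show ?thesis by (simp add: cinner_self)
qed

lemma scaleC_minus_one: "(- 1) *\<^sub>C x = - (x :: 'a::complex_vector)"
  by (metis cvec.scale_minus_left scaleC_one)

lemma bounded_linear_scaleC: "bounded_linear ((*\<^sub>C) c :: 'a::complex_inner \<Rightarrow> 'a)"
proof (rule bounded_linear_intro[where K = "cmod c"])
  show "c *\<^sub>C r *\<^sub>R x = r *\<^sub>R c *\<^sub>C x" for r and x :: 'a
    by (simp add: scaleR_scaleC scaleC_scaleC mult.commute)
qed (simp_all add: scaleC_add_right norm_scaleC mult.commute)

lemma scaleC_blinfun_apply [simp]: "(c *\<^sub>C T) x = c *\<^sub>C T x"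
  for T :: "'a::real_normed_vector \<Rightarrow>\<^sub>L 'b::complex_inner"
  by transfer simp

lemma norm_scaleC_blinfun: "norm (c *\<^sub>C T) = cmod c * norm T"
  for T :: "'a::real_normed_vector \<Rightarrow>\<^sub>L 'b::complex_inner"
proof -
  have le: "norm (c *\<^sub>C T) \<le> cmod c * norm T" for c and T :: "'a \<Rightarrow>\<^sub>L 'b"
    by (rule norm_blinfun_bound)
      (auto simp: norm_scaleC mult.assoc intro!: mult_left_mono norm_blinfun)
  show ?thesis
  proof (cases "c = 0")
    case False
    have "norm T = norm (inverse c *\<^sub>C c *\<^sub>C T)" using False by (simp add: scaleC_scaleC scaleC_one)
    also have "\<dots> \<le> inverse (cmod c) * norm (c *\<^sub>C T)" using le[of "inverse c" "c *\<^sub>C T"] by (simp only: norm_inverse)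
    finally have "cmod c * norm T \<le> norm (c *\<^sub>C T)" using False by (simp add: field_simps)
    with le[of c T] show ?thesis by simp
  qed simp
qed

section \<open>The cocycle of sections and self-similarity\<close>

section \<open>Sections of elements of the group\<close>

lemma act_eqI: "(\<And>w. act g w = act h w) \<Longrightarrow> g = h"
  by (simp add: act_inject[symmetric] fun_eq_iff)

lemma section_at_eqI: "(\<And>w. act g (v @ w) = act g v @ act h w) \<Longrightarrow> section_at g v = h"
  unfolding section_at_def by (rule the1_equality[OF ex1_section]) blast

lemma section_at_add: "section_at (g + h) v = section_at g (act h v) + section_at h v"
  by (rule section_at_eqI) (simp add: act_add act_append)

lemma section_at_zero [simp]: "section_at 0 v = 0"
  by (rule section_at_eqI) (simp add: act_zero)

lemma section_at_Nil [simp]: "section_at g [] = g"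
proof (rule section_at_eqI)
  have "act g [] = []" using length_act[of g "[]"] by (simp only: list.size length_0_conv)
  then show "act g ([] @ w) = act g [] @ act g w" for w by simp
qed

lemma section_at_uminus: "section_at (- g) (act g v) = - section_at g v"
proof -
  have "section_at (- g) (act g v) + section_at g v = 0"
    using section_at_add[of "- g" g v] by simp
  then show ?thesis by (simp add: eq_neg_iff_add_eq_0)
qed

lemma section_at_append: "section_at g (v @ w) = section_at (section_at g v) w"
proof (rule section_at_eqI)
  show "act g ((v @ w) @ u) = act g (v @ w) @ act (section_at (section_at g v) w) u" for u
    using act_append[of g v "w @ u"] by (simp add: act_append)
qed

lemma act_inj: "act g v = act g w \<longleftrightarrow> v = w"
  by (metis act_uminus(1))

lemma act_letter: "act g [i] = [hd (act g [i])]"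
  using length_act[of g "[i]"] by (cases "act g [i]") auto

lemma act_Cons: "act g (i # v) = hd (act g [i]) # act (section_at g [i]) v"
  using act_append[of g "[i]" v] act_letter[of g i] by (metis append_Cons append_Nil)

section \<open>Self-similarity of the Koopman representation\<close>

text \<open>The offset k restricts attention to prefixes that contain a given word of length k
  entirely, which is the situation in which \<open>act_append\<close> applies.\<close>

lemma stake_eqI:
  assumes "\<And>n. stake (k + n) s = stake (k + n) s'"
  shows "s = s'"
proof -
  have "s !! n = s' !! n" for n
  proof -
    have "stake (k + Suc n) s ! n = s !! n" "stake (k + Suc n) s' ! n = s' !! n"
      by (rule stake_nth, simp)+
    with assms[of "Suc n"] show ?thesis by simp
  qed
  then show ?thesis using smap_alt[of "\<lambda>x. x" s s'] by (simp add: stream.map_ident)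
qed

lemma boundary_act_shift: "boundary_act g (v @- x) = act g v @- boundary_act (section_at g v) x"
  by (rule stake_eqI[where k = "length v"]) (simp add: stake_boundary_act stake_shift act_append)

lemma stake_one: "stake 1 x = [shd x]"
  by simp

text \<open>The point g^-1 x begins with i exactly when x begins with j = g(i), and then its tail is
  the image of the tail of x under the inverse of the section of g at i.\<close>

lemma koopman_fun_branch_fun:
  "koopman_fun g (branch_fun i f) = branch_fun (hd (act g [i])) (koopman_fun (section_at g [i]) f)"
proof -
  define j where "j = hd (act g [i])"
  define h where "h = section_at g [i]"
  have j: "act g [i] = [j]" unfolding j_def by (rule act_letter)
  have 1: "boundary_act (- g) x = i ## boundary_act (- h) (stl x)" if "shd x = j" for x
  proof -
    have "boundary_act (- g) ([j] @- stl x) = act (- g) [j] @- boundary_act (section_at (- g) [j]) (stl x)"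
      by (rule boundary_act_shift)
    moreover have "act (- g) [j] = [i]" "section_at (- g) [j] = - h"
      using act_uminus(1)[of g "[i]"] section_at_uminus[of g "[i]"] by (simp_all add: j h_def)
    moreover have "[j] @- stl x = x" using that by (cases x) auto
    ultimately show ?thesis by simp
  qed
  have 2: "shd x = j" if "shd (boundary_act (- g) x) = i" for x
  proof -
    have "act g [shd (boundary_act (- g) x)] = act g (act (- g) [shd x])"
      using stake_boundary_act[of 1 "- g" x] by (simp add: stake_one)
    then show ?thesis using that j by (simp add: act_uminus)
  qed
  \<comment> \<open>The two representatives agree at every point, not only almost everywhere, so
    passing to classes is mere rewriting.\<close>
  have eq: "(\<lambda>x. if shd (boundary_act (- g) x) = i then complex_of_real (sqrt 2) * F (stl (boundary_act (- g) x)) else 0)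
     = (\<lambda>x. if shd x = j then complex_of_real (sqrt 2) * F (boundary_act (- h) (stl x)) else 0)" for F
  proof (rule ext)
    show "(if shd (boundary_act (- g) x) = i then complex_of_real (sqrt 2) * F (stl (boundary_act (- g) x)) else 0)
      = (if shd x = j then complex_of_real (sqrt 2) * F (boundary_act (- h) (stl x)) else 0)" for x
    proof (cases "shd x = j")
      case True
      from 1[OF this] show ?thesis by (simp only: True stream.sel simp_thms if_True)
    next
      case False
      with 2[of x] have "shd (boundary_act (- g) x) \<noteq> i" by blast
      with False show ?thesis by (simp only: if_False)
    qed
  qed
  have "koopman_fun g (branch_fun i f) = branch_fun j (koopman_fun h f)"
  proof (induction f rule: l2.abs_induct)
    case (1 F)
    note k = koopman_fun.rsp[unfolded rel_fun_def, rule_format, OF refl]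
    note b = branch_fun.rsp[unfolded rel_fun_def, rule_format, OF refl]
    show ?case
      by (simp only: koopman_fun.abs_eq[OF b[OF 1]] koopman_fun.abs_eq[OF 1] branch_fun.abs_eq[OF 1]
          branch_fun.abs_eq[OF k[OF 1]] eq)
  qed
  then show ?thesis by (simp add: j_def h_def)
qed

lemma koopman_branch:
  "koopman g (branch i f) = branch (hd (act g [i])) (koopman (section_at g [i]) f)"
  by (simp add: koopman.rep_eq branch.rep_eq koopman_fun_branch_fun)

lemma word_isometry_Nil [simp]: "word_isometry [] = id_blinfun"
  and word_isometry_Cons [simp]: "word_isometry (i # v) = branch i o\<^sub>L word_isometry v"
  by (simp_all add: word_isometry_def)

lemma koopman_word_isometry:
  "koopman g (word_isometry v f) = word_isometry (act g v) (koopman (section_at g v) f)"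
proof (induction v arbitrary: g)
  case Nil
  have "act g [] = []" using length_act[of g "[]"] by (simp only: list.size length_0_conv)
  then show ?case by simp
next
  case (Cons i v)
  then show ?case
    using section_at_append[of g "[i]" v]
    by (simp only: koopman_branch act_Cons[of g i v] word_isometry_Cons blinfun_apply_blinfun_compose append.simps)
qed

lemma koopman_zero: "koopman 0 = id_blinfun"
proof (rule blinfun_eqI)
  fix f
  have b: "boundary_act 0 x = x" for x
    by (rule stake_eqI[where k = 0]) (simp add: stake_boundary_act act_zero)
  show "koopman 0 f = id_blinfun f"
    unfolding koopman.rep_eq blinfun_apply_id_blinfun id_def by (induction f rule: l2.abs_induct) (simp add: koopman_fun.abs_eq b)
qed

lemma koopman_add: "koopman (g + h) = koopman g o\<^sub>L koopman h"
proof (rule blinfun_eqI)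
  fix f
  have b: "boundary_act (- (g + h)) x = boundary_act (- h) (boundary_act (- g) x)" for x
    by (rule stake_eqI[where k = 0]) (simp add: stake_boundary_act minus_add act_add del: add_uminus_conv_diff)
  show "koopman (g + h) f = (koopman g o\<^sub>L koopman h) f"
    unfolding blinfun_apply_blinfun_compose koopman.rep_eq
  proof (induction f rule: l2.abs_induct)
    case (1 F)
    note k = koopman_fun.rsp[unfolded rel_fun_def, rule_format, OF refl]
    show ?case by (simp only: koopman_fun.abs_eq[OF k[OF 1]] koopman_fun.abs_eq[OF 1] b)
  qed
qed

lemma koopman_scaleC: "koopman g (c *\<^sub>C f) = c *\<^sub>C koopman g f"
  unfolding koopman.rep_eq
proof (induction f rule: l2.abs_induct)
  case (1 F)
  note k = koopman_fun.rsp[unfolded rel_fun_def, rule_format, OF refl]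
  note s = scaleC_l2.rsp[unfolded rel_fun_def, rule_format, OF refl]
  show ?case by (simp only: koopman_fun.abs_eq[OF s[OF 1]] koopman_fun.abs_eq[OF 1] scaleC_l2.abs_eq[OF 1] scaleC_l2.abs_eq[OF k[OF 1]])
qed

lemma koopman_cinner: "cinner (koopman g f) (koopman g k) = cinner f k"
  unfolding koopman.rep_eq
proof transfer
  fix g f k assume "l2_rel f f" "l2_rel k k"
  then have fk: "f \<in> borel_measurable mu" "k \<in> borel_measurable mu"
    by (simp_all add: l2_rel_def square_integrable_def)
  have "(\<integral>x. f (boundary_act (- g) x) * cnj (k (boundary_act (- g) x)) \<partial>mu) =
    (\<integral>x. f x * cnj (k x) \<partial>distr mu mu (boundary_act (- g)))"
    by (subst integral_distr[OF measurable_boundary_act])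
      (auto intro!: borel_measurable_times measurable_cnj fk)
  then show "(\<integral>x. f (boundary_act (- g) x) * cnj (k (boundary_act (- g) x)) \<partial>mu) = (\<integral>x. f x * cnj (k x) \<partial>mu)"
    by (simp add: boundary_act_measure_preserving)
qed

lemma self_similar_koopman: "self_similar koopman"
  unfolding self_similar_def unitary_rep_def
  by (auto intro!: blinfun_eqI simp: koopman_zero koopman_add koopman_scaleC koopman_cinner koopman_word_isometry)

lemma norm_koopman: "norm (koopman g f) = norm f"
  by (rule norm_l2_eqI) (rule koopman_cinner)

lemma cinner_koopman: "cinner (koopman g f) k = cinner f (koopman (- g) k)"
proof -
  have "koopman (- g) (koopman g f) = f" for g f
    using koopman_add[of "- g" g] by (simp add: koopman_zero blinfun_apply_blinfun_compose[symmetric] del: blinfun_apply_blinfun_compose)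
  from this[of "- g" k] show ?thesis using koopman_cinner[of g f "koopman (- g) k"] by simp
qed

section \<open>The two isometries, the cylinder functions and the Hilbert space\<close>

section \<open>The isometries and their adjoints\<close>

lift_definition gen\<^sub>a :: grigorchuk is gen_a by (rule generate.incl) simp
lift_definition gen\<^sub>b :: grigorchuk is gen_b by (rule generate.incl) simp
lift_definition gen\<^sub>c :: grigorchuk is gen_c by (rule generate.incl) simp
lift_definition gen\<^sub>d :: grigorchuk is gen_d by (rule generate.incl) simp

lemmas act_gen = gen\<^sub>a.rep_eq gen\<^sub>b.rep_eq gen\<^sub>c.rep_eq gen\<^sub>d.rep_eq

lemma section_at_gen_a: "section_at gen\<^sub>a [i] = 0"
  by (rule section_at_eqI, cases i) (simp_all add: act_gen act_zero)

lemma section_at_gen: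
  "section_at gen\<^sub>b [False] = gen\<^sub>a" "section_at gen\<^sub>b [True] = gen\<^sub>c"
  "section_at gen\<^sub>c [False] = gen\<^sub>a" "section_at gen\<^sub>c [True] = gen\<^sub>d"
  "section_at gen\<^sub>d [False] = 0" "section_at gen\<^sub>d [True] = gen\<^sub>b"
  by (rule section_at_eqI, simp add: act_gen act_zero)+

lemma koopman_gen_branch:
  "koopman gen\<^sub>a (branch i f) = branch (\<not> i) f"
  "koopman gen\<^sub>b (branch False f) = branch False (koopman gen\<^sub>a f)"
  "koopman gen\<^sub>b (branch True f) = branch True (koopman gen\<^sub>c f)"
  "koopman gen\<^sub>c (branch False f) = branch False (koopman gen\<^sub>a f)"
  "koopman gen\<^sub>c (branch True f) = branch True (koopman gen\<^sub>d f)"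
  "koopman gen\<^sub>d (branch False f) = branch False f"
  "koopman gen\<^sub>d (branch True f) = branch True (koopman gen\<^sub>b f)"
  by (cases i; simp add: koopman_branch section_at_gen section_at_gen_a act_gen koopman_zero)+

lemma branch_scaleC: "branch i (c *\<^sub>C f) = c *\<^sub>C branch i f"
  unfolding branch.rep_eq
proof (induction f rule: l2.abs_induct)
  case (1 F)
  note b = branch_fun.rsp[unfolded rel_fun_def, rule_format, OF refl]
  note s = scaleC_l2.rsp[unfolded rel_fun_def, rule_format, OF refl]
  have "(\<lambda>x. if shd x = i then complex_of_real (sqrt 2) * (c * F (stl x)) else 0) =
    (\<lambda>x. c * (if shd x = i then complex_of_real (sqrt 2) * F (stl x) else 0))"
    by (rule ext) simp
  then show ?case
    by (simp only: branch_fun.abs_eq[OF s[OF 1]] branch_fun.abs_eq[OF 1] scaleC_l2.abs_eq[OF 1] scaleC_l2.abs_eq[OF b[OF 1]])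
qed

lemma cinner_branch_other: "i \<noteq> j \<Longrightarrow> cinner (branch i f) (branch j g) = 0"
  unfolding branch.rep_eq
proof transfer
  fix i j :: bool and f g :: "bool stream \<Rightarrow> complex"
  assume "i \<noteq> j"
  then have "(if shd x = i then complex_of_real (sqrt 2) * f (stl x) else 0) *
    cnj (if shd x = j then complex_of_real (sqrt 2) * g (stl x) else 0) = 0" for x
    by auto
  then show "(\<integral>x. (if shd x = i then complex_of_real (sqrt 2) * f (stl x) else 0) *
    cnj (if shd x = j then complex_of_real (sqrt 2) * g (stl x) else 0) \<partial>mu) = 0"
    by (simp only: integral_zero)
qed

text \<open>The supports of the two branches fill the boundary, so the sum is one integral of a
  function of \<open>stl x\<close>, and \<open>stl\<close> preserves the measure. This avoids
  integrating over half of the boundary. The factor 2 is the square of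
  \<open>sqrt 2\<close>.\<close>

lemma cinner_branch_sum:
  "cinner (branch False f) (branch False g) + cinner (branch True f) (branch True g) = 2 * cinner f g"
  unfolding branch.rep_eq
proof transfer
  fix f g assume fg: "l2_rel f f" "l2_rel g g"
  let ?s = "\<lambda>i (f :: bool stream \<Rightarrow> complex) x. if shd x = i then complex_of_real (sqrt 2) * f (stl x) else 0"
  have "l2_rel (?s i f) (?s i f)" if "l2_rel f f" for i f
    by (rule branch_fun.rsp[unfolded rel_fun_def, rule_format, OF refl that])
  then have int: "integrable mu (\<lambda>x. ?s i f x * cnj (?s i g x))" for i
    using fg by (intro square_integrable_product) (auto simp: l2_rel_def)
  have stl: "stl \<in> measurable mu mu" unfolding mu_def by (rule measurable_stl)
  have m: "f \<in> borel_measurable mu" "g \<in> borel_measurable mu"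
    using fg by (simp_all add: l2_rel_def square_integrable_def)
  have "(\<integral>x. ?s False f x * cnj (?s False g x) \<partial>mu) + (\<integral>x. ?s True f x * cnj (?s True g x) \<partial>mu) =
    (\<integral>x. ?s False f x * cnj (?s False g x) + ?s True f x * cnj (?s True g x) \<partial>mu)"
    by (rule Bochner_Integration.integral_add[symmetric, OF int int])
  also have "\<dots> = (\<integral>x. 2 * (f (stl x) * cnj (g (stl x))) \<partial>mu)"
  proof (rule Bochner_Integration.integral_cong[OF refl])
    have "complex_of_real (sqrt 2) * complex_of_real (sqrt 2) = 2"
      by (simp flip: of_real_mult)
    then have "complex_of_real (sqrt 2) * u * (complex_of_real (sqrt 2) * v) = 2 * (u * v)" for u v
      by (metis mult.assoc mult.left_commute)
    then show "?s False f x * cnj (?s False g x) + ?s True f x * cnj (?s True g x) = 2 * (f (stl x) * cnj (g (stl x)))" for x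
      by simp
  qed
  also have "\<dots> = 2 * (\<integral>x. f x * cnj (g x) \<partial>distr mu mu stl)"
    by (subst integral_distr[OF stl]) (auto intro!: borel_measurable_times measurable_cnj m)
  finally show "(\<integral>x. ?s False f x * cnj (?s False g x) \<partial>mu) + (\<integral>x. ?s True f x * cnj (?s True g x) \<partial>mu) =
    2 * (\<integral>x. f x * cnj (g x) \<partial>mu)"
    by (simp only: stl_measure_preserving)
qed

text \<open>The unitary of the generator a exchanges the two branches, so they contribute equally to
  the sum in \<open>cinner_branch_sum\<close>.\<close>

lemma cinner_branch_same: "cinner (branch i f) (branch i g) = cinner f g"
proof -
  have "cinner (branch True f) (branch True g) = cinner (branch False f) (branch False g)"
    using koopman_cinner[of gen\<^sub>a "branch False f" "branch False g"] by (simp add: koopman_gen_branch)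
  with cinner_branch_sum[of f g] show ?thesis by (cases i) simp_all
qed

lemma nn_integral_mu_scons:
  assumes [measurable]: "h \<in> borel_measurable mu"
  shows "(\<integral>\<^sup>+x. h x \<partial>mu) = ((\<integral>\<^sup>+x. h (False ## x) \<partial>mu) + (\<integral>\<^sup>+x. h (True ## x) \<partial>mu)) / 2"
proof -
  have "(\<integral>\<^sup>+x. h x \<partial>mu) = (\<integral>\<^sup>+i. (\<integral>\<^sup>+x. h (i ## x) \<partial>mu) \<partial>measure_pmf (pmf_of_set UNIV))"
    unfolding mu_def
    by (rule prob_space.nn_integral_stream_space[OF prob_space_measure_pmf]) (use assms in \<open>simp add: mu_def\<close>)
  also have "\<dots> = ((\<integral>\<^sup>+x. h (False ## x) \<partial>mu) + (\<integral>\<^sup>+x. h (True ## x) \<partial>mu)) / 2"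
    by (subst nn_integral_pmf_of_set) (simp_all add: UNIV_bool add.commute)
  finally show ?thesis .
qed

lemma measurable_scons: "(\<lambda>x. i ## x) \<in> measurable mu mu"
  unfolding mu_def by (rule measurable_Stream) simp_all

lemma AE_mu_scons:
  assumes ae: "AE x in mu. f x = g x" and m [measurable]: "f \<in> borel_measurable mu" "g \<in> borel_measurable mu"
  shows "AE x in mu. f (i ## x) = (g (i ## x) :: complex)"
proof -
  have "Measurable.pred mu (\<lambda>x. f x = g x)" by measurable
  then have "(AE x in mu. f x = g x) \<longleftrightarrow> (AE i in measure_pmf (pmf_of_set UNIV). AE x in mu. f (i ## x) = g (i ## x))"
    unfolding mu_def by (rule prob_space.AE_stream_space[OF prob_space_measure_pmf])
  with ae show ?thesis by (simp add: AE_measure_pmf_iff)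
qed

text \<open>This is the adjoint of s_i, as \<open>cinner_branch\<close> confirms: the factor
  \<open>sqrt 2\<close> of s_i times the weight 1/2 of a half of the boundary leaves 1 /
  \<open>sqrt 2\<close>.\<close>

lift_definition cobranch_fun :: "bool \<Rightarrow> l2 \<Rightarrow> l2" is "\<lambda>i f x. f (i ## x) / complex_of_real (sqrt 2)"
proof -
  fix i f g assume fg: "l2_rel f g"
  have "square_integrable (\<lambda>x. h (i ## x) / complex_of_real (sqrt 2))" if h: "square_integrable h" for h
  proof -
    have m [measurable]: "h \<in> borel_measurable mu" using h by (simp add: square_integrable_def)
    have hm [measurable]: "(\<lambda>x. h (i ## x)) \<in> borel_measurable mu"
      by (rule measurable_compose[OF measurable_scons m])
    let ?I = "\<lambda>i. \<integral>\<^sup>+x. ennreal ((cmod (h (i ## x)))\<^sup>2) \<partial>mu"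
    have fin: "(\<integral>\<^sup>+x. ennreal ((cmod (h x))\<^sup>2) \<partial>mu) < \<infinity>"
      using h by (simp add: square_integrable_def integrable_iff_bounded)
    have half: "(\<integral>\<^sup>+x. ennreal ((cmod (h x))\<^sup>2) \<partial>mu) = (?I False + ?I True) / 2"
      by (rule nn_integral_mu_scons) measurable
    have "?I i < \<infinity>"
    proof -
      have "?I False + ?I True \<noteq> \<infinity>"
      proof
        assume "?I False + ?I True = \<infinity>"
        then have "(?I False + ?I True) / 2 = \<infinity>" by (simp only: ennreal_divide_eq_top_iff infinity_ennreal_def) simp
        with fin half show False by simp
      qed
      then show ?thesis by (cases i) (auto simp: less_top[symmetric])
    qed
    then have "integrable mu (\<lambda>x. (cmod (h (i ## x)))\<^sup>2)"
      by (simp add: integrable_iff_bounded)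
    then show ?thesis by (simp add: square_integrable_def norm_divide power_divide)
  qed
  moreover have "AE x in mu. f (i ## x) = g (i ## x)"
    using fg by (intro AE_mu_scons) (auto simp: l2_rel_def square_integrable_def)
  then have "AE x in mu. f (i ## x) / complex_of_real (sqrt 2) = g (i ## x) / complex_of_real (sqrt 2)"
    by eventually_elim simp
  ultimately show "l2_rel (\<lambda>x. f (i ## x) / complex_of_real (sqrt 2)) (\<lambda>x. g (i ## x) / complex_of_real (sqrt 2))"
    using fg by (simp add: l2_rel_def)
qed

lemma cobranch_fun_branch_fun: "cobranch_fun i (branch_fun j f) = (if i = j then f else 0)"
proof (induction f rule: l2.abs_induct)
  case (1 F)
  note b = branch_fun.rsp[unfolded rel_fun_def, rule_format, OF refl, OF 1]
  show ?case
    by (cases "i = j")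
      (simp_all add: branch_fun.abs_eq[OF 1] cobranch_fun.abs_eq[OF b] zero_l2.abs_eq)
qed

lemma branch_fun_cobranch_fun:
  "branch_fun False (cobranch_fun False f) + branch_fun True (cobranch_fun True f) = f"
proof (induction f rule: l2.abs_induct)
  case (1 F)
  note b = branch_fun.rsp[unfolded rel_fun_def, rule_format, OF refl]
  note c = cobranch_fun.rsp[unfolded rel_fun_def, rule_format, OF refl, OF 1]
  have "(if shd x = False then complex_of_real (sqrt 2) * (F (False ## stl x) / complex_of_real (sqrt 2)) else 0) +
     (if shd x = True then complex_of_real (sqrt 2) * (F (True ## stl x) / complex_of_real (sqrt 2)) else 0) = F x" for x
    by (cases x rule: stream.exhaust) auto
  then show ?case
    by (simp only: branch_fun.abs_eq[OF c] cobranch_fun.abs_eq[OF 1] plus_l2.abs_eq[OF b[OF c] b[OF c]])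
qed

lift_definition cobranch :: "bool \<Rightarrow> l2 \<Rightarrow>\<^sub>L l2" is cobranch_fun
proof (rule bounded_linear_intro[where K = 1])
  fix i and f g :: l2 and r :: real
  have dec: "f = branch False (cobranch_fun False f) + branch True (cobranch_fun True f)" for f
    by (simp add: branch.rep_eq branch_fun_cobranch_fun)
  \<comment> \<open>The decomposition into the ranges of the two branches is unique because the
    ranges are orthogonal. Linearity is then read off from decompositions, and the norm bound below
    is Pythagoras.\<close>
  have uniq: "cobranch_fun i (branch False u + branch True v) = (if i then v else u)" for u v
  proof -
    let ?f = "branch False u + branch True v"
    have "branch i (if i then v else u) - branch i (cobranch_fun i ?f) =
       branch (\<not> i) (cobranch_fun (\<not> i) ?f) - branch (\<not> i) (if i then u else v)"
      using dec[of ?f] by (cases i) (simp_all add: algebra_simps)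
    then have "branch i ((if i then v else u) - cobranch_fun i ?f) =
       branch (\<not> i) (cobranch_fun (\<not> i) ?f - (if i then u else v))"
      by (simp only: blinfun.diff_right)
    then have "cinner (branch i ((if i then v else u) - cobranch_fun i ?f)) (branch i ((if i then v else u) - cobranch_fun i ?f)) = 0"
      by (metis cinner_branch_other)
    then show ?thesis unfolding cinner_branch_same by (simp add: cinner_self)
  qed
  have "f + g = branch False (cobranch_fun False f + cobranch_fun False g) + branch True (cobranch_fun True f + cobranch_fun True g)"
    using dec[of f] dec[of g] by (simp add: blinfun.add_right algebra_simps)
  then show "cobranch_fun i (f + g) = cobranch_fun i f + cobranch_fun i g" using uniq by (cases i) metis+
  have "r *\<^sub>R f = branch False (r *\<^sub>R cobranch_fun False f) + branch True (r *\<^sub>R cobranch_fun True f)"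
    using dec[of f] by (simp add: blinfun.scaleR_right flip: scaleR_add_right)
  then show "cobranch_fun i (r *\<^sub>R f) = r *\<^sub>R cobranch_fun i f" using uniq by (cases i) metis+
  have "cinner f f = cinner (cobranch_fun False f) (cobranch_fun False f) + cinner (cobranch_fun True f) (cobranch_fun True f)"
    by (subst (1 2) dec) (simp add: cinner_add_left cinner_add_right cinner_branch_same cinner_branch_other)
  then have "(norm f)\<^sup>2 = (norm (cobranch_fun False f))\<^sup>2 + (norm (cobranch_fun True f))\<^sup>2"
    unfolding cinner_self by (simp flip: of_real_add del: of_real_power)
  then have "(norm (cobranch_fun i f))\<^sup>2 \<le> (norm f)\<^sup>2" by (cases i) auto
  then show "norm (cobranch_fun i f) \<le> norm f * 1" by (simp add: power2_le_iff_abs_le)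
qed

lemma cobranch_branch: "cobranch i (branch j f) = (if i = j then f else 0)"
  by (simp add: cobranch.rep_eq branch.rep_eq cobranch_fun_branch_fun)

lemma branch_cobranch: "branch False (cobranch False f) + branch True (cobranch True f) = f"
  by (simp add: cobranch.rep_eq branch.rep_eq branch_fun_cobranch_fun)

lemma cinner_branch: "cinner (branch i f) g = cinner f (cobranch i g)"
proof -
  have "cinner (branch i f) (branch False (cobranch False g) + branch True (cobranch True g)) = cinner f (cobranch i g)"
    by (cases i) (simp_all add: cinner_add_right cinner_branch_same cinner_branch_other)
  then show ?thesis by (simp only: branch_cobranch)
qed

lemma norm_branch: "norm (branch i f) = norm f"
  by (rule norm_l2_eqI) (rule cinner_branch_same)

section \<open>The normalised indicators of cylinders\<close>

lift_definition const_one :: l2 is "\<lambda>x. 1"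
  by (simp add: l2_rel_def square_integrable_def)

lemma cinner_const_one: "cinner const_one const_one = 1"
  by transfer (use mu.prob_space in simp)

lemma koopman_const_one: "koopman g const_one = const_one"
  unfolding koopman.rep_eq by (simp add: const_one.abs_eq koopman_fun.abs_eq const_one.rsp)

lemma cobranch_const_one: "cobranch i const_one = complex_of_real (1 / sqrt 2) *\<^sub>C const_one"
  unfolding cobranch.rep_eq const_one_def
  by (simp add: cobranch_fun.abs_eq[OF const_one.rsp] scaleC_l2.abs_eq[OF const_one.rsp])

definition cyl :: "bool list \<Rightarrow> l2" where
  "cyl v = word_isometry v const_one"

lemma cyl_Nil: "cyl [] = const_one" and cyl_Cons: "cyl (i # v) = branch i (cyl v)"
  by (simp_all add: cyl_def)

lemma koopman_cyl: "koopman g (cyl v) = cyl (act g v)"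
  by (simp add: cyl_def koopman_word_isometry koopman_const_one)

lemma word_isometry_append: "word_isometry (v @ w) = word_isometry v o\<^sub>L word_isometry w"
  by (induction v) (auto intro!: blinfun_eqI)

lemma word_isometry_scaleC: "word_isometry v (c *\<^sub>C f) = c *\<^sub>C word_isometry v f"
  by (induction v) (simp_all add: branch_scaleC)

lemma cyl_append: "cyl (v @ w) = word_isometry v (cyl w)"
  by (simp add: cyl_def word_isometry_append)

lemma cinner_cyl: "length v = length w \<Longrightarrow> cinner (cyl v) (cyl w) = (if v = w then 1 else 0)"
proof (induction v w rule: list_induct2)
  case Nil
  then show ?case by (simp add: cyl_Nil cinner_const_one)
next
  case (Cons i v j w)
  then show ?case
    by (cases "i = j") (simp_all add: cyl_Cons cinner_branch_same cinner_branch_other)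
qed

lemma norm_cyl: "norm (cyl v) = 1"
proof -
  have "(norm (cyl v))\<^sup>2 = 1"
    using cinner_self[of "cyl v"] cinner_cyl[of v v] by (metis of_real_eq_1_iff)
  then show ?thesis by (simp add: power2_eq_1_iff) (metis norm_not_less_zero neg_less_0_iff_less zero_less_one)
qed

section \<open>Completeness of \<open>L\<^sup>2\<close> and totality of the cylinder functions\<close>

lemma l2_obtain:
  obtains F where "l2_rel F F" "f = abs_l2 F"
  by (induction f rule: l2.abs_induct) auto

lemma l2_diff_abs:
  assumes "l2_rel F F" "l2_rel G G"
  shows "l2_rel (\<lambda>x. F x - G x) (\<lambda>x. F x - G x)" "abs_l2 F - abs_l2 G = abs_l2 (\<lambda>x. F x - G x)"
proof -
  have s: "l2_rel (\<lambda>x. (- 1) * G x) (\<lambda>x. (- 1) * G x)"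
    using scaleC_l2.rsp[unfolded rel_fun_def, rule_format, OF refl assms(2)] .
  have "l2_rel (\<lambda>x. F x + (- 1) * G x) (\<lambda>x. F x + (- 1) * G x)"
    using plus_l2.rsp[unfolded rel_fun_def, rule_format, OF assms(1) s] .
  then show "l2_rel (\<lambda>x. F x - G x) (\<lambda>x. F x - G x)" by simp
  show "abs_l2 F - abs_l2 G = abs_l2 (\<lambda>x. F x - G x)"
    by (simp add: minus_l2_def uminus_l2_def scaleC_l2.abs_eq[OF assms(2)] plus_l2.abs_eq[OF assms(1) s, simplified] plus_l2.abs_eq[OF assms(1) s])
qed

lemma cinner_abs: "l2_rel F F \<Longrightarrow> l2_rel G G \<Longrightarrow> cinner (abs_l2 F) (abs_l2 G) = (\<integral>x. F x * cnj (G x) \<partial>mu)"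
  by (rule cinner_l2.abs_eq)

lemma norm_abs: assumes "l2_rel F F" shows "(norm (abs_l2 F))\<^sup>2 = (\<integral>x. (cmod (F x))\<^sup>2 \<partial>mu)"
proof -
  have "complex_of_real ((norm (abs_l2 F))\<^sup>2) = (\<integral>x. complex_of_real ((cmod (F x))\<^sup>2) \<partial>mu)"
    using cinner_self[of "abs_l2 F"] by (simp only: cinner_abs[OF assms assms] complex_norm_square)
  then show ?thesis by (simp only: integral_complex_of_real of_real_eq_iff)
qed

text \<open>Cauchy-Schwarz for the modulus of F against the constant function one, which has norm 1
  because the measure is a probability. It brings the almost everywhere convergence available for
  L^1 within reach of L^2.\<close>

lemma l2_L1_bound:
  assumes F: "l2_rel F F"
  shows "integrable mu F" "(\<integral>x. cmod (F x) \<partial>mu) \<le> norm (abs_l2 F)"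
proof -
  have sF: "square_integrable F" "square_integrable (\<lambda>x. 1)"
    using F by (auto simp: l2_rel_def square_integrable_def)
  then show "integrable mu F" using square_integrable_product[OF sF] by simp
  have mF: "F \<in> borel_measurable mu" using sF by (simp add: square_integrable_def)
  have A: "l2_rel (\<lambda>x. complex_of_real (cmod (F x))) (\<lambda>x. complex_of_real (cmod (F x)))"
    using sF mF by (auto simp: l2_rel_def square_integrable_def intro!: borel_measurable_of_real borel_measurable_norm)
  have "(\<integral>x. complex_of_real (cmod (F x)) \<partial>mu) = cinner (abs_l2 (\<lambda>x. complex_of_real (cmod (F x)))) const_one"
    unfolding const_one_def cinner_abs[OF A const_one.rsp] by simp
  then have "complex_of_real (\<integral>x. cmod (F x) \<partial>mu) = cinner (abs_l2 (\<lambda>x. complex_of_real (cmod (F x)))) const_one"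
    by (simp only: integral_complex_of_real)
  then have "(\<integral>x. cmod (F x) \<partial>mu) \<le> norm (abs_l2 (\<lambda>x. complex_of_real (cmod (F x)))) * norm const_one"
    using cinner_cauchy_schwarz[of "abs_l2 (\<lambda>x. complex_of_real (cmod (F x)))" const_one]
    by (metis abs_ge_self norm_of_real order_trans)
  also have "norm const_one = 1" using norm_cyl[of "[]"] by (simp add: cyl_Nil)
  also have "norm (abs_l2 (\<lambda>x. complex_of_real (cmod (F x)))) = norm (abs_l2 F)"
  proof -
    have "(norm (abs_l2 (\<lambda>x. complex_of_real (cmod (F x)))))\<^sup>2 = (norm (abs_l2 F))\<^sup>2"
      by (simp add: norm_abs[OF A] norm_abs[OF F])
    then show ?thesis by (simp only: power2_eq_iff_nonneg norm_ge_zero)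
  qed
  finally show "(\<integral>x. cmod (F x) \<partial>mu) \<le> norm (abs_l2 F)" by simp
qed

text \<open>
  A Cauchy sequence in \<open>L\<^sup>2\<close> is Cauchy in \<open>L\<^sup>1\<close>, so a subsequence converges almost everywhere; by
  Fatou's lemma its pointwise limit is the limit in \<open>L\<^sup>2\<close>.
\<close>

instance l2 :: banach
proof
  fix X :: "nat \<Rightarrow> l2" assume X: "Cauchy X"
  have "\<exists>F. \<forall>n. l2_rel (F n) (F n) \<and> X n = abs_l2 (F n)"
    by (rule choice) (metis l2_obtain)
  then obtain F where F: "\<And>n. l2_rel (F n) (F n)" "\<And>n. X n = abs_l2 (F n)" by blast
  have D: "l2_rel (\<lambda>x. F i x - F j x) (\<lambda>x. F i x - F j x)"
      "X i - X j = abs_l2 (\<lambda>x. F i x - F j x)" for i j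
    using l2_diff_abs[OF F(1) F(1)] by (simp_all add: F(2))
  have m [measurable]: "F n \<in> borel_measurable mu" for n
    using F(1)[of n] by (simp add: l2_rel_def square_integrable_def)
  have cauchy: "\<exists>N. \<forall>i\<ge>N. \<forall>j\<ge>N. norm (X i - X j) < e" if "e > 0" for e
    using X that by (simp add: Cauchy_iff)
  have "\<exists>N. \<forall>i\<ge>N. \<forall>j\<ge>N. (\<integral>x. norm (F i x - F j x) \<partial>mu) < e" if "e > 0" for e
    using cauchy[OF that] l2_L1_bound(2)[OF D(1)] D(2) by (metis le_less_trans)
  with l2_L1_bound(1)[OF F(1)] obtain r :: "nat \<Rightarrow> nat"
    where r: "strict_mono r" "AE x in mu. Cauchy (\<lambda>i. F (r i) x)"
    by (rule cauchy_L1_AE_cauchy_subseq) blast+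
  define G where "G x = lim (\<lambda>i. F (r i) x)" for x
  have mG [measurable]: "G \<in> borel_measurable mu"
    unfolding G_def by measurable
  have lim: "AE x in mu. (\<lambda>i. F (r i) x) \<longlonglongrightarrow> G x"
    using r(2) by eventually_elim (simp add: G_def convergent_LIMSEQ_iff[symmetric] Cauchy_convergent_iff)
  have fatou: "(\<integral>\<^sup>+x. ennreal ((cmod (F n x - G x))\<^sup>2) \<partial>mu) \<le> ennreal (e\<^sup>2)"
    if e: "e > 0" and N: "\<forall>i\<ge>N. \<forall>j\<ge>N. norm (X i - X j) < e" and n: "n \<ge> N" for e N n
  proof -
    have "(\<integral>\<^sup>+x. ennreal ((cmod (F n x - G x))\<^sup>2) \<partial>mu) =
      (\<integral>\<^sup>+x. liminf (\<lambda>i. ennreal ((cmod (F n x - F (r i) x))\<^sup>2)) \<partial>mu)"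
    proof (rule nn_integral_cong_AE, use lim in eventually_elim)
      fix x assume "(\<lambda>i. F (r i) x) \<longlonglongrightarrow> G x"
      then have "(\<lambda>i. ennreal ((cmod (F n x - F (r i) x))\<^sup>2)) \<longlonglongrightarrow> ennreal ((cmod (F n x - G x))\<^sup>2)"
        by (intro tendsto_intros)
      then show "ennreal ((cmod (F n x - G x))\<^sup>2) = liminf (\<lambda>i. ennreal ((cmod (F n x - F (r i) x))\<^sup>2))"
        by (intro lim_imp_Liminf[symmetric]) auto
    qed
    also have "\<dots> \<le> liminf (\<lambda>i. \<integral>\<^sup>+x. ennreal ((cmod (F n x - F (r i) x))\<^sup>2) \<partial>mu)"
      by (rule nn_integral_liminf) measurable
    also have "\<dots> \<le> ennreal (e\<^sup>2)"
    proof (rule Liminf_le, simp, rule eventually_sequentiallyI[of N])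
      fix i assume "i \<ge> N"
      then have "r i \<ge> N" using seq_suble[OF r(1), of i] by simp
      have "(\<integral>\<^sup>+x. ennreal ((cmod (F n x - F (r i) x))\<^sup>2) \<partial>mu) =
          ennreal (\<integral>x. (cmod (F n x - F (r i) x))\<^sup>2 \<partial>mu)"
        using D(1)[of n "r i"] by (intro nn_integral_eq_integral) (auto simp: l2_rel_def square_integrable_def)
      also have "\<dots> = ennreal ((norm (X n - X (r i)))\<^sup>2)"
        by (simp add: norm_abs[OF D(1), symmetric] D(2))
      also have "\<dots> \<le> ennreal (e\<^sup>2)"
        using N n \<open>r i \<ge> N\<close> by (intro ennreal_leI power_mono) (auto simp: less_imp_le)
      finally show "(\<integral>\<^sup>+x. ennreal ((cmod (F n x - F (r i) x))\<^sup>2) \<partial>mu) \<le> ennreal (e\<^sup>2)" .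
    qed
    finally show ?thesis .
  qed
  have FG: "l2_rel (\<lambda>x. F n x - G x) (\<lambda>x. F n x - G x) \<and> norm (abs_l2 (\<lambda>x. F n x - G x)) \<le> e"
    if e: "e > 0" and N: "\<forall>i\<ge>N. \<forall>j\<ge>N. norm (X i - X j) < e" and n: "n \<ge> N" for e N n
  proof -
    have "integrable mu (\<lambda>x. (cmod (F n x - G x))\<^sup>2)"
      using fatou[OF that] by (simp add: integrable_iff_bounded) (metis ennreal_less_top order.strict_trans1)
    then have rel: "l2_rel (\<lambda>x. F n x - G x) (\<lambda>x. F n x - G x)"
      by (simp add: l2_rel_def square_integrable_def)
    then have "ennreal ((norm (abs_l2 (\<lambda>x. F n x - G x)))\<^sup>2) = (\<integral>\<^sup>+x. ennreal ((cmod (F n x - G x))\<^sup>2) \<partial>mu)"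
      unfolding norm_abs[OF rel] by (intro nn_integral_eq_integral[symmetric]) (auto simp: l2_rel_def square_integrable_def)
    with fatou[OF that] have "ennreal ((norm (abs_l2 (\<lambda>x. F n x - G x)))\<^sup>2) \<le> ennreal (e\<^sup>2)" by metis
    then have "norm (abs_l2 (\<lambda>x. F n x - G x)) \<le> e" using e by (simp add: ennreal_le_iff)
    with rel show ?thesis by blast
  qed
  \<comment> \<open>A single index shows that the limit G is square integrable: G is F N1 minus the
    square integrable difference F N1 - G.\<close>
  obtain N1 where N1: "\<forall>i\<ge>N1. \<forall>j\<ge>N1. norm (X i - X j) < 1" using cauchy[of 1] by auto
  have "l2_rel (\<lambda>x. F N1 x - (F N1 x - G x)) (\<lambda>x. F N1 x - (F N1 x - G x))"
    using FG[OF zero_less_one N1 order_refl] by (rule l2_diff_abs(1)[OF F(1) conjunct1])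
  then have G: "l2_rel G G" by simp
  have "X \<longlonglongrightarrow> abs_l2 G"
  proof (rule LIMSEQ_I)
    fix e :: real assume "0 < e"
    then obtain N where N: "\<forall>i\<ge>N. \<forall>j\<ge>N. norm (X i - X j) < e / 2" using cauchy[of "e / 2"] by auto
    have "norm (X n - abs_l2 G) < e" if "n \<ge> N" for n
      using FG[OF _ N that] \<open>0 < e\<close> l2_diff_abs(2)[OF F(1)[of n] G] by (simp add: F(2))
    then show "\<exists>N. \<forall>n\<ge>N. norm (X n - abs_l2 G) < e" by blast
  qed
  then show "convergent X" by (rule convergentI)
qed

text \<open>The function h may change sign, so it is no density of a positive measure. The argument
  therefore works with set integrals: cylinders are an intersection-stable generator, and vanishing
  of the integral passes to complements and disjoint unions.\<close>

lemma AE_zero_of_cylinders: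
  fixes h :: "bool stream \<Rightarrow> real"
  assumes h: "integrable mu h" and zero: "\<And>v. (\<integral>x\<in>sstart UNIV v. h x \<partial>mu) = 0"
  shows "AE x in mu. h x = 0"
proof (rule density_unique_real[OF h])
  let ?G = "sstart UNIV ` lists (UNIV :: bool set) \<union> {{}}"
  have sets: "sets mu = sigma_sets UNIV ?G"
    unfolding sets_mu sets_stream_space_sstart[OF countableI_type] by (simp add: streams_UNIV)
  fix A assume "A \<in> sets mu"
  then have A: "A \<in> sigma_sets UNIV ?G" by (simp only: sets)
  have int: "set_integrable mu B h" if "B \<in> sets mu" for B
    unfolding set_integrable_def using integrable_mult_indicator[OF that h] .
  have "(\<integral>x\<in>A. h x \<partial>mu) = 0"
    using Int_stable_sstart Pow_UNIV[THEN equalityD2, THEN subset_trans[OF subset_UNIV]] A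
  proof (induction A rule: sigma_sets_induct_disjoint)
    case (basic A)
    then show ?case using zero by (auto simp: set_lebesgue_integral_def[of _ "{}"])
  next
    case empty
    then show ?case by (simp add: set_lebesgue_integral_def)
  next
    case (compl A)
    then have "A \<in> sets mu" by (simp only: sets)
    then have "(\<integral>x\<in>A \<union> (UNIV - A). h x \<partial>mu) = (\<integral>x\<in>A. h x \<partial>mu) + (\<integral>x\<in>UNIV - A. h x \<partial>mu)"
      by (intro set_integral_Un int) (auto simp: Compl_eq_Diff_UNIV[symmetric] intro: sets.compl_sets[of _ mu, simplified])
    \<comment> \<open>The cylinder of the empty word is the whole space; its vanishing integral is
      what complements require.\<close>
    moreover have "(\<integral>x\<in>UNIV. h x \<partial>mu) = 0" using zero[of "[]"] by (simp add: streams_UNIV)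
    ultimately show ?case using compl by (simp add: Un_Diff_cancel)
  next
    case (union A)
    then have m: "A i \<in> sets mu" for i by (auto simp only: sets)
    show ?case
      using union by (subst lebesgue_integral_countable_add[OF m _ int]) (use m in \<open>auto simp: disjoint_family_on_def\<close>)
  qed
  then show "(\<integral>x\<in>A. h x \<partial>mu) = (\<integral>x\<in>A. 0 \<partial>mu)" by simp
qed simp

text \<open>Both halves go through one induction, because computing \<open>branch_fun\<close> on a
  class requires the representative to be square integrable.\<close>

lemma cyl_abs:
  "l2_rel (\<lambda>x. complex_of_real (sqrt 2 ^ length v * indicator (sstart UNIV v) x)) (\<lambda>x. complex_of_real (sqrt 2 ^ length v * indicator (sstart UNIV v) x))
   \<and> cyl v = abs_l2 (\<lambda>x. complex_of_real (sqrt 2 ^ length v * indicator (sstart UNIV v) x))"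
proof (induction v)
  case Nil
  show ?case by (simp add: cyl_Nil const_one_def streams_UNIV const_one.rsp)
next
  case (Cons i v)
  let ?F = "\<lambda>v x. complex_of_real (sqrt 2 ^ length v * indicator (sstart UNIV v) x)"
  have eq: "(\<lambda>x. if shd x = i then complex_of_real (sqrt 2) * ?F v (stl x) else 0) = ?F (i # v)"
    by (rule ext) (auto simp: indicator_def)
  show ?case
    using branch_fun.rsp[unfolded rel_fun_def, rule_format, OF refl, OF Cons.IH[THEN conjunct1], of i]
      branch_fun.abs_eq[OF Cons.IH[THEN conjunct1], of i] Cons.IH[THEN conjunct2]
    unfolding eq cyl_Cons branch.rep_eq by metis
qed

lemma cyl_total:
  assumes "\<And>v. cinner f (cyl v) = 0"
  shows "f = 0"
proof -
  obtain F where F: "l2_rel F F" "f = abs_l2 F" by (rule l2_obtain)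
  have int: "integrable mu F" by (rule l2_L1_bound(1)[OF F(1)])
  have zero: "(\<integral>x\<in>sstart UNIV v. F x \<partial>mu) = 0" for v
  proof -
    have "0 = (\<integral>x. F x * cnj (complex_of_real (sqrt 2 ^ length v * indicator (sstart UNIV v) x)) \<partial>mu)"
      using assms[of v] cinner_abs[OF F(1) cyl_abs[THEN conjunct1], of v] cyl_abs[THEN conjunct2, of v] F(2) by simp
    also have "\<dots> = (\<integral>x. complex_of_real (sqrt 2 ^ length v) * (indicator (sstart UNIV v) x *\<^sub>R F x) \<partial>mu)"
      by (rule Bochner_Integration.integral_cong) (auto simp: indicator_def mult.commute)
    also have "\<dots> = complex_of_real (sqrt 2 ^ length v) * (\<integral>x. indicator (sstart UNIV v) x *\<^sub>R F x \<partial>mu)"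
      by (rule integral_mult_right_zero)
    finally show ?thesis by (simp add: set_lebesgue_integral_def)
  qed
  have seti: "integrable mu (\<lambda>x. indicator (sstart UNIV v) x *\<^sub>R F x)" for v
    by (rule integrable_mult_indicator[OF _ int]) (simp add: sets_mu sets_sstart)
  have "AE x in mu. Re (F x) = 0"
  proof (rule AE_zero_of_cylinders)
    show "integrable mu (\<lambda>x. Re (F x))" using int by simp
    show "(\<integral>x\<in>sstart UNIV v. Re (F x) \<partial>mu) = 0" for v
      using integral_Re[OF seti[of v]] zero[of v] by (simp add: set_lebesgue_integral_def)
  qed
  moreover have "AE x in mu. Im (F x) = 0"
  proof (rule AE_zero_of_cylinders)
    show "integrable mu (\<lambda>x. Im (F x))" using int by simp
    show "(\<integral>x\<in>sstart UNIV v. Im (F x) \<partial>mu) = 0" for v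
      using integral_Im[OF seti[of v]] zero[of v] by (simp add: set_lebesgue_integral_def)
  qed
  ultimately have "AE x in mu. F x = 0" by eventually_elim (simp add: complex_eq_iff)
  then have "l2_rel F (\<lambda>x. 0)" using F(1) square_integrable_zero by (simp add: l2_rel_def)
  then show ?thesis
    unfolding F(2) zero_l2_def using Quotient3_rel_abs[OF Quotient3_l2] by blast
qed

section \<open>The algebra, its norm closure and adjoints\<close>

section \<open>The Koopman algebra and its closure\<close>

lemma poly_mapping_induct [case_names zero single add]:
  fixes x :: "'a \<Rightarrow>\<^sub>0 'b::comm_monoid_add"
  assumes zero: "P 0" and single: "\<And>g c. P (Poly_Mapping.single g c)" and add: "\<And>x y. P x \<Longrightarrow> P y \<Longrightarrow> P (x + y)"
  shows "P x"
proof -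
  have "x = (\<Sum>g\<in>Poly_Mapping.keys x. Poly_Mapping.single g (Poly_Mapping.lookup x g))"
  proof (rule poly_mapping_eqI)
    fix k
    show "Poly_Mapping.lookup x k = Poly_Mapping.lookup (\<Sum>g\<in>Poly_Mapping.keys x. Poly_Mapping.single g (Poly_Mapping.lookup x g)) k"
      by (simp add: lookup_sum lookup_single when_def in_keys_iff)
  qed
  moreover have "P (\<Sum>g\<in>A. Poly_Mapping.single g (Poly_Mapping.lookup x g))" for A
    by (induction A rule: infinite_finite_induct) (auto intro: assms)
  ultimately show ?thesis by metis
qed

lemma extend_rep_superset:
  assumes "finite A" "Poly_Mapping.keys x \<subseteq> A"
  shows "extend_rep \<rho> x = (\<Sum>g\<in>A. Poly_Mapping.lookup x g *\<^sub>C \<rho> g)"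
  unfolding extend_rep_def
  by (rule sum.mono_neutral_left) (use assms in \<open>auto simp: in_keys_iff\<close>)

lemma extend_rep_zero [simp]: "extend_rep \<rho> 0 = 0"
  by (simp add: extend_rep_def)

lemma extend_rep_single: "extend_rep \<rho> (Poly_Mapping.single g c) = c *\<^sub>C \<rho> g"
  by (subst extend_rep_superset[of "{g}"]) auto

lemma extend_rep_add: "extend_rep \<rho> (x + y) = extend_rep \<rho> x + extend_rep \<rho> y"
proof -
  let ?A = "Poly_Mapping.keys x \<union> Poly_Mapping.keys y"
  have "Poly_Mapping.keys (x + y) \<subseteq> ?A" by (rule keys_add)
  then show ?thesis
    by (simp add: extend_rep_superset[of ?A] lookup_add scaleC_add_left sum.distrib)
qed

lemma extend_rep_scaleC: "extend_rep \<rho> (c *\<^sub>C x) = c *\<^sub>C extend_rep \<rho> x"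
proof -
  have l: "Poly_Mapping.lookup (c *\<^sub>C x) g = c * Poly_Mapping.lookup x g" for g
    by transfer (simp add: scaleC_complex_def)
  have "Poly_Mapping.keys (c *\<^sub>C x) \<subseteq> Poly_Mapping.keys x" by (auto simp: in_keys_iff l)
  then show ?thesis
    by (simp add: extend_rep_superset[of "Poly_Mapping.keys x"] l scaleC_scaleC cvec.scale_sum_right)
qed

lemma scaleC_compose: "(c *\<^sub>C S) o\<^sub>L T = c *\<^sub>C (S o\<^sub>L T)" for S :: "'b::real_normed_vector \<Rightarrow>\<^sub>L 'c::complex_inner"
  by (rule blinfun_eqI) simp

lemma compose_add_left: "(S + S') o\<^sub>L T = (S o\<^sub>L T) + (S' o\<^sub>L T)"
  and compose_add_right: "T o\<^sub>L (S + S') = (T o\<^sub>L S) + (T o\<^sub>L S')"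
  by (rule bounded_bilinear.add_left[OF bounded_bilinear_blinfun_compose]
      bounded_bilinear.add_right[OF bounded_bilinear_blinfun_compose])+

text \<open>The operator type contains every bounded real-linear map. Scalars always leave the left
  factor of a composition, but leave the right factor only past an operator with this
  property.\<close>

definition clinear_op :: "(l2 \<Rightarrow>\<^sub>L l2) \<Rightarrow> bool" where
  "clinear_op T \<longleftrightarrow> (\<forall>c f. T (c *\<^sub>C f) = c *\<^sub>C T f)"

lemma clinear_opD: "clinear_op T \<Longrightarrow> T (c *\<^sub>C f) = c *\<^sub>C T f"
  by (simp add: clinear_op_def)

lemma compose_scaleC: "clinear_op T \<Longrightarrow> T o\<^sub>L (c *\<^sub>C S) = c *\<^sub>C (T o\<^sub>L S)"
  by (rule blinfun_eqI) (simp add: clinear_opD)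

lemma clinear_op_koopman: "clinear_op (koopman g)"
  by (simp add: clinear_op_def koopman_scaleC)

lemma extend_rep_mult: "extend_rep koopman (x * y) = extend_rep koopman x o\<^sub>L extend_rep koopman y"
proof (induction x rule: poly_mapping_induct)
  case zero
  then show ?case by (simp add: blinfun_compose_zero)
next
  case (add x x')
  then show ?case by (simp add: distrib_right extend_rep_add compose_add_left)
next
  case (single g c)
  show ?case
  proof (induction y rule: poly_mapping_induct)
    case zero
    then show ?case by simp
  next
    case (add y y')
    then show ?case by (simp add: distrib_left extend_rep_add compose_add_right)
  next
    case (single h d)
    then show ?case
      by (simp add: mult_single extend_rep_single koopman_add scaleC_compose
          compose_scaleC[OF clinear_op_koopman] scaleC_scaleC)
  qed
qed

lemma koopman_algebra_eq_span: "koopman_algebra = cvec.span (range koopman)"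
proof
  show "koopman_algebra \<subseteq> cvec.span (range koopman)"
  proof
    fix T assume "T \<in> koopman_algebra"
    then obtain x where "T = extend_rep koopman x" by (auto simp: koopman_algebra_def)
    moreover have "extend_rep koopman x \<in> cvec.span (range koopman)"
      unfolding extend_rep_def by (rule cvec.span_sum, rule cvec.span_scale, rule cvec.span_base) simp
    ultimately show "T \<in> cvec.span (range koopman)" by simp
  qed
  have "cvec.subspace koopman_algebra"
    unfolding koopman_algebra_def cvec.subspace_def
  proof (intro conjI ballI allI)
    show "0 \<in> range (extend_rep koopman)" by (rule range_eqI[of _ _ 0]) simp
    fix x y and c :: complex
    assume "x \<in> range (extend_rep koopman)"
    then obtain u where u: "x = extend_rep koopman u" by blast
    show "c *\<^sub>C x \<in> range (extend_rep koopman)" unfolding u by (simp only: extend_rep_scaleC[symmetric] rangeI)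
    assume "y \<in> range (extend_rep koopman)"
    then obtain w where w: "y = extend_rep koopman w" by blast
    show "x + y \<in> range (extend_rep koopman)" unfolding u w by (simp only: extend_rep_add[symmetric] rangeI)
  qed
  moreover have "range koopman \<subseteq> koopman_algebra"
  proof
    fix T assume "T \<in> range koopman"
    then obtain g where "T = koopman g" by blast
    then have "T = extend_rep koopman (Poly_Mapping.single g 1)" by (simp add: extend_rep_single scaleC_one)
    then show "T \<in> koopman_algebra" unfolding koopman_algebra_def by (rule range_eqI)
  qed
  ultimately show "cvec.span (range koopman) \<subseteq> koopman_algebra" by (simp add: cvec.span_minimal)
qed

lemma koopman_in_algebra: "koopman g \<in> koopman_algebra"
  by (simp add: koopman_algebra_eq_span cvec.span_base)

lemma subspace_algebra: "cvec.subspace koopman_algebra"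
  by (simp add: koopman_algebra_eq_span)

lemma id_in_algebra: "id_blinfun \<in> koopman_algebra"
  using koopman_in_algebra[of 0] by (simp add: koopman_zero)

lemma algebra_compose:
  assumes "S \<in> koopman_algebra" "T \<in> koopman_algebra"
  shows "S o\<^sub>L T \<in> koopman_algebra"
proof -
  obtain x y where "S = extend_rep koopman x" "T = extend_rep koopman y"
    using assms by (auto simp: koopman_algebra_def)
  then show ?thesis unfolding koopman_algebra_def by (simp only: extend_rep_mult[symmetric] rangeI)
qed

lemma algebra_subset_cstar: "koopman_algebra \<subseteq> koopman_cstar"
  by (simp add: koopman_cstar_def closure_subset)

lemma algebra_induct [consumes 1, case_names koopman add scaleC]:
  assumes T: "T \<in> koopman_algebra"
    and koopman: "\<And>g. P (koopman g)" and add: "\<And>S T. P S \<Longrightarrow> P T \<Longrightarrow> P (S + T)"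
    and scaleC: "\<And>c T. P T \<Longrightarrow> P (c *\<^sub>C T)"
  shows "P T"
proof -
  have "P 0" using scaleC[OF koopman, of 0] by simp
  then have "cvec.subspace {T. P T}" using add scaleC by (auto simp: cvec.subspace_def)
  then show ?thesis
    using cvec.span_minimal[of "range koopman" "{T. P T}"] koopman T by (auto simp: koopman_algebra_eq_span)
qed

text \<open>Statements about the closure are reduced in this way to single group elements. The price
  is the closedness of the property, usually obtained from a bound by the operator norm.\<close>

lemma cstar_induct [consumes 1, case_names koopman add scaleC closed]:
  assumes T: "T \<in> koopman_cstar"
    and koopman: "\<And>g. P (koopman g)" and add: "\<And>S T. P S \<Longrightarrow> P T \<Longrightarrow> P (S + T)"
    and scaleC: "\<And>c T. P T \<Longrightarrow> P (c *\<^sub>C T)" and closed: "closed {T. P T}"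
  shows "P T"
proof -
  have "koopman_algebra \<subseteq> {T. P T}" using algebra_induct[of _ P] assms by blast
  then have "koopman_cstar \<subseteq> {T. P T}" unfolding koopman_cstar_def by (rule closure_minimal[OF _ closed])
  with T show ?thesis by blast
qed

lemma continuous_scaleC_blinfun: "continuous_on A ((*\<^sub>C) c :: (l2 \<Rightarrow>\<^sub>L l2) \<Rightarrow> _)"
proof (rule bounded_linear.continuous_on[OF _ continuous_on_id, unfolded id_def], rule bounded_linear_intro[where K = "cmod c"])
  show "c *\<^sub>C (x + y) = c *\<^sub>C x + c *\<^sub>C y" for x y :: "l2 \<Rightarrow>\<^sub>L l2" by (rule scaleC_add_right)
  show "c *\<^sub>C r *\<^sub>R x = r *\<^sub>R c *\<^sub>C x" for r and x :: "l2 \<Rightarrow>\<^sub>L l2"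
    by (rule blinfun_eqI) (simp add: blinfun.scaleR_left scaleR_scaleC scaleC_scaleC mult.commute)
  show "norm (c *\<^sub>C x) \<le> norm x * cmod c" for x :: "l2 \<Rightarrow>\<^sub>L l2" by (simp add: norm_scaleC_blinfun mult.commute)
qed

lemma closure_image_closed:
  assumes "continuous_on UNIV f" "f ` A \<subseteq> B" "closed B" shows "f ` closure A \<subseteq> B"
proof -
  have "closed (f -` B)" using assms(1,3) by (simp add: closed_vimage)
  moreover have "A \<subseteq> f -` B" using assms(2) by blast
  ultimately have "closure A \<subseteq> f -` B" by (rule closure_minimal[rotated])
  then show ?thesis by blast
qed

lemma closed_cstar: "closed koopman_cstar"
  by (simp add: koopman_cstar_def)

lemma cstar_add:
  assumes S: "S \<in> koopman_cstar" and T: "T \<in> koopman_cstar" shows "S + T \<in> koopman_cstar"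
proof -
  have 1: "S + T \<in> koopman_cstar" if "S \<in> koopman_algebra" "T \<in> koopman_cstar" for S T
  proof -
    have "(\<lambda>T. S + T) ` koopman_algebra \<subseteq> koopman_cstar"
      using that(1) cvec.subspace_add[OF subspace_algebra] algebra_subset_cstar by blast
    then show ?thesis
      using closure_image_closed[of "\<lambda>T. S + T" koopman_algebra koopman_cstar] that(2) closed_cstar
      continuous_on_add[OF continuous_on_const continuous_on_id, of UNIV S]
      by (simp add: koopman_cstar_def image_subset_iff)
  qed
  have "(\<lambda>S. S + T) ` koopman_algebra \<subseteq> koopman_cstar" using 1 T by blast
  then show ?thesis
    using closure_image_closed[of "\<lambda>S. S + T" koopman_algebra koopman_cstar] S closed_cstar
      continuous_on_add[OF continuous_on_id continuous_on_const, of UNIV T]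
    by (simp add: koopman_cstar_def image_subset_iff)
qed

lemma cstar_scaleC: assumes "T \<in> koopman_cstar" shows "c *\<^sub>C T \<in> koopman_cstar"
proof -
  have "(*\<^sub>C) c ` koopman_algebra \<subseteq> koopman_cstar"
    using cvec.subspace_scale[OF subspace_algebra] algebra_subset_cstar by blast
  then show ?thesis
    using closure_image_closed[of "(*\<^sub>C) c" koopman_algebra koopman_cstar] assms closed_cstar continuous_scaleC_blinfun
    by (auto simp: koopman_cstar_def)
qed

lemma cstar_compose:
  assumes S: "S \<in> koopman_cstar" and T: "T \<in> koopman_cstar" shows "S o\<^sub>L T \<in> koopman_cstar"
proof -
  have c: "continuous_on UNIV (\<lambda>T. S o\<^sub>L T)" "continuous_on UNIV (\<lambda>S. S o\<^sub>L T)" for S T :: "l2 \<Rightarrow>\<^sub>L l2"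
    by (intro bounded_bilinear.continuous_on[OF bounded_bilinear_blinfun_compose] continuous_intros)+
  have 1: "S o\<^sub>L T \<in> koopman_cstar" if "S \<in> koopman_algebra" "T \<in> koopman_cstar" for S T
  proof -
    have "(o\<^sub>L) S ` koopman_algebra \<subseteq> koopman_cstar"
      using that(1) algebra_compose algebra_subset_cstar by blast
    then show ?thesis
      using closure_image_closed[OF c(1), of S koopman_algebra koopman_cstar] that(2) closed_cstar
      by (auto simp: koopman_cstar_def)
  qed
  have "(\<lambda>S. S o\<^sub>L T) ` koopman_algebra \<subseteq> koopman_cstar" using 1 T by blast
  then show ?thesis
    using closure_image_closed[OF c(2), of T koopman_algebra koopman_cstar] S closed_cstar
    by (auto simp: koopman_cstar_def)
qed

lemma continuous_blinfun_apply: "continuous_on A (\<lambda>T :: l2 \<Rightarrow>\<^sub>L l2. T f)"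
  by (intro continuous_intros)

lemma cstar_clinear: "T \<in> koopman_cstar \<Longrightarrow> clinear_op T"
proof (induction rule: cstar_induct)
  case closed
  have "continuous_on UNIV (\<lambda>T :: l2 \<Rightarrow>\<^sub>L l2. c *\<^sub>C T f)" for c f
    by (rule bounded_linear.continuous_on[OF bounded_linear_scaleC continuous_blinfun_apply])
  then show ?case
    unfolding clinear_op_def by (intro closed_Collect_all closed_Collect_eq continuous_blinfun_apply)
qed (simp_all add: koopman_scaleC clinear_op_def blinfun.add_left scaleC_add_right scaleC_scaleC mult.commute)

section \<open>Adjoints\<close>

text \<open>Since \<open>cadjoint\<close> is a definite description, it says nothing before
  existence is known; the relation allows existence to be proved by approximation.\<close>

definition is_adjoint :: "(l2 \<Rightarrow>\<^sub>L l2) \<Rightarrow> (l2 \<Rightarrow>\<^sub>L l2) \<Rightarrow> bool" where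
  "is_adjoint T S \<longleftrightarrow> (\<forall>x y. cinner (T x) y = cinner x (S y))"

lemma cadjoint_eqI: assumes "is_adjoint T S" shows "cadjoint T = S"
  unfolding cadjoint_def
proof (rule the_equality)
  show "\<forall>x y. cinner (T x) y = cinner x (S y)" using assms by (simp add: is_adjoint_def)
  fix S' :: "l2 \<Rightarrow>\<^sub>L l2" assume "\<forall>x y. cinner (T x) y = cinner x (S' y)"
  with assms have "cinner (S' y) x = cinner (S y) x" for x y
    unfolding is_adjoint_def by (metis cinner_commute)
  then show "S' = S" by (intro blinfun_eqI cinner_eqI) blast
qed

text \<open>The square of the norm of S y is the product of T (S y) with y. Applied to differences,
  the bound makes the adjoints of a convergent sequence Cauchy.\<close>

lemma is_adjoint_norm: assumes "is_adjoint T S" shows "norm S \<le> norm T"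
proof (rule norm_blinfun_bound)
  fix y
  have "(norm (S y))\<^sup>2 = cmod (cinner (S y) (S y))" by (simp add: cinner_self norm_power)
  also have "\<dots> = cmod (cinner (T (S y)) y)" using assms by (simp add: is_adjoint_def)
  also have "\<dots> \<le> norm (T (S y)) * norm y" by (rule cinner_cauchy_schwarz)
  also have "\<dots> \<le> norm T * norm (S y) * norm y" by (intro mult_right_mono norm_blinfun) simp
  finally have "norm (S y) * norm (S y) \<le> norm (S y) * (norm T * norm y)"
    by (simp add: power2_eq_square mult_ac)
  then show "norm (S y) \<le> norm T * norm y"
    by (cases "norm (S y) = 0") (auto dest: mult_left_le_imp_le)
qed simp

lemma is_adjoint_diff: "is_adjoint T S \<Longrightarrow> is_adjoint T' S' \<Longrightarrow> is_adjoint (T - T') (S - S')"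
  by (simp add: is_adjoint_def blinfun.diff_left cinner_diff_left cinner_diff_right)

text \<open>Group elements have their inverses as adjoints, and linear combinations and norm limits
  inherit adjoints. The adjoint is thereby found inside the closure itself, so that it is closed
  under the involution.\<close>

lemma cstar_adjoint_exists: "T \<in> koopman_cstar \<Longrightarrow> \<exists>S\<in>koopman_cstar. is_adjoint T S"
proof (induction rule: cstar_induct)
  case (koopman g)
  show ?case
    using cinner_koopman koopman_in_algebra[of "- g"] algebra_subset_cstar by (auto simp: is_adjoint_def)
next
  case (add T T')
  then obtain S S' where "S \<in> koopman_cstar" "is_adjoint T S" "S' \<in> koopman_cstar" "is_adjoint T' S'" by blast
  then show ?case
    by (intro bexI[of _ "S + S'"]) (auto simp: is_adjoint_def blinfun.add_left cinner_add_left cinner_add_right cstar_add)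
next
  case (scaleC c T)
  then obtain S where "S \<in> koopman_cstar" "is_adjoint T S" by blast
  then show ?case
    by (intro bexI[of _ "cnj c *\<^sub>C S"]) (auto simp: is_adjoint_def cinner_scaleC_left cinner_scaleC_right cstar_scaleC)
next
  case closed
  show ?case unfolding closed_sequential_limits mem_Collect_eq
  proof (intro allI impI, elim conjE)
    fix X T assume "\<forall>n. \<exists>S\<in>koopman_cstar. is_adjoint (X n) S" and T: "X \<longlonglongrightarrow> T"
    then obtain Y where Y: "\<And>n. Y n \<in> koopman_cstar" "\<And>n. is_adjoint (X n) (Y n)" by metis
    have "Cauchy Y"
    proof (rule CauchyI)
      fix e :: real assume "0 < e"
      then obtain N where "\<forall>m\<ge>N. \<forall>n\<ge>N. norm (X m - X n) < e"
        using LIMSEQ_imp_Cauchy[OF T] by (auto simp: Cauchy_iff)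
      then show "\<exists>N. \<forall>m\<ge>N. \<forall>n\<ge>N. norm (Y m - Y n) < e"
        using is_adjoint_norm[OF is_adjoint_diff[OF Y(2) Y(2)]] by (metis le_less_trans)
    qed
    \<comment> \<open>Completeness of L^2 enters here, through completeness of the space of
      operators.\<close>
    then obtain S where S: "Y \<longlonglongrightarrow> S" by (metis Cauchy_convergent convergent_def)
    have "S \<in> koopman_cstar" using closed_sequentially[OF closed_cstar _ S] Y(1) by blast
    moreover have "cinner (T x) y = cinner x (S y)" for x y
    proof (rule LIMSEQ_unique)
      show "(\<lambda>n. cinner (X n x) y) \<longlonglongrightarrow> cinner (T x) y"
        by (intro bounded_bilinear.tendsto[OF bounded_bilinear_cinner] blinfun.tendsto T tendsto_const)
      have "(\<lambda>n. cinner x (Y n y)) \<longlonglongrightarrow> cinner x (S y)"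
        by (intro bounded_bilinear.tendsto[OF bounded_bilinear_cinner] blinfun.tendsto S tendsto_const)
      then show "(\<lambda>n. cinner (X n x) y) \<longlonglongrightarrow> cinner x (S y)" using Y(2) by (simp add: is_adjoint_def)
    qed
    ultimately show "\<exists>S\<in>koopman_cstar. is_adjoint T S" by (auto simp: is_adjoint_def)
  qed
qed

lemma cstar_cadjoint:
  assumes "T \<in> koopman_cstar"
  shows "cadjoint T \<in> koopman_cstar" "cinner (T x) y = cinner x (cadjoint T y)"
  using cstar_adjoint_exists[OF assms] cadjoint_eqI by (auto simp: is_adjoint_def)

text \<open>If T vanishes on the cylinder functions, then every T^* y is orthogonal to all of them
  and is zero by \<open>cyl_total\<close>; hence T is zero.\<close>

lemma cstar_eq_zeroI:
  assumes "T \<in> koopman_cstar" "\<And>v. T (cyl v) = 0" shows "T = 0"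
proof (rule blinfun_eqI)
  fix f
  have "cadjoint T y = 0" for y
  proof (rule cyl_total)
    show "cinner (cadjoint T y) (cyl v) = 0" for v
      using cstar_cadjoint(2)[OF assms(1), of "cyl v" y] assms(2) by (metis cinner_commute cinner_zero(1) complex_cnj_zero)
  qed
  then have "cinner (T f) y = cinner 0 y" for y using cstar_cadjoint(2)[OF assms(1), of f y] by simp
  then have "T f = 0" by (rule cinner_eqI)
  then show "T f = blinfun_apply 0 f" by simp
qed

section \<open>Restriction to finite levels and the limit of their traces\<close>

section \<open>Finite levels\<close>

definition words :: "nat \<Rightarrow> bool list set" where
  "words n = {v. length v = n}"

lemma in_words [simp]: "v \<in> words n \<longleftrightarrow> length v = n"
  by (simp add: words_def)

lemma words_0 [simp]: "words 0 = {[]}"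
  by (auto simp: words_def)

lemma finite_words [simp]: "finite (words n)" and card_words: "card (words n) = 2 ^ n"
  using finite_lists_length_eq[of "UNIV :: bool set" n] card_lists_length_eq[of "UNIV :: bool set" n]
  by (simp_all add: words_def)

lemma sum_words_Suc: "(\<Sum>v\<in>words (Suc n). F v) = (\<Sum>v\<in>words n. F (False # v)) + (\<Sum>v\<in>words n. F (True # v))"
proof -
  have "words (Suc n) = (#) False ` words n \<union> (#) True ` words n"
    by (auto simp: words_def length_Suc_conv)
  moreover have "(#) False ` words n \<inter> (#) True ` words n = {}" by auto
  ultimately have "sum F (words (Suc n)) = sum F ((#) False ` words n) + sum F ((#) True ` words n)"
    by (simp add: sum.union_disjoint)
  then show ?thesis by (simp add: sum.reindex inj_on_def)
qed

definition level_space :: "nat \<Rightarrow> l2 set" where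
  "level_space n = cvec.span (cyl ` words n)"

lemma cyl_in_level: "length v = n \<Longrightarrow> cyl v \<in> level_space n"
  unfolding level_space_def by (rule cvec.span_base) auto

text \<open>By orthonormality of the cylinder functions of one length, the right-hand side is the
  orthogonal projection. Written as an equation, membership becomes a closed condition.\<close>

lemma level_expansion: "f \<in> level_space n \<longleftrightarrow> f = (\<Sum>v\<in>words n. cinner f (cyl v) *\<^sub>C cyl v)"
proof
  assume "f \<in> level_space n"
  then show "f = (\<Sum>v\<in>words n. cinner f (cyl v) *\<^sub>C cyl v)"
    unfolding level_space_def
  proof (induction rule: cvec.span_induct_alt)
    case base
    then show ?case by simp
  next
    case (step c x y)
    then obtain w where w: "x = cyl w" "length w = n" by auto
    have "(\<Sum>v\<in>words n. cinner (c *\<^sub>C x + y) (cyl v) *\<^sub>C cyl v) =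
      c *\<^sub>C (\<Sum>v\<in>words n. cinner x (cyl v) *\<^sub>C cyl v) + (\<Sum>v\<in>words n. cinner y (cyl v) *\<^sub>C cyl v)"
      by (simp add: cinner_add_left cinner_scaleC_left scaleC_add_left sum.distrib cvec.scale_sum_right scaleC_scaleC)
    also have "(\<Sum>v\<in>words n. cinner x (cyl v) *\<^sub>C cyl v) = (\<Sum>v\<in>words n. if v = w then x else 0)"
      by (rule sum.cong) (auto simp: w cinner_cyl scaleC_one)
    also have "\<dots> = x" using w by simp
    finally show ?case using step by simp
  qed
next
  assume "f = (\<Sum>v\<in>words n. cinner f (cyl v) *\<^sub>C cyl v)"
  moreover have "(\<Sum>v\<in>words n. cinner f (cyl v) *\<^sub>C cyl v) \<in> level_space n"
    unfolding level_space_def by (intro cvec.span_sum cvec.span_scale cvec.span_base) auto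
  ultimately show "f \<in> level_space n" by metis
qed

lemma subspace_level: "cvec.subspace (level_space n)"
  by (simp add: level_space_def)

lemma continuous_cinner_left: "continuous_on A (\<lambda>x. cinner x (y :: 'a::complex_inner))"
  by (intro bounded_bilinear.continuous_on[OF bounded_bilinear_cinner] continuous_intros)

lemma continuous_scaleC_left: "continuous_on A (\<lambda>c. c *\<^sub>C (y :: 'a::complex_inner))"
proof (rule linear_continuous_on, rule bounded_linear_intro[where K = "norm y"])
  show "(r *\<^sub>R c) *\<^sub>C y = r *\<^sub>R c *\<^sub>C y" for r c
    by (simp add: scaleR_scaleC scaleC_scaleC scaleR_conv_of_real)
qed (simp_all add: scaleC_add_left norm_scaleC)

lemma closed_level: "closed (level_space n)"
proof -
  have "continuous_on UNIV (\<lambda>f. \<Sum>v\<in>words n. cinner f (cyl v) *\<^sub>C cyl v)"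
    by (intro continuous_on_sum continuous_on_compose2[OF continuous_scaleC_left continuous_cinner_left]) auto
  then have "closed {f. f = (\<Sum>v\<in>words n. cinner f (cyl v) *\<^sub>C cyl v)}"
    by (intro closed_Collect_eq continuous_on_id)
  also have "{f. f = (\<Sum>v\<in>words n. cinner f (cyl v) *\<^sub>C cyl v)} = level_space n"
    using level_expansion[of _ n] by blast
  finally show ?thesis .
qed

lemma cstar_level:
  assumes "T \<in> koopman_cstar" "f \<in> level_space n" shows "T f \<in> level_space n"
  using assms
proof (induction rule: cstar_induct)
  case (koopman g)
  have "f = (\<Sum>v\<in>words n. cinner f (cyl v) *\<^sub>C cyl v)" using level_expansion koopman by blast
  then have "koopman g f = (\<Sum>v\<in>words n. cinner f (cyl v) *\<^sub>C cyl (act g v))"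
    by (metis (no_types, lifting) blinfun.sum_right koopman_cyl koopman_scaleC sum.cong)
  also have "\<dots> \<in> level_space n"
    by (intro cvec.subspace_sum[OF subspace_level] cvec.subspace_scale[OF subspace_level] cyl_in_level) simp
  finally show ?case .
next
  case closed
  have "closed ((\<lambda>T :: l2 \<Rightarrow>\<^sub>L l2. T f) -` level_space n)"
    using closed_level continuous_blinfun_apply by (simp add: closed_vimage)
  then show ?case using assms(2) by (simp add: vimage_def)
qed (simp_all add: blinfun.add_left cvec.subspace_add[OF subspace_level] cvec.subspace_scale[OF subspace_level])

lemma cstar_cyl_expansion:
  "T \<in> koopman_cstar \<Longrightarrow> T (cyl v) = (\<Sum>w\<in>words (length v). cinner (T (cyl v)) (cyl w) *\<^sub>C cyl w)"
  using cstar_level[OF _ cyl_in_level[OF refl], of T v] by (simp only: level_expansion)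

section \<open>Residual finite dimensionality\<close>

lemma hilbert_space_level: "hilbert_space_on (level_space n)"
  by (simp add: hilbert_space_on_def subspace_level complete_eq_closed closed_level)

lemma residually_finite_dim_cstar: "residually_finite_dim TYPE(l2) koopman_cstar"
proof -
  define \<phi> where "\<phi> n T = (\<lambda>f. if f \<in> level_space n then blinfun_apply T f else 0)" for n and T :: "l2 \<Rightarrow>\<^sub>L l2"
  note sub = cvec.subspace_add[OF subspace_level] cvec.subspace_scale[OF subspace_level]
  have rep: "star_rep koopman_cstar (o\<^sub>L) id_blinfun cadjoint (level_space n) (\<phi> n)" for n
    unfolding star_rep_def
  proof (intro conjI ballI allI)
    show "hilbert_space_on (level_space n)" by (rule hilbert_space_level)
    fix a assume a: "a \<in> koopman_cstar"
    show "bounded_operator_on (level_space n) (\<phi> n a)"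
      unfolding bounded_operator_on_def
      using cstar_level[OF a, of _ n] clinear_opD[OF cstar_clinear[OF a]]
      by (auto simp: \<phi>_def blinfun.add_right sub intro!: exI[of _ "norm a"] norm_blinfun)
    show "\<phi> n (c *\<^sub>C a) = c *\<^sub>C \<phi> n a" for c
      by (auto simp: \<phi>_def scaleC_fun_def)
    show "cinner (\<phi> n a x) y = cinner x (\<phi> n (cadjoint a) y)" if "x \<in> level_space n" "y \<in> level_space n" for x y
      using that cstar_cadjoint(2)[OF a] by (simp add: \<phi>_def)
    fix b assume b: "b \<in> koopman_cstar"
    show "\<phi> n (a + b) = \<phi> n a + \<phi> n b"
      by (auto simp: \<phi>_def plus_fun_def blinfun.add_left)
    show "\<phi> n (a o\<^sub>L b) = \<phi> n a \<circ> \<phi> n b"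
      using cstar_level[OF b, of _ n] by (auto simp: \<phi>_def fun_eq_iff blinfun.zero_right)
  next
    show "\<phi> n id_blinfun = (\<lambda>x. if x \<in> level_space n then x else 0)" by (auto simp: \<phi>_def)
  qed
  have fin: "cfinite_dim (level_space n)" for n
    unfolding cfinite_dim_def level_space_def by (intro exI[of _ "cyl ` words n"]) auto
  have sep: "\<exists>n. \<phi> n x \<noteq> 0" if "x \<in> koopman_cstar" "x \<noteq> 0" for x
  proof (rule ccontr)
    assume "\<not> ?thesis"
    then have "\<phi> (length v) x (cyl v) = 0" for v by (simp add: zero_fun_def)
    then have "x (cyl v) = 0" for v by (simp add: \<phi>_def cyl_in_level)
    then show False using cstar_eq_zeroI that by blast
  qed
  show ?thesis
    unfolding residually_finite_dim_def
    by (rule exI[of _ "range (\<lambda>n. (level_space n, \<phi> n))"]) (use rep fin sep in auto)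
qed

lemma residually_finite_dim_subset:
  assumes "residually_finite_dim TYPE('h::complex_inner) B" "A \<subseteq> B"
  shows "residually_finite_dim TYPE('h) A"
proof -
  have sub: "star_rep A (o\<^sub>L) id_blinfun cadjoint H \<phi>" if "star_rep B (o\<^sub>L) id_blinfun cadjoint H \<phi>" for H :: "'h set" and \<phi>
    using that assms(2) unfolding star_rep_def by (meson subsetD)
  from assms(1) show ?thesis
    unfolding residually_finite_dim_def
  proof (elim exE conjE, intro exI conjI)
    fix \<F> :: "('h set \<times> ((l2 \<Rightarrow>\<^sub>L l2) \<Rightarrow> 'h \<Rightarrow> 'h)) set"
    assume "\<forall>(H, \<phi>)\<in>\<F>. star_rep B (o\<^sub>L) id_blinfun cadjoint H \<phi> \<and> cfinite_dim H"
    then show "\<forall>(H, \<phi>)\<in>\<F>. star_rep A (o\<^sub>L) id_blinfun cadjoint H \<phi> \<and> cfinite_dim H"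
      using sub by (simp add: case_prod_beta)
    assume "\<forall>x\<in>B. x \<noteq> 0 \<longrightarrow> (\<exists>(H, \<phi>)\<in>\<F>. \<phi> x \<noteq> 0)"
    then show "\<forall>x\<in>A. x \<noteq> 0 \<longrightarrow> (\<exists>(H, \<phi>)\<in>\<F>. \<phi> x \<noteq> 0)"
      using assms(2) by (simp add: subset_eq)
  qed
qed

section \<open>The trace\<close>

definition level_trace :: "nat \<Rightarrow> (l2 \<Rightarrow>\<^sub>L l2) \<Rightarrow> complex" where
  "level_trace n T = (\<Sum>v\<in>words n. cinner (T (cyl v)) (cyl v)) / 2 ^ n"

lemma level_trace_add: "level_trace n (S + T) = level_trace n S + level_trace n T"
  by (simp add: level_trace_def blinfun.add_left cinner_add_left sum.distrib add_divide_distrib)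

lemma level_trace_scaleC: "level_trace n (c *\<^sub>C T) = c * level_trace n T"
  by (simp add: level_trace_def cinner_scaleC_left sum_distrib_left)

lemma level_trace_diff: "level_trace n (S - T) = level_trace n S - level_trace n T"
  using level_trace_add[of n "S - T" T] by simp

text \<open>The bound is uniform in n, which lets convergence of the level traces pass to norm
  limits of operators.\<close>

lemma level_trace_bound: "cmod (level_trace n T) \<le> norm T"
proof -
  have "cmod (\<Sum>v\<in>words n. cinner (T (cyl v)) (cyl v)) \<le> (\<Sum>v\<in>words n. norm T)"
  proof (rule sum_norm_le)
    fix v
    have "norm (cinner (T (cyl v)) (cyl v)) \<le> norm (T (cyl v)) * norm (cyl v)" by (rule cinner_cauchy_schwarz)
    also have "\<dots> \<le> norm T" using norm_blinfun[of T "cyl v"] by (simp add: norm_cyl)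
    finally show "norm (cinner (T (cyl v)) (cyl v)) \<le> norm T" .
  qed
  then show ?thesis by (simp add: level_trace_def norm_divide norm_power card_words field_simps)
qed

lemma level_trace_koopman:
  "level_trace n (koopman g) = complex_of_real (real (card {v \<in> words n. act g v = v}) / 2 ^ n)"
proof -
  have "(\<Sum>v\<in>words n. cinner (koopman g (cyl v)) (cyl v)) = (\<Sum>v\<in>words n. if act g v = v then 1 else 0)"
    by (rule sum.cong) (simp_all add: koopman_cyl cinner_cyl)
  then show ?thesis by (simp add: level_trace_def sum.If_cases Int_def)
qed

text \<open>For a group element the level trace is the proportion of fixed words. A fixed word has a
  fixed parent and each parent has two children, so the proportion decreases with the level. Norm
  limits are handled by splitting e into thirds.\<close>

lemma level_trace_convergent: "T \<in> koopman_cstar \<Longrightarrow> convergent (\<lambda>n. level_trace n T)"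
proof (induction rule: cstar_induct)
  case (koopman g)
  define fx where "fx n = card {v \<in> words n. act g v = v}" for n
  have "fx (Suc n) \<le> 2 * fx n" for n
  proof -
    have fin: "finite {v \<in> words n. act g v = v}"
      by (rule finite_subset[OF _ finite_words[of n]]) blast
    have "{v \<in> words (Suc n). act g v = v} \<subseteq> (\<lambda>(v, i). v @ [i]) ` ({v \<in> words n. act g v = v} \<times> UNIV)"
    proof
      fix v assume v: "v \<in> {v \<in> words (Suc n). act g v = v}"
      then obtain u i where u: "v = u @ [i]" by (metis (mono_tags) in_words length_0_conv mem_Collect_eq nat.distinct(1) rev_exhaust)
      then have "act g u = u" "length u = n" using v take_act[of u g "[i]"] by auto
      then show "v \<in> (\<lambda>(v, i). v @ [i]) ` ({v \<in> words n. act g v = v} \<times> UNIV)" using u by auto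
    qed
    then have "fx (Suc n) \<le> card ((\<lambda>(v, i). v @ [i]) ` ({v \<in> words n. act g v = v} \<times> (UNIV :: bool set)))"
      unfolding fx_def
    proof (rule card_mono[rotated])
      show "finite ((\<lambda>(v, i). v @ [i]) ` ({v \<in> words n. act g v = v} \<times> (UNIV :: bool set)))"
        by (intro finite_imageI finite_cartesian_product fin finite)
    qed
    also have "\<dots> \<le> card ({v \<in> words n. act g v = v} \<times> (UNIV :: bool set))" by (intro card_image_le finite_cartesian_product fin finite)
    finally show ?thesis by (simp add: fx_def card_cartesian_product)
  qed
  then have fx: "real (fx (Suc n)) \<le> 2 * real (fx n)" for n
    using of_nat_mono[of "fx (Suc n)" "2 * fx n", where 'a = real] by simp
  have "decseq (\<lambda>n. real (fx n) / 2 ^ n)"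
  proof (rule decseq_SucI)
    show "real (fx (Suc n)) / 2 ^ Suc n \<le> real (fx n) / 2 ^ n" for n
      using divide_right_mono[OF fx[of n], of "2 ^ Suc n"] by simp
  qed
  then obtain l where "(\<lambda>n. real (fx n) / 2 ^ n) \<longlonglongrightarrow> l"
    by (rule decseq_convergent[where B = 0]) auto
  then have "convergent (\<lambda>n. complex_of_real (real (fx n) / 2 ^ n))"
    by (metis convergentI tendsto_of_real)
  then show ?case by (simp add: level_trace_koopman fx_def)
next
  case (add S T)
  then show ?case by (simp add: level_trace_add convergent_add)
next
  case (scaleC c T)
  then show ?case by (simp add: level_trace_scaleC convergent_mult convergent_const)
next
  case closed
  show ?case unfolding closed_sequential_limits mem_Collect_eq
  proof (intro allI impI, elim conjE)
    fix X T assume conv: "\<forall>k. convergent (\<lambda>n. level_trace n (X k))" and T: "X \<longlonglongrightarrow> T"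
    have "Cauchy (\<lambda>n. level_trace n T)"
    proof (rule CauchyI)
      fix e :: real assume e: "0 < e"
      obtain k where k: "norm (X k - T) < e / 3" using LIMSEQ_D[OF T, of "e / 3"] e by auto
      have "Cauchy (\<lambda>n. level_trace n (X k))" using conv by (simp add: Cauchy_convergent_iff)
      then obtain N where N: "\<And>m n. m \<ge> N \<Longrightarrow> n \<ge> N \<Longrightarrow> cmod (level_trace m (X k) - level_trace n (X k)) < e / 3"
        using CauchyD[of _ "e / 3"] e by (metis divide_pos_pos zero_less_numeral)
      have 1: "cmod (level_trace m T - level_trace m (X k)) < e / 3" for m
        using level_trace_bound[of m "T - X k"] k by (simp add: level_trace_diff norm_minus_commute)
      have "cmod (level_trace m T - level_trace n T) < e" if "m \<ge> N" "n \<ge> N" for m n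
        using norm_triangle_ineq[of "level_trace m T - level_trace m (X k)" "level_trace m (X k) - level_trace n T"]
          norm_triangle_ineq[of "level_trace m (X k) - level_trace n (X k)" "level_trace n (X k) - level_trace n T"]
          N[OF that] 1[of m] 1[of n] by (simp add: norm_minus_commute)
      then show "\<exists>N. \<forall>m\<ge>N. \<forall>n\<ge>N. norm (level_trace m T - level_trace n T) < e" by blast
    qed
    then show "convergent (\<lambda>n. level_trace n T)" by (simp add: Cauchy_convergent_iff)
  qed
qed

definition koopman_trace :: "(l2 \<Rightarrow>\<^sub>L l2) \<Rightarrow> complex" where
  "koopman_trace T = lim (\<lambda>n. level_trace n T)"

lemma koopman_trace_limit: "T \<in> koopman_cstar \<Longrightarrow> (\<lambda>n. level_trace n T) \<longlonglongrightarrow> koopman_trace T"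
  unfolding koopman_trace_def using level_trace_convergent by (simp add: convergent_LIMSEQ_iff)

lemma koopman_trace_eqI: "(\<lambda>n. level_trace n T) \<longlonglongrightarrow> t \<Longrightarrow> koopman_trace T = t"
  unfolding koopman_trace_def by (rule limI)

lemma level_trace_commute:
  assumes S: "S \<in> koopman_cstar" and T: "T \<in> koopman_cstar"
  shows "level_trace n (S o\<^sub>L T) = level_trace n (T o\<^sub>L S)"
proof -
  have *: "cinner (S (T (cyl v))) (cyl v) = (\<Sum>w\<in>words n. cinner (T (cyl v)) (cyl w) * cinner (S (cyl w)) (cyl v))"
    if "S \<in> koopman_cstar" "T \<in> koopman_cstar" "length v = n" for S T v
  proof -
    have "S (T (cyl v)) = (\<Sum>w\<in>words n. cinner (T (cyl v)) (cyl w) *\<^sub>C S (cyl w))"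
      by (subst cstar_cyl_expansion[OF that(2)])
        (simp add: blinfun.sum_right clinear_opD[OF cstar_clinear[OF that(1)]] that(3))
    then show ?thesis by (simp add: cinner_sum_left cinner_scaleC_left)
  qed
  have "(\<Sum>v\<in>words n. cinner ((S o\<^sub>L T) (cyl v)) (cyl v)) =
    (\<Sum>v\<in>words n. \<Sum>w\<in>words n. cinner (T (cyl v)) (cyl w) * cinner (S (cyl w)) (cyl v))"
    by (rule sum.cong) (simp_all add: *[OF S T])
  also have "\<dots> = (\<Sum>w\<in>words n. \<Sum>v\<in>words n. cinner (T (cyl v)) (cyl w) * cinner (S (cyl w)) (cyl v))"
    by (rule sum.swap)
  also have "\<dots> = (\<Sum>w\<in>words n. cinner ((T o\<^sub>L S) (cyl w)) (cyl w))"
    by (rule sum.cong) (simp_all add: *[OF T S] mult.commute)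
  finally show ?thesis by (simp add: level_trace_def)
qed

lemma level_trace_square:
  assumes "T \<in> koopman_cstar"
  shows "level_trace n (cadjoint T o\<^sub>L T) = complex_of_real ((\<Sum>v\<in>words n. (norm (T (cyl v)))\<^sup>2) / 2 ^ n)"
proof -
  have "cinner (cadjoint T (T x)) x = complex_of_real ((norm (T x))\<^sup>2)" for x
  proof -
    have "cinner (cadjoint T (T x)) x = cnj (cinner x (cadjoint T (T x)))" by (rule cinner_commute)
    also have "\<dots> = cnj (cinner (T x) (T x))" by (simp only: cstar_cadjoint(2)[OF assms])
    finally show ?thesis by (simp add: cinner_self)
  qed
  then show ?thesis by (simp add: level_trace_def)
qed

section \<open>Faithfulness of the trace\<close>

section \<open>Generation of the group\<close>

text \<open>No case for inverses arises, because the four generators are involutions.\<close>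

lemma grigorchuk_induct [case_names zero gen_a gen_b gen_c gen_d add]:
  assumes zero: "P 0" and gens: "P gen\<^sub>a" "P gen\<^sub>b" "P gen\<^sub>c" "P gen\<^sub>d"
    and add: "\<And>g h. P g \<Longrightarrow> P h \<Longrightarrow> P (g + h)"
  shows "P g"
proof -
  let ?S = "{gen_a, gen_b, gen_c, gen_d}"
  have g: "P (Abs_grigorchuk k)" if "k \<in> ?S" for k
    using that gens by (auto simp: gen\<^sub>a_def gen\<^sub>b_def gen\<^sub>c_def gen\<^sub>d_def)
  have "P (Abs_grigorchuk k)" if "k \<in> generate tree_aut ?S" for k
    using that
  proof (induction k rule: generate.induct)
    case one
    then show ?case using zero by (simp add: zero_grigorchuk_def)
  next
    case (incl h)
    then show ?case by (rule g)
  next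
    case (inv h)
    have "inv\<^bsub>tree_aut\<^esub> h = h"
    proof (rule group.inv_equality[OF group_tree_aut])
      show "h \<otimes>\<^bsub>tree_aut\<^esub> h = \<one>\<^bsub>tree_aut\<^esub>"
        using inv gen_involution by (auto simp: tree_aut_def fun_eq_iff)
    qed (use inv gen_in_tree_aut in auto)
    then show ?case using g[OF inv] by simp
  next
    case (eng h k)
    have "Abs_grigorchuk (h \<otimes>\<^bsub>tree_aut\<^esub> k) = Abs_grigorchuk h + Abs_grigorchuk k"
      using eng.hyps by (simp add: plus_grigorchuk.abs_eq eq_onp_same_args)
    then show ?case using add eng.IH by simp
  qed
  from this[OF act] show ?thesis by (simp add: act_inverse)
qed

section \<open>Almost invariant isometries\<close>

definition avg :: "l2 \<Rightarrow>\<^sub>L l2" where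
  "avg = (1 / sqrt 2) *\<^sub>R (branch False + branch True)"

text \<open>Since \<open>avg f\<close> is the composition of f with \<open>stl\<close>,
  \<open>spread n\<close> is composition with the n-fold shift. Equivalently, it is 2^(-n/2) times
  the sum of S_x over all words x of length n.\<close>

primrec spread :: "nat \<Rightarrow> l2 \<Rightarrow>\<^sub>L l2" where
  "spread 0 = id_blinfun"
| "spread (Suc n) = avg o\<^sub>L spread n"

lemma avg_apply: "avg f = (1 / sqrt 2) *\<^sub>R (branch False f + branch True f)"
  by (simp add: avg_def blinfun.scaleR_left blinfun.add_left)

lemma norm_avg: "norm (avg f) = norm f"
proof (rule norm_l2_eqI)
  have "complex_of_real (sqrt 2) * complex_of_real (sqrt 2) = 2" by (simp flip: of_real_mult)
  then show "cinner (avg f) (avg f) = cinner f f"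
    by (simp add: avg_apply scaleR_scaleC cinner_scaleC_left cinner_scaleC_right cinner_add_left
        cinner_add_right cinner_branch_same cinner_branch_other field_simps)
qed

lemma norm_spread: "norm (spread n f) = norm f"
  by (induction n) (simp_all add: norm_avg)

lemma koopman_gen_a_spread: "koopman gen\<^sub>a (spread (Suc n) f) = spread (Suc n) f"
  by (simp add: avg_apply blinfun.scaleR_right blinfun.add_right koopman_gen_branch add.commute)

lemma norm_avg_le:
  assumes "koopman g (branch False f) = branch False p" "koopman g (branch True f) = branch True q"
  shows "norm (koopman g (avg f) - avg f) \<le> (1 / sqrt 2) * (norm (p - f) + norm (q - f))"
proof -
  have "koopman g (avg f) - avg f = (1 / sqrt 2) *\<^sub>R (branch False (p - f) + branch True (q - f))"
    by (simp add: avg_apply blinfun.scaleR_right blinfun.add_right blinfun.diff_right assms algebra_simps)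
  also have "norm \<dots> \<le> (1 / sqrt 2) * (norm (branch False (p - f)) + norm (branch True (q - f)))"
    by (simp add: divide_right_mono norm_triangle_ineq)
  finally show ?thesis by (simp only: norm_branch)
qed

text \<open>
  The sections of \<open>b\<close>, \<open>c\<close>, \<open>d\<close> are trivial or equal to \<open>a\<close> except at the words \<open>1\<dots>1\<close>, so that
  these generators almost fix the isometries \<open>spread n\<close>.
\<close>

lemma norm_gen_spread:
  "norm (koopman gen\<^sub>b (spread (Suc n) f) - spread (Suc n) f) \<le> 2 * (1 / sqrt 2) ^ n * norm f \<and>
   norm (koopman gen\<^sub>c (spread (Suc n) f) - spread (Suc n) f) \<le> 2 * (1 / sqrt 2) ^ n * norm f \<and>
   norm (koopman gen\<^sub>d (spread (Suc n) f) - spread (Suc n) f) \<le> 2 * (1 / sqrt 2) ^ n * norm f"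
proof (induction n)
  case 0
  have "norm (koopman g (spread (Suc 0) f) - spread (Suc 0) f) \<le> 2 * norm f" for g
    using norm_triangle_ineq4[of "koopman g (spread (Suc 0) f)" "spread (Suc 0) f"]
    unfolding norm_koopman norm_spread by simp
  then show ?case by simp
next
  case (Suc n)
  let ?f = "spread (Suc n) f"
  \<comment> \<open>The section at 0 is trivial or equal to a, and a fixes
    \<open>spread (Suc n) f\<close> exactly, so the half below 0 contributes no error. The half
    below 1 repeats the situation one level down, which yields one factor 1 /
    \<open>sqrt 2\<close>.\<close>
  have *: "norm (koopman g (spread (Suc (Suc n)) f) - spread (Suc (Suc n)) f) \<le> 2 * (1 / sqrt 2) ^ Suc n * norm f"
    if "koopman g (branch False ?f) = branch False ?f" "koopman g (branch True ?f) = branch True q"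
      "norm (q - ?f) \<le> 2 * (1 / sqrt 2) ^ n * norm f" for g q
  proof -
    have "norm (koopman g (avg ?f) - avg ?f) \<le> (1 / sqrt 2) * (norm (?f - ?f) + norm (q - ?f))"
      by (rule norm_avg_le[OF that(1,2)])
    also have "\<dots> \<le> (1 / sqrt 2) * (2 * (1 / sqrt 2) ^ n * norm f)"
      using that(3) by (intro mult_left_mono) auto
    finally show ?thesis by simp
  qed
  show ?case
    by (intro conjI *[OF _ _ conjunct1[OF Suc]] *[OF _ _ conjunct1[OF conjunct2[OF Suc]]] *[OF _ _ conjunct2[OF conjunct2[OF Suc]]])
      (simp_all only: koopman_gen_branch koopman_gen_a_spread)
qed

lemma spread_almost_invariant: "(\<lambda>n. (koopman g o\<^sub>L spread n) - spread n) \<longlonglongrightarrow> 0"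
proof (induction g rule: grigorchuk_induct)
  case zero
  have "(koopman 0 o\<^sub>L spread n) - spread n = 0" for n by (rule blinfun_eqI) (simp add: koopman_zero blinfun.diff_left)
  then show ?case by simp
next
  case gen_a
  have "(koopman gen\<^sub>a o\<^sub>L spread (Suc n)) - spread (Suc n) = 0" for n
    by (rule blinfun_eqI) (simp only: blinfun.diff_left blinfun_apply_blinfun_compose koopman_gen_a_spread blinfun.zero_left diff_self)
  then show ?case by (subst filterlim_sequentially_Suc[symmetric]) (simp del: spread.simps)
next
  case (add g h)
  have "(koopman (g + h) o\<^sub>L spread n) - spread n =
    (koopman g o\<^sub>L ((koopman h o\<^sub>L spread n) - spread n)) + ((koopman g o\<^sub>L spread n) - spread n)" for n
    by (rule blinfun_eqI) (simp add: koopman_add blinfun.diff_left blinfun.diff_right blinfun.add_left)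
  moreover have "(\<lambda>n. (koopman g o\<^sub>L ((koopman h o\<^sub>L spread n) - spread n)) + ((koopman g o\<^sub>L spread n) - spread n)) \<longlonglongrightarrow> (koopman g o\<^sub>L 0) + 0"
    by (intro tendsto_add bounded_bilinear.tendsto[OF bounded_bilinear_blinfun_compose] tendsto_const add)
  ultimately show ?case by (simp only: blinfun_compose_zero add_0_right)
next
  have *: "(\<lambda>n. (koopman g o\<^sub>L spread n) - spread n) \<longlonglongrightarrow> 0"
    if "\<And>n f. norm (koopman g (spread (Suc n) f) - spread (Suc n) f) \<le> 2 * (1 / sqrt 2) ^ n * norm f" for g
  proof (subst filterlim_sequentially_Suc[symmetric], rule Lim_null_comparison)
    show "\<forall>\<^sub>F n in sequentially. norm ((koopman g o\<^sub>L spread (Suc n)) - spread (Suc n)) \<le> 2 * (1 / sqrt 2) ^ n"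
      using that by (intro always_eventually allI norm_blinfun_bound) (simp_all add: blinfun.diff_left del: spread.simps)
    have "(\<lambda>n. (1 / sqrt 2) ^ n) \<longlonglongrightarrow> 0" by (rule LIMSEQ_power_zero) simp
    then show "(\<lambda>n. 2 * (1 / sqrt 2) ^ n) \<longlonglongrightarrow> 0" by (rule tendsto_mult_right_zero)
  qed
  {
    case gen_b
    then show ?case using norm_gen_spread by (intro *) blast
  next
    case gen_c
    then show ?case using norm_gen_spread by (intro *) blast
  next
    case gen_d
    then show ?case using norm_gen_spread by (intro *) blast
  }
qed

section \<open>Matrix coefficients\<close>

primrec coword :: "bool list \<Rightarrow> l2 \<Rightarrow>\<^sub>L l2" where
  "coword [] = id_blinfun"
| "coword (i # v) = coword v o\<^sub>L cobranch i"

lemma cinner_word_isometry: "cinner (word_isometry v f) g = cinner f (coword v g)"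
  by (induction v arbitrary: g) (simp_all add: cinner_branch)

lemma coword_word_isometry:
  "length v = length w \<Longrightarrow> coword v (word_isometry w f) = (if v = w then f else 0)"
proof (induction v w rule: list_induct2)
  case (Cons i v j w)
  then show ?case by (cases "i = j"; cases "v = w") (simp_all add: cobranch_branch blinfun.zero_right)
qed simp

lemma sum_word_isometry_coword: "(\<Sum>v\<in>words n. word_isometry v (coword v f)) = f"
proof (induction n arbitrary: f)
  case (Suc n)
  have "(\<Sum>v\<in>words (Suc n). word_isometry v (coword v f)) = branch False (cobranch False f) + branch True (cobranch True f)"
    by (simp add: sum_words_Suc blinfun.sum_right[symmetric] Suc)
  then show ?case by (simp only: branch_cobranch)
qed simp

lemma clinear_op_coword: "clinear_op (coword v)"
  unfolding clinear_op_def
proof (intro allI cinner_eqI)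
  fix c f z
  have "cinner z (coword v (c *\<^sub>C f)) = cinner z (c *\<^sub>C coword v f)"
    by (simp add: cinner_word_isometry[symmetric] cinner_scaleC_right)
  then show "cinner (coword v (c *\<^sub>C f)) z = cinner (c *\<^sub>C coword v f) z" by (metis cinner_commute)
qed

lemma norm_word_isometry: "norm (word_isometry v f) = norm f"
  by (induction v) (simp_all add: norm_branch)

lemma norm_coword: "norm (coword v f) \<le> norm f"
proof -
  have "(norm (coword v f))\<^sup>2 = cmod (cinner (coword v f) (coword v f))" by (simp add: cinner_self norm_power)
  also have "\<dots> = cmod (cinner (word_isometry v (coword v f)) f)" by (simp add: cinner_word_isometry)
  also have "\<dots> \<le> norm (word_isometry v (coword v f)) * norm f" by (rule cinner_cauchy_schwarz)
  finally have "norm (coword v f) * norm (coword v f) \<le> norm (coword v f) * norm f"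
    by (simp add: norm_word_isometry power2_eq_square)
  then show ?thesis by (cases "norm (coword v f) = 0") (auto dest: mult_left_le_imp_le)
qed

text \<open>For a group element g the entry is the operator of the section of g at w if g(w) = u,
  and zero otherwise, while the coefficient is 1 or 0 accordingly; the claim becomes
  \<open>spread_almost_invariant\<close>. Both terms are at most the norm of T in size for every n,
  so the property survives norm limits.\<close>

lemma coefficient_almost_scalar:
  assumes T: "T \<in> koopman_cstar" and len: "length u = length w"
  shows "(\<lambda>n. (coword u o\<^sub>L T o\<^sub>L word_isometry w o\<^sub>L spread n) - cinner (T (cyl w)) (cyl u) *\<^sub>C spread n) \<longlonglongrightarrow> 0"
proof -
  define D where "D T n = (coword u o\<^sub>L T o\<^sub>L word_isometry w o\<^sub>L spread n) - cinner (T (cyl w)) (cyl u) *\<^sub>C spread n" for T n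
  have D_add: "D (S + T) n = D S n + D T n" for S T n
    by (rule blinfun_eqI) (simp add: D_def blinfun.diff_left blinfun.add_left blinfun.add_right cinner_add_left scaleC_add_left)
  have D_scale: "D (c *\<^sub>C T) n = c *\<^sub>C D T n" for c T n
    by (rule blinfun_eqI) (simp add: D_def blinfun.diff_left clinear_opD[OF clinear_op_coword] cinner_scaleC_left scaleC_scaleC cvec.scale_right_diff_distrib)
  have D_diff: "D (S - T) n = D S n - D T n" for S T n
    using D_add[of "S - T" T n] by simp
  have D_norm: "norm (D T n) \<le> 2 * norm T" for T n
  proof (rule norm_blinfun_bound)
    fix f
    have 1: "norm (coword u (T (word_isometry w (spread n f)))) \<le> norm T * norm f"
      using order_trans[OF norm_coword norm_blinfun, of u T "word_isometry w (spread n f)"]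
      by (simp add: norm_word_isometry norm_spread)
    have "cmod (cinner (T (cyl w)) (cyl u)) \<le> norm T"
      using order_trans[OF cinner_cauchy_schwarz[of "T (cyl w)" "cyl u"]] norm_blinfun[of T "cyl w"] by (simp add: norm_cyl)
    then have "norm (cinner (T (cyl w)) (cyl u) *\<^sub>C spread n f) \<le> norm T * norm f"
      by (simp add: norm_scaleC norm_spread mult_right_mono)
    with 1 show "norm (D T n f) \<le> 2 * norm T * norm f"
      using norm_triangle_ineq4[of "coword u (T (word_isometry w (spread n f)))" "cinner (T (cyl w)) (cyl u) *\<^sub>C spread n f"]
      by (simp add: D_def blinfun.diff_left)
  qed simp
  have "(\<lambda>n. D T n) \<longlonglongrightarrow> 0" using T
  proof (induction rule: cstar_induct)
    case (koopman g)
    have "D (koopman g) n = (if u = act g w then (koopman (section_at g w) o\<^sub>L spread n) - spread n else 0)" for n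
      by (rule blinfun_eqI)
        (simp add: D_def blinfun.diff_left koopman_word_isometry coword_word_isometry len koopman_cyl cinner_cyl scaleC_one)
    then show ?case using spread_almost_invariant[of "section_at g w"] by (cases "u = act g w") simp_all
  next
    case (add S T)
    then show ?case using tendsto_add[OF add] by (simp add: D_add)
  next
    case (scaleC c T)
    have "(\<lambda>n. c *\<^sub>C D T n) \<longlonglongrightarrow> c *\<^sub>C 0"
      using continuous_scaleC_blinfun[of UNIV c] scaleC by (rule continuous_on_tendsto_compose) auto
    then show ?case by (simp add: D_scale)
  next
    case closed
    show ?case unfolding closed_sequential_limits mem_Collect_eq
    proof (intro allI impI, elim conjE)
      fix X T assume X: "\<forall>k. (\<lambda>n. D (X k) n) \<longlonglongrightarrow> 0" and T: "X \<longlonglongrightarrow> T"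
      show "(\<lambda>n. D T n) \<longlonglongrightarrow> 0"
      proof (rule LIMSEQ_I)
        fix e :: real assume e: "0 < e"
        obtain k where k: "norm (X k - T) < e / 4" using LIMSEQ_D[OF T, of "e / 4"] e by auto
        obtain N where N: "\<And>n. n \<ge> N \<Longrightarrow> norm (D (X k) n) < e / 2"
          using LIMSEQ_D[OF X[rule_format, of k], of "e / 2"] e by auto
        have "norm (D T n - 0) < e" if "n \<ge> N" for n
          using N[OF that] D_norm[of "T - X k" n] k norm_triangle_ineq[of "D (T - X k) n" "D (X k) n"]
          by (simp add: D_diff norm_minus_commute)
        then show "\<exists>N. \<forall>n\<ge>N. norm (D T n - 0) < e" by blast
      qed
    qed
  qed
  then show ?thesis by (simp add: D_def)
qed

lemma cstar_nonzero_coefficient: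
  assumes "T \<in> koopman_cstar" "T \<noteq> 0"
  obtains u w where "length u = length w" "cinner (T (cyl w)) (cyl u) \<noteq> 0"
proof -
  obtain w where w: "T (cyl w) \<noteq> 0" using cstar_eq_zeroI assms by blast
  have "\<exists>u\<in>words (length w). cinner (T (cyl w)) (cyl u) \<noteq> 0"
  proof (rule ccontr)
    assume "\<not> ?thesis"
    then have "T (cyl w) = 0" by (subst cstar_cyl_expansion[OF assms(1)]) simp
    with w show False by simp
  qed
  with that show ?thesis by auto
qed

text \<open>With V^n equal to 2^(-n/2) times the sum of the S_x, this is the bound of the squared
  norm of a sum of 2^n vectors by 2^n times the sum of their squared norms, applied one letter at a
  time.\<close>

lemma norm_spread_sum:
  "(norm (T (word_isometry w (spread n f))))\<^sup>2 \<le> (\<Sum>x\<in>words n. (norm (T (word_isometry (w @ x) f)))\<^sup>2)"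
  for T :: "l2 \<Rightarrow>\<^sub>L l2"
proof (induction n arbitrary: w)
  case (Suc n)
  let ?p = "T (word_isometry (w @ [False]) (spread n f))"
  let ?q = "T (word_isometry (w @ [True]) (spread n f))"
  have "T (word_isometry w (spread (Suc n) f)) = (1 / sqrt 2) *\<^sub>R (?p + ?q)"
    by (simp add: avg_apply word_isometry_append blinfun.scaleR_right blinfun.add_right)
  then have "(norm (T (word_isometry w (spread (Suc n) f))))\<^sup>2 = (norm (?p + ?q))\<^sup>2 / 2"
    by (simp only: norm_scaleR power_mult_distrib) (simp add: power_divide)
  also have "(norm (?p + ?q))\<^sup>2 \<le> (norm ?p + norm ?q)\<^sup>2"
    by (intro power_mono norm_triangle_ineq) simp
  also have "\<dots> \<le> 2 * ((norm ?p)\<^sup>2 + (norm ?q)\<^sup>2)"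
    using sum_squares_bound[of "norm ?p" "norm ?q"] by (simp add: power2_sum)
  finally have "(norm (T (word_isometry w (spread (Suc n) f))))\<^sup>2 \<le> (norm ?p)\<^sup>2 + (norm ?q)\<^sup>2" by simp
  also have "\<dots> \<le> (\<Sum>x\<in>words (Suc n). (norm (T (word_isometry (w @ x) f)))\<^sup>2)"
    using Suc[of "w @ [False]"] Suc[of "w @ [True]"] by (simp add: sum_words_Suc)
  finally show ?case .
qed simp

lemma koopman_trace_faithful:
  assumes T: "T \<in> koopman_cstar" "T \<noteq> 0"
  shows "koopman_trace (cadjoint T o\<^sub>L T) \<noteq> 0"
proof -
  obtain u w where len: "length u = length w" and t0: "cinner (T (cyl w)) (cyl u) \<noteq> 0"
    by (rule cstar_nonzero_coefficient[OF T])
  define t where "t = cinner (T (cyl w)) (cyl u)"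
  \<comment> \<open>Half of the coefficient is sacrificed to the approximation error; the other half
    remains as a lower bound.\<close>
  define e where "e = cmod t / 2"
  have e: "e > 0" using t0 by (simp add: e_def t_def)
  obtain n where n: "norm ((coword u o\<^sub>L T o\<^sub>L word_isometry w o\<^sub>L spread n) - t *\<^sub>C spread n) < e"
    using LIMSEQ_D[OF coefficient_almost_scalar[OF T(1) len] e] by (auto simp: t_def)
  have lower: "e \<le> norm (T (word_isometry w (spread n (cyl v))))" for v
  proof -
    let ?x = "coword u (T (word_isometry w (spread n (cyl v))))"
    have "norm (?x - t *\<^sub>C spread n (cyl v)) \<le> e"
      using norm_blinfun[of "(coword u o\<^sub>L T o\<^sub>L word_isometry w o\<^sub>L spread n) - t *\<^sub>C spread n" "cyl v"] n
      by (simp add: blinfun.diff_left norm_cyl)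
    moreover have "norm (t *\<^sub>C spread n (cyl v)) = 2 * e" by (simp add: norm_scaleC norm_spread norm_cyl e_def)
    ultimately have "e \<le> norm ?x"
      using norm_triangle_ineq2[of "t *\<^sub>C spread n (cyl v)" ?x] by (simp add: norm_minus_commute)
    then show ?thesis using norm_coword[of u "T (word_isometry w (spread n (cyl v)))"] by linarith
  qed
  \<comment> \<open>The words w, x, v concatenated, with x of length n and v of length N, have
    length N + m. Each v contributes at least the square of e, so the normalised sum is at least
    this square divided by 2^m, whatever N is.\<close>
  define m where "m = length w + n"
  have sum: "e\<^sup>2 * 2 ^ N \<le> (\<Sum>y\<in>words (N + m). (norm (T (cyl y)))\<^sup>2)" for N
  proof -
    have "e\<^sup>2 * 2 ^ N = (\<Sum>v\<in>words N. e\<^sup>2)" by (simp add: card_words)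
    also have "\<dots> \<le> (\<Sum>v\<in>words N. \<Sum>x\<in>words n. (norm (T (word_isometry (w @ x) (cyl v))))\<^sup>2)"
    proof (rule sum_mono)
      fix v
      have "e\<^sup>2 \<le> (norm (T (word_isometry w (spread n (cyl v)))))\<^sup>2"
        using lower[of v] e by (intro power_mono) auto
      also note norm_spread_sum
      finally show "e\<^sup>2 \<le> (\<Sum>x\<in>words n. (norm (T (word_isometry (w @ x) (cyl v))))\<^sup>2)" .
    qed
    also have "\<dots> = (\<Sum>(v, x)\<in>words N \<times> words n. (norm (T (cyl (w @ x @ v))))\<^sup>2)"
      by (simp add: sum.cartesian_product cyl_append[symmetric])
    also have "\<dots> = (\<Sum>y\<in>(\<lambda>(v, x). w @ x @ v) ` (words N \<times> words n). (norm (T (cyl y)))\<^sup>2)"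
      by (subst sum.reindex) (auto simp: inj_on_def case_prod_unfold)
    also have "\<dots> \<le> (\<Sum>y\<in>words (N + m). (norm (T (cyl y)))\<^sup>2)"
      by (intro sum_mono2) (auto simp: m_def)
    finally show ?thesis .
  qed
  have "e\<^sup>2 / 2 ^ m \<le> Re (level_trace (N + m) (cadjoint T o\<^sub>L T))" for N
    using divide_right_mono[OF sum[of N], of "2 ^ (N + m)"] by (simp add: level_trace_square[OF T(1)] power_add)
  moreover have "(\<lambda>N. Re (level_trace (N + m) (cadjoint T o\<^sub>L T))) \<longlonglongrightarrow> Re (koopman_trace (cadjoint T o\<^sub>L T))"
    by (intro tendsto_Re LIMSEQ_ignore_initial_segment koopman_trace_limit cstar_compose cstar_cadjoint T)
  ultimately have "e\<^sup>2 / 2 ^ m \<le> Re (koopman_trace (cadjoint T o\<^sub>L T))"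
    by (intro LIMSEQ_le_const) auto
  moreover have "e\<^sup>2 / 2 ^ m > 0" using e by simp
  ultimately show ?thesis by auto
qed

lemma faithful_koopman_trace: "faithful_trace koopman_cstar koopman_trace"
  unfolding faithful_trace_def
proof (intro conjI ballI allI impI)
  note lim = koopman_trace_limit
  fix x assume x: "x \<in> koopman_cstar"
  show "koopman_trace (c *\<^sub>C x) = c * koopman_trace x" for c
    by (rule koopman_trace_eqI) (simp add: level_trace_scaleC tendsto_mult_left lim x)
  have sq: "(\<lambda>n. level_trace n (cadjoint x o\<^sub>L x)) \<longlonglongrightarrow> koopman_trace (cadjoint x o\<^sub>L x)"
    by (intro lim cstar_compose cstar_cadjoint x)
  have "(\<lambda>n. 0) \<longlonglongrightarrow> Im (koopman_trace (cadjoint x o\<^sub>L x))"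
    using tendsto_Im[OF sq] by (simp add: level_trace_square[OF x])
  then show "Im (koopman_trace (cadjoint x o\<^sub>L x)) = 0" by (simp add: LIMSEQ_const_iff)
  show "0 \<le> Re (koopman_trace (cadjoint x o\<^sub>L x))"
    by (rule LIMSEQ_le_const[OF tendsto_Re[OF sq]])
      (auto simp: level_trace_square[OF x] intro!: divide_nonneg_nonneg sum_nonneg)
  show "x = 0" if "koopman_trace (cadjoint x o\<^sub>L x) = 0"
    using koopman_trace_faithful[OF x] that by blast
  fix y assume y: "y \<in> koopman_cstar"
  show "koopman_trace (x + y) = koopman_trace x + koopman_trace y"
    by (rule koopman_trace_eqI) (simp add: level_trace_add tendsto_add lim x y)
  show "koopman_trace (x o\<^sub>L y) = koopman_trace (y o\<^sub>L x)"
    by (simp add: koopman_trace_def level_trace_commute[OF x y])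
next
  have "level_trace n id_blinfun = 1" for n
    by (simp add: level_trace_def cinner_cyl card_words)
  then show "koopman_trace id_blinfun = 1" by (intro koopman_trace_eqI) simp
qed

section \<open>Relations in the group and an element of the kernel\<close>

section \<open>Relations in the group\<close>

lemma gen_b_c: "gen_b (gen_c w) = gen_d w \<and> gen_c (gen_d w) = gen_b w \<and> gen_d (gen_b w) = gen_c w"
proof (induction w)
  case (Cons i w)
  then show ?case by (cases i) (simp_all add: gen_involution)
qed simp

lemma grigorchuk_relations:
  "gen\<^sub>a + gen\<^sub>a = 0" "gen\<^sub>b + gen\<^sub>b = 0" "gen\<^sub>c + gen\<^sub>c = 0" "gen\<^sub>d + gen\<^sub>d = 0"
  "gen\<^sub>b + gen\<^sub>c = gen\<^sub>d" "gen\<^sub>c + gen\<^sub>d = gen\<^sub>b" "gen\<^sub>d + gen\<^sub>b = gen\<^sub>c"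
  by (rule act_eqI, simp add: act_add act_gen act_zero gen_involution gen_b_c)+

lemma grigorchuk_cancel:
  "gen\<^sub>a + (gen\<^sub>a + x) = x" "gen\<^sub>b + (gen\<^sub>b + x) = x" "gen\<^sub>c + (gen\<^sub>c + x) = x" "gen\<^sub>d + (gen\<^sub>d + x) = x"
  by (simp_all add: grigorchuk_relations flip: add.assoc)

lemma grigorchuk_b_d: "gen\<^sub>b + gen\<^sub>d = gen\<^sub>c" "gen\<^sub>d + gen\<^sub>c = gen\<^sub>b" "gen\<^sub>c + gen\<^sub>b = gen\<^sub>d"
  by (metis grigorchuk_relations grigorchuk_cancel)+

text \<open>The elements d and ada act nontrivially only below 1 and only below 0 respectively,
  hence they commute; this is the relation (ad)^4 = 1.\<close>

lemma dihedral_relation: "gen\<^sub>d + (gen\<^sub>a + (gen\<^sub>d + gen\<^sub>a)) = gen\<^sub>a + (gen\<^sub>d + (gen\<^sub>a + gen\<^sub>d))"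
proof (rule act_eqI)
  fix w
  show "act (gen\<^sub>d + (gen\<^sub>a + (gen\<^sub>d + gen\<^sub>a))) w = act (gen\<^sub>a + (gen\<^sub>d + (gen\<^sub>a + gen\<^sub>d))) w"
    by (cases w rule: gen_a.cases) (simp_all add: act_add act_gen)
qed

lemma dihedral_relation': "gen\<^sub>d + (gen\<^sub>a + (gen\<^sub>d + (gen\<^sub>a + gen\<^sub>d))) = gen\<^sub>a + (gen\<^sub>d + gen\<^sub>a)"
  using dihedral_relation by (metis grigorchuk_cancel(4) add.assoc)

lemma koopman_inject_ne:
  assumes "act g v \<noteq> act h v" shows "koopman g \<noteq> koopman h"
proof
  assume "koopman g = koopman h"
  then have "cyl (act g v) = cyl (act h v)" by (simp flip: koopman_cyl)
  then show False using cinner_cyl[of "act g v" "act h v"] cinner_cyl[of "act g v" "act g v"] assms by simp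
qed

section \<open>Non-injectivity\<close>

lemma extend_rep_one: "extend_rep koopman 1 = id_blinfun"
  using extend_rep_single[of koopman 0 1] by (simp add: koopman_zero scaleC_one)

text \<open>
  The elements \<open>d\<close> and \<open>ada\<close> are supported on the two different halves of the boundary, so that
  \<open>(1 - d)(1 - ada)\<close> is in the kernel.
\<close>

lemma extend_rep_not_inj: "\<not> inj (extend_rep koopman)"
proof
  let ?h = "gen\<^sub>a + (gen\<^sub>d + gen\<^sub>a)"
  define x :: group_algebra where
    "x = Poly_Mapping.single 0 1 + Poly_Mapping.single gen\<^sub>d (- 1) + Poly_Mapping.single ?h (- 1) + Poly_Mapping.single (gen\<^sub>d + ?h) 1"
  assume inj: "inj (extend_rep koopman)"
  have "act gen\<^sub>d [True, False, False] \<noteq> act 0 [True, False, False]" by (simp add: act_gen act_zero)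
  then have d: "gen\<^sub>d \<noteq> 0" by metis
  have "act ?h [False, False, False] \<noteq> act 0 [False, False, False]" by (simp add: act_add act_gen act_zero)
  then have h: "?h \<noteq> 0" by metis
  \<comment> \<open>The coefficient of the identity is 1 or 2, according to whether the last product
    is trivial; it is nonzero in both cases.\<close>
  have "Poly_Mapping.lookup x 0 = 1 + (1 when gen\<^sub>d + ?h = 0)"
    using d h by (simp add: x_def lookup_add lookup_single)
  then have "x \<noteq> 0" by (auto simp: when_def split: if_splits)
  moreover have "extend_rep koopman x = 0"
  proof (rule blinfun_eqI)
    fix f
    have "extend_rep koopman x (branch i f) = 0" for i f
      by (cases i)
        (simp_all add: x_def extend_rep_add extend_rep_single extend_rep_one blinfun.add_left blinfun.diff_left koopman_add koopman_zero scaleC_one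
          koopman_gen_branch scaleC_minus_one)
    then have "extend_rep koopman x (branch False (cobranch False f) + branch True (cobranch True f)) = 0"
      by (simp only: blinfun.add_right add_0_right)
    then show "extend_rep koopman x f = blinfun_apply 0 f" by (simp add: branch_cobranch)
  qed
  ultimately show False using inj extend_rep_zero by (metis injD)
qed

section \<open>The commutator ideal and infinite dimension\<close>

section \<open>The ideal generated by a commutator\<close>

definition comm_ab :: "l2 \<Rightarrow>\<^sub>L l2" where
  "comm_ab = koopman (gen\<^sub>a + gen\<^sub>b) - koopman (gen\<^sub>b + gen\<^sub>a)"

definition comm_ideal :: "(l2 \<Rightarrow>\<^sub>L l2) set" where
  "comm_ideal = cvec.span {koopman g o\<^sub>L comm_ab o\<^sub>L koopman h | g h. True}"

lemma span_linear_image: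
  fixes L :: "'a::complex_vector \<Rightarrow> 'b::complex_vector"
  assumes x: "x \<in> cvec.span X" and base: "\<And>x. x \<in> X \<Longrightarrow> L x \<in> cvec.span Y"
    and lin: "\<And>x y. L (x + y) = L x + L y" "\<And>c x. L (c *\<^sub>C x) = c *\<^sub>C L x"
  shows "L x \<in> cvec.span Y"
  using x
proof (induction rule: cvec.span_induct_alt)
  case base
  have "L 0 = 0" using lin(2)[of 0 0] by simp
  then show ?case by (simp add: cvec.span_zero)
next
  case (step c x y)
  then show ?case by (simp add: lin base cvec.span_add cvec.span_scale)
qed

lemma subspace_comm_ideal: "cvec.subspace comm_ideal"
  by (simp add: comm_ideal_def)

lemma comp_assoc: "(S o\<^sub>L T) o\<^sub>L U = S o\<^sub>L (T o\<^sub>L U)"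
  by (rule blinfun_eqI) simp

lemma comp_id [simp]: "id_blinfun o\<^sub>L T = T" "T o\<^sub>L id_blinfun = T"
  by (rule blinfun_eqI, simp)+

lemma comm_ab_in_algebra: "comm_ab \<in> koopman_algebra"
  unfolding comm_ab_def by (intro cvec.subspace_diff[OF subspace_algebra] koopman_in_algebra)

lemma comm_ideal_subset: "comm_ideal \<subseteq> koopman_algebra"
  unfolding comm_ideal_def
  by (rule cvec.span_minimal) (auto intro!: subspace_algebra algebra_compose koopman_in_algebra comm_ab_in_algebra)

lemma algebra_clinear: "T \<in> koopman_algebra \<Longrightarrow> clinear_op T"
  using cstar_clinear algebra_subset_cstar by blast

lemma comm_ideal_koopman:
  assumes "z \<in> comm_ideal" shows "koopman g o\<^sub>L z o\<^sub>L koopman h \<in> comm_ideal"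
  using assms unfolding comm_ideal_def
proof (rule span_linear_image)
  fix z assume "z \<in> {koopman g o\<^sub>L comm_ab o\<^sub>L koopman h | g h. True}"
  then obtain g' h' where "z = koopman g' o\<^sub>L comm_ab o\<^sub>L koopman h'" by blast
  then have "koopman g o\<^sub>L z o\<^sub>L koopman h = koopman (g + g') o\<^sub>L comm_ab o\<^sub>L koopman (h' + h)"
    by (simp add: koopman_add comp_assoc)
  then show "koopman g o\<^sub>L z o\<^sub>L koopman h \<in> cvec.span {koopman g o\<^sub>L comm_ab o\<^sub>L koopman h | g h. True}"
    by (intro cvec.span_base) blast
qed (simp_all add: compose_add_left compose_add_right scaleC_compose compose_scaleC clinear_op_koopman)

lemma comm_ideal_left: assumes "z \<in> comm_ideal" "T \<in> koopman_algebra" shows "T o\<^sub>L z \<in> comm_ideal"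
  using assms(2)
proof (induction rule: algebra_induct)
  case (koopman g)
  then show ?case using comm_ideal_koopman[OF assms(1), of g 0] by (simp add: koopman_zero)
qed (simp_all add: compose_add_left scaleC_compose cvec.subspace_add[OF subspace_comm_ideal] cvec.subspace_scale[OF subspace_comm_ideal])

lemma comm_ideal_right: assumes "z \<in> comm_ideal" "T \<in> koopman_algebra" shows "z o\<^sub>L T \<in> comm_ideal"
  using assms(2)
proof (induction rule: algebra_induct)
  case (koopman g)
  then show ?case using comm_ideal_koopman[OF assms(1), of 0 g] by (simp add: koopman_zero)
qed (use assms(1) comm_ideal_subset algebra_clinear in \<open>auto simp: compose_add_right compose_scaleC cvec.subspace_add[OF subspace_comm_ideal] cvec.subspace_scale[OF subspace_comm_ideal]\<close>)

lemma comm_ab_in_ideal: "comm_ab \<in> comm_ideal"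
proof -
  have "koopman 0 o\<^sub>L comm_ab o\<^sub>L koopman 0 \<in> comm_ideal"
    unfolding comm_ideal_def by (rule cvec.span_base) blast
  then show ?thesis by (simp add: koopman_zero)
qed

lemma compose_diff_left: "(S - S') o\<^sub>L T = (S o\<^sub>L T) - (S' o\<^sub>L T)"
  and compose_diff_right: "T o\<^sub>L (S - S') = (T o\<^sub>L S) - (T o\<^sub>L S')"
  by (rule bounded_bilinear.diff_left[OF bounded_bilinear_blinfun_compose]
      bounded_bilinear.diff_right[OF bounded_bilinear_blinfun_compose])+

abbreviation gen_abab :: grigorchuk where "gen_abab \<equiv> gen\<^sub>a + (gen\<^sub>b + (gen\<^sub>a + gen\<^sub>b))"
abbreviation gen_baba :: grigorchuk where "gen_baba \<equiv> gen\<^sub>b + (gen\<^sub>a + (gen\<^sub>b + gen\<^sub>a))"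

text \<open>Together with \<open>comm_ab_factor\<close> this shows that ab - ba and (ab)^2 - 1
  generate the same ideal. The second generator is of the form k - 1 with k in the group, so that
  group commutators can be used.\<close>

lemma abab_factor: "koopman gen_abab - id_blinfun = comm_ab o\<^sub>L koopman (gen\<^sub>a + gen\<^sub>b)"
  by (simp add: comm_ab_def compose_diff_left add.assoc grigorchuk_cancel grigorchuk_relations
      koopman_zero flip: koopman_add)

lemma comm_ab_factor: "comm_ab = (koopman gen_abab - id_blinfun) o\<^sub>L koopman (gen\<^sub>b + gen\<^sub>a)"
  by (simp add: comm_ab_def compose_diff_left add.assoc grigorchuk_cancel grigorchuk_relations
      flip: koopman_add)

lemma abab_in_ideal: "koopman gen_abab - id_blinfun \<in> comm_ideal"
  unfolding abab_factor by (intro comm_ideal_right comm_ab_in_ideal koopman_in_algebra)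

lemma baba_in_ideal: "koopman gen_baba - id_blinfun \<in> comm_ideal"
proof -
  have "koopman gen_baba - id_blinfun = (- 1) *\<^sub>C ((koopman gen_abab - id_blinfun) o\<^sub>L koopman gen_baba)"
    by (simp add: compose_diff_left add.assoc grigorchuk_cancel grigorchuk_relations koopman_zero
        scaleC_minus_one flip: koopman_add)
  then show ?thesis
    by (simp only: cvec.subspace_scale[OF subspace_comm_ideal] comm_ideal_right abab_in_ideal koopman_in_algebra)
qed

text \<open>
  Writing \<open>k = (ab)\<^sup>2\<close>, the element \<open>k d k\<^sup>-\<^sup>1 d\<close> acts trivially below the vertex \<open>0\<close> and as
  \<open>k\<close> below the vertex \<open>1\<close>.
\<close>

lemma branch_abab_in_ideal: "branch True o\<^sub>L (koopman gen_abab - id_blinfun) o\<^sub>L cobranch True \<in> comm_ideal"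
proof -
  let ?h = "gen_abab + (gen\<^sub>d + (gen_baba + gen\<^sub>d))"
  \<comment> \<open>In terms of k = (ab)^2, the two summands are (k - 1) d k^-1 d and d (k^-1 - 1)
    d; since d is an involution they add up to k d k^-1 d - 1.\<close>
  have "(koopman gen_abab - id_blinfun) o\<^sub>L koopman (gen\<^sub>d + (gen_baba + gen\<^sub>d)) \<in> comm_ideal"
    by (intro comm_ideal_right abab_in_ideal koopman_in_algebra)
  moreover have "koopman gen\<^sub>d o\<^sub>L (koopman gen_baba - id_blinfun) o\<^sub>L koopman gen\<^sub>d \<in> comm_ideal"
    by (intro comm_ideal_koopman baba_in_ideal)
  ultimately have "((koopman gen_abab - id_blinfun) o\<^sub>L koopman (gen\<^sub>d + (gen_baba + gen\<^sub>d))) +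
      (koopman gen\<^sub>d o\<^sub>L (koopman gen_baba - id_blinfun) o\<^sub>L koopman gen\<^sub>d) \<in> comm_ideal"
    by (rule cvec.subspace_add[OF subspace_comm_ideal])
  also have "((koopman gen_abab - id_blinfun) o\<^sub>L koopman (gen\<^sub>d + (gen_baba + gen\<^sub>d))) +
      (koopman gen\<^sub>d o\<^sub>L (koopman gen_baba - id_blinfun) o\<^sub>L koopman gen\<^sub>d) = koopman ?h - id_blinfun"
    by (simp add: compose_diff_left compose_diff_right add.assoc grigorchuk_relations koopman_zero flip: koopman_add)
  also have "koopman ?h - id_blinfun = branch True o\<^sub>L (koopman gen_abab - id_blinfun) o\<^sub>L cobranch True"
  proof (rule blinfun_eqI)
    fix f
    have inv: "koopman g (koopman g k) = k" if "g \<in> {gen\<^sub>a, gen\<^sub>b, gen\<^sub>c, gen\<^sub>d}" for g k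
    proof -
      have "koopman (g + g) k = k" using that by (auto simp: grigorchuk_relations koopman_zero)
      then show ?thesis by (simp add: koopman_add)
    qed
    \<comment> \<open>The sections of k at 0 and 1 are ca and ac. Below 0 everything cancels; below
      1 the product is ac b ca b, which this relation turns into (ab)^2.\<close>
    have cbc: "koopman gen\<^sub>c (koopman gen\<^sub>b (koopman gen\<^sub>c k)) = koopman gen\<^sub>b k" for k
    proof -
      have "koopman (gen\<^sub>c + (gen\<^sub>b + gen\<^sub>c)) k = koopman gen\<^sub>b k" by (simp add: grigorchuk_relations)
      then show ?thesis by (simp add: koopman_add)
    qed
    have "koopman ?h (branch False u) = branch False u" for u
      by (simp add: koopman_add koopman_gen_branch inv)
    moreover have "koopman ?h (branch True u) = branch True (koopman gen_abab u)" for u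
      by (simp add: koopman_add koopman_gen_branch inv cbc)
    ultimately have "(koopman ?h - id_blinfun) (branch False (cobranch False f) + branch True (cobranch True f)) =
      branch True ((koopman gen_abab - id_blinfun) (cobranch True f))"
      by (simp add: blinfun.diff_left blinfun.diff_right blinfun.add_right)
    then show "(koopman ?h - id_blinfun) f = (branch True o\<^sub>L (koopman gen_abab - id_blinfun) o\<^sub>L cobranch True) f"
      by (simp only: branch_cobranch blinfun_apply_blinfun_compose)
  qed
  finally show ?thesis .
qed

text \<open>The group is self-replicating: b, c, d have the sections c, d, b at the vertex 1, and
  aba has the section a there. Multiplication inside a corner can thus be carried out by group
  elements outside it.\<close>

lemma section_at_True_surj: "\<exists>g'. act g' [True] = [True] \<and> section_at g' [True] = g"
proof (induction g rule: grigorchuk_induct)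
  case zero
  show ?case by (rule exI[of _ 0]) (simp add: act_zero)
next
  case gen_a
  show ?case
    by (rule exI[of _ "gen\<^sub>a + (gen\<^sub>b + gen\<^sub>a)"]) (simp add: act_add act_gen section_at_add section_at_gen section_at_gen_a)
next
  case gen_b
  show ?case by (rule exI[of _ "gen\<^sub>d"]) (simp add: act_gen section_at_gen)
next
  case gen_c
  show ?case by (rule exI[of _ "gen\<^sub>b"]) (simp add: act_gen section_at_gen)
next
  case gen_d
  show ?case by (rule exI[of _ "gen\<^sub>c"]) (simp add: act_gen section_at_gen)
next
  case (add g h)
  then obtain g' h' where "act g' [True] = [True]" "section_at g' [True] = g" "act h' [True] = [True]" "section_at h' [True] = h" by blast
  then show ?case by (intro exI[of _ "g' + h'"]) (simp add: act_add section_at_add)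
qed

lemma koopman_diagonal:
  assumes "act g' [True] = [True]" "section_at g' [True] = g"
  shows "koopman g' (branch True f) = branch True (koopman g f)"
    "cobranch True (koopman g' f) = koopman g (cobranch True f)"
proof -
  show *: "koopman g' (branch True f) = branch True (koopman g f)" for f
    by (simp add: koopman_branch assms)
  have "act g' [False] \<noteq> [True]" using assms(1) by (metis act_inj list.inject)
  then have "hd (act g' [False]) = False" using act_letter[of g' False] by (cases "hd (act g' [False])") auto
  then have "cobranch True (koopman g' (branch False u)) = 0" for u
    by (simp add: koopman_branch cobranch_branch)
  then have "cobranch True (koopman g' (branch False (cobranch False f) + branch True (cobranch True f))) = koopman g (cobranch True f)"
    by (simp add: blinfun.add_right * cobranch_branch)
  then show "cobranch True (koopman g' f) = koopman g (cobranch True f)" by (simp only: branch_cobranch)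
qed

lemma compress_koopman:
  "\<exists>g' h'. branch True o\<^sub>L (koopman g o\<^sub>L z o\<^sub>L koopman h) o\<^sub>L cobranch True =
    koopman g' o\<^sub>L (branch True o\<^sub>L z o\<^sub>L cobranch True) o\<^sub>L koopman h'"
proof -
  obtain g' h' where "act g' [True] = [True]" "section_at g' [True] = g" "act h' [True] = [True]" "section_at h' [True] = h"
    using section_at_True_surj by metis
  then show ?thesis
    by (intro exI[of _ g'] exI[of _ h'] blinfun_eqI) (simp add: koopman_diagonal)
qed

lemma branch_comm_ideal_True: assumes "z \<in> comm_ideal" shows "branch True o\<^sub>L z o\<^sub>L cobranch True \<in> comm_ideal"
proof -
  have ab: "branch True o\<^sub>L comm_ab o\<^sub>L cobranch True \<in> comm_ideal"
  proof -
    obtain g' h' where "branch True o\<^sub>L (koopman 0 o\<^sub>L (koopman gen_abab - id_blinfun) o\<^sub>L koopman (gen\<^sub>b + gen\<^sub>a)) o\<^sub>L cobranch True =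
      koopman g' o\<^sub>L (branch True o\<^sub>L (koopman gen_abab - id_blinfun) o\<^sub>L cobranch True) o\<^sub>L koopman h'"
      using compress_koopman by blast
    then have "branch True o\<^sub>L comm_ab o\<^sub>L cobranch True =
      koopman g' o\<^sub>L (branch True o\<^sub>L (koopman gen_abab - id_blinfun) o\<^sub>L cobranch True) o\<^sub>L koopman h'"
      by (subst comm_ab_factor) (simp add: koopman_zero)
    then show ?thesis by (simp only: comm_ideal_koopman branch_abab_in_ideal)
  qed
  show ?thesis
    unfolding comm_ideal_def
  proof (rule span_linear_image[OF assms[unfolded comm_ideal_def]])
    fix z assume "z \<in> {koopman g o\<^sub>L comm_ab o\<^sub>L koopman h | g h. True}"
    then obtain g h where "z = koopman g o\<^sub>L comm_ab o\<^sub>L koopman h" by blast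
    then obtain g' h' where "branch True o\<^sub>L z o\<^sub>L cobranch True = koopman g' o\<^sub>L (branch True o\<^sub>L comm_ab o\<^sub>L cobranch True) o\<^sub>L koopman h'"
      using compress_koopman by metis
    then have "branch True o\<^sub>L z o\<^sub>L cobranch True \<in> comm_ideal" by (simp only: comm_ideal_koopman ab)
    then show "branch True o\<^sub>L z o\<^sub>L cobranch True \<in> cvec.span {koopman g o\<^sub>L comm_ab o\<^sub>L koopman h | g h. True}"
      by (simp only: comm_ideal_def)
  qed (simp_all add: blinfun_eqI blinfun.add_left blinfun.add_right branch_scaleC)
qed

lemma branch_comm_ideal: assumes "z \<in> comm_ideal" shows "branch i o\<^sub>L z o\<^sub>L cobranch j \<in> comm_ideal"
proof -
  \<comment> \<open>The element \<open>s i\<close> moves the vertex 1 to i, so the corner at 1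
    yields all four corners.\<close>
  define s where "s i = (if i then 0 else gen\<^sub>a)" for i
  have "cobranch True (koopman (s j) (branch False (cobranch False f) + branch True (cobranch True f))) = cobranch j f" for f
    by (cases j) (simp_all add: s_def koopman_zero blinfun.add_right koopman_gen_branch cobranch_branch)
  then have "cobranch True (koopman (s j) f) = cobranch j f" for f by (simp only: branch_cobranch)
  then have "branch i o\<^sub>L z o\<^sub>L cobranch j = koopman (s i) o\<^sub>L (branch True o\<^sub>L z o\<^sub>L cobranch True) o\<^sub>L koopman (s j)"
    by (intro blinfun_eqI, cases i) (simp_all add: s_def koopman_zero koopman_gen_branch)
  then show ?thesis by (simp only: comm_ideal_koopman branch_comm_ideal_True assms)
qed

lemma word_comm_ideal:
  "length p = length q \<Longrightarrow> z \<in> comm_ideal \<Longrightarrow> word_isometry p o\<^sub>L z o\<^sub>L coword q \<in> comm_ideal"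
proof (induction p q rule: list_induct2)
  case (Cons i p j q)
  then have "branch i o\<^sub>L (word_isometry p o\<^sub>L z o\<^sub>L coword q) o\<^sub>L cobranch j \<in> comm_ideal"
    by (intro branch_comm_ideal)
  then show ?case by (simp add: comp_assoc)
qed simp

section \<open>Infinite dimension\<close>

lemma comm_ab_nonzero: "comm_ab \<noteq> 0"
proof -
  have "act (gen\<^sub>a + gen\<^sub>b) [False, False] \<noteq> act (gen\<^sub>b + gen\<^sub>a) [False, False]"
    by (simp add: act_add act_gen)
  from koopman_inject_ne[OF this] show ?thesis by (simp add: comm_ab_def)
qed

text \<open>The operators S_p (ab - ba) S_p^* for words p of length n lie in B and act on orthogonal
  ranges, so they are 2^n independent elements. A spanning set of n elements contradicts 2^n >
  n.\<close>

lemma algebra_infinite_dim: "\<not> cfinite_dim koopman_algebra"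
proof
  assume "cfinite_dim koopman_algebra"
  then obtain F where F: "finite F" "koopman_algebra \<subseteq> cvec.span F" by (auto simp: cfinite_dim_def)
  obtain f where f: "comm_ab f \<noteq> 0" using comm_ab_nonzero by (metis blinfun_eqI blinfun.zero_left)
  define n where "n = card F"
  define X where "X p = word_isometry p o\<^sub>L comm_ab o\<^sub>L coword p" for p
  have X: "coword q (X p (word_isometry q f)) = (if p = q then comm_ab f else 0)" if "p \<in> words n" "q \<in> words n" for p q
    using that by (simp add: X_def coword_word_isometry blinfun.zero_right)
  have inj: "inj_on X (words n)"
    by (rule inj_onI) (metis X f)
  have "cvec.independent (X ` words n)"
  proof (rule cvec.independent_if_scalars_zero)
    fix u y assume sum: "(\<Sum>x\<in>X ` words n. u x *\<^sub>C x) = 0" and "y \<in> X ` words n"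
    then obtain q where q: "q \<in> words n" "y = X q" by blast
    have "0 = coword q ((\<Sum>p\<in>words n. u (X p) *\<^sub>C X p) (word_isometry q f))"
      using sum by (simp add: sum.reindex[OF inj] blinfun.zero_right)
    also have "\<dots> = (\<Sum>p\<in>words n. u (X p) *\<^sub>C coword q (X p (word_isometry q f)))"
      by (simp add: blinfun.sum_left blinfun.sum_right clinear_opD[OF clinear_op_coword])
    also have "\<dots> = (\<Sum>p\<in>words n. if p = q then u (X q) *\<^sub>C comm_ab f else 0)"
      by (rule sum.cong) (use X q(1) in auto)
    also have "\<dots> = u (X q) *\<^sub>C comm_ab f" using q(1) by simp
    finally show "u y = 0" using f q by simp
  qed simp
  moreover have "X ` words n \<subseteq> cvec.span F"
    using word_comm_ideal[OF refl comm_ab_in_ideal] comm_ideal_subset F(2) by (auto simp: X_def)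
  ultimately have "card (X ` words n) \<le> card F" using cvec.independent_span_bound[OF F(1)] by blast
  moreover have "card (X ` words n) = 2 ^ n" by (simp only: card_image[OF inj] card_words)
  ultimately have "2 ^ n \<le> n" by (simp only: n_def)
  then show False using less_exp[of n] by simp
qed

text \<open>An exchange argument. Spanning sets modulo an ideal arise naturally outside B, for
  instance from operators S_r z S_s^*, whereas the quotient has to be spanned by classes of elements
  of B.\<close>

lemma finite_complement:
  fixes V :: "'a::complex_vector set"
  assumes "finite G" "cvec.subspace V" "V \<subseteq> cvec.span (G \<union> J)"
  shows "\<exists>F. finite F \<and> F \<subseteq> V \<and> V \<subseteq> cvec.span (F \<union> J)"
  using assms
proof (induction G arbitrary: V rule: finite_induct)
  case empty
  then show ?case by (intro exI[of _ "{}"]) auto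
next
  case (insert g G)
  let ?W = "cvec.span (G \<union> J)"
  obtain F where F: "finite F" "F \<subseteq> V \<inter> ?W" "V \<inter> ?W \<subseteq> cvec.span (F \<union> J)"
    using insert.IH[of "V \<inter> ?W"] insert.prems(1) by (auto intro: cvec.subspace_inter)
  show ?case
  proof (cases "V \<subseteq> ?W")
    case True
    then show ?thesis using F by (intro exI[of _ F]) auto
  next
    case False
    then obtain v where v: "v \<in> V" "v \<notin> ?W" by blast
    \<comment> \<open>A vector of V outside the smaller span has a nonzero coordinate along g, so it
      can take the place of g.\<close>
    have br: "\<exists>k. x - k *\<^sub>C g \<in> ?W" if "x \<in> V" for x
      using that insert.prems(2) cvec.span_breakdown_eq[of x g "G \<union> J"] by auto
    obtain k where k: "v - k *\<^sub>C g \<in> ?W" using br v(1) by blast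
    with v(2) have k0: "k \<noteq> 0" by auto
    have "x \<in> cvec.span (insert v F \<union> J)" if x: "x \<in> V" for x
    proof -
      obtain l where l: "x - l *\<^sub>C g \<in> ?W" using br x by blast
      have "x - (l / k) *\<^sub>C v = (x - l *\<^sub>C g) - (l / k) *\<^sub>C (v - k *\<^sub>C g)"
        using k0 by (simp add: cvec.scale_right_diff_distrib)
      then have "x - (l / k) *\<^sub>C v \<in> ?W" using k l by (simp only: cvec.span_diff cvec.span_scale)
      moreover have "x - (l / k) *\<^sub>C v \<in> V"
        by (intro cvec.subspace_diff cvec.subspace_scale insert.prems(1) x v(1))
      ultimately have "x - (l / k) *\<^sub>C v \<in> cvec.span (F \<union> J)" using F(3) by blast
      then show ?thesis using cvec.span_breakdown_eq[of x v "F \<union> J"] by auto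
    qed
    then show ?thesis using F v(1) by (intro exI[of _ "insert v F"]) auto
  qed
qed

section \<open>Failure of *-just-infiniteness\<close>

lemma lookup_star: "Poly_Mapping.lookup (group_algebra_star x) g = cnj (Poly_Mapping.lookup x (- g))"
  by transfer simp

lemma extend_rep_star: "cinner (extend_rep koopman x f) k = cinner f (extend_rep koopman (group_algebra_star x) k)"
proof (induction x rule: poly_mapping_induct)
  case zero
  have "group_algebra_star 0 = (0 :: group_algebra)" by (rule poly_mapping_eqI) (simp add: lookup_star)
  then show ?case by simp
next
  case (single g c)
  have "group_algebra_star (Poly_Mapping.single g c) = Poly_Mapping.single (- g) (cnj c)"
  proof (rule poly_mapping_eqI)
    fix k
    have "g = - k \<longleftrightarrow> - g = k" by auto
    then show "Poly_Mapping.lookup (group_algebra_star (Poly_Mapping.single g c)) k = Poly_Mapping.lookup (Poly_Mapping.single (- g) (cnj c)) k"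
      by (simp add: lookup_star lookup_single when_def)
  qed
  then show ?case by (simp add: extend_rep_single cinner_scaleC_left cinner_scaleC_right cinner_koopman)
next
  case (add x y)
  have "group_algebra_star (x + y) = group_algebra_star x + group_algebra_star y"
    by (rule poly_mapping_eqI) (simp add: lookup_star lookup_add)
  then show ?case using add by (simp add: extend_rep_add blinfun.add_left cinner_add_left cinner_add_right)
qed

lemma not_star_just_infinite: "\<not> star_just_infinite TYPE(l2)"
proof
  assume sji: "star_just_infinite TYPE(l2)"
  define \<phi> where "\<phi> x = blinfun_apply (extend_rep koopman x)" for x
  have "star_rep UNIV (*) 1 group_algebra_star (UNIV :: l2 set) \<phi>"
    unfolding star_rep_def
  proof (intro conjI ballI allI)
    show "hilbert_space_on (UNIV :: l2 set)" by (simp add: hilbert_space_on_def complete_UNIV)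
    fix x y :: group_algebra and c :: complex and f k :: l2
    have "extend_rep koopman x (c *\<^sub>C f) = c *\<^sub>C extend_rep koopman x f" for c f
      using algebra_clinear[of "extend_rep koopman x"] by (simp add: koopman_algebra_def clinear_opD)
    then show "bounded_operator_on UNIV (\<phi> x)"
      unfolding bounded_operator_on_def
      by (auto simp: \<phi>_def blinfun.add_right intro!: exI[of _ "norm (extend_rep koopman x)"] norm_blinfun)
    show "\<phi> (x + y) = \<phi> x + \<phi> y" by (auto simp: \<phi>_def extend_rep_add plus_fun_def blinfun.add_left)
    show "\<phi> (c *\<^sub>C x) = c *\<^sub>C \<phi> x" by (auto simp: \<phi>_def extend_rep_scaleC scaleC_fun_def)
    show "\<phi> (x * y) = \<phi> x \<circ> \<phi> y" by (auto simp: \<phi>_def extend_rep_mult)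
    show "cinner (\<phi> x f) k = cinner f (\<phi> (group_algebra_star x) k)" by (simp add: \<phi>_def extend_rep_star)
  next
    show "\<phi> 1 = (\<lambda>x. if x \<in> UNIV then x else 0)" by (auto simp: \<phi>_def extend_rep_one)
  qed
  then have "inj \<phi> \<or> cfinite_dim (range \<phi>)" using sji by (auto simp: star_just_infinite_def)
  moreover have "\<not> inj \<phi>"
    using extend_rep_not_inj by (auto simp: \<phi>_def inj_def blinfun_apply_inject)
  moreover have "\<not> cfinite_dim (range \<phi>)"
  proof
    assume "cfinite_dim (range \<phi>)"
    then obtain G where G: "finite G" "range \<phi> \<subseteq> cvec.span (G \<union> {})" by (auto simp: cfinite_dim_def)
    have range: "range \<phi> = blinfun_apply ` koopman_algebra" by (auto simp: \<phi>_def koopman_algebra_def)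
    have add: "blinfun_apply S + blinfun_apply T = blinfun_apply (S + T)" for S T :: "l2 \<Rightarrow>\<^sub>L l2"
      by (auto simp: plus_fun_def blinfun.add_left)
    have scale: "c *\<^sub>C blinfun_apply S = blinfun_apply (c *\<^sub>C S)" for c and S :: "l2 \<Rightarrow>\<^sub>L l2"
      by (auto simp: scaleC_fun_def)
    have zero: "(0 :: l2 \<Rightarrow> l2) = blinfun_apply 0" by (auto simp: zero_fun_def)
    have "cvec.subspace (range \<phi>)"
      unfolding range cvec.subspace_def using subspace_algebra
      by (auto simp: add scale zero cvec.subspace_def)
    \<comment> \<open>The given spanning set consists of arbitrary functions. Once moved into the
      range, it is the image of a finite set of bounded operators.\<close>
    then obtain F where F: "finite F" "F \<subseteq> range \<phi>" "range \<phi> \<subseteq> cvec.span F"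
      using finite_complement[OF G(1) _ G(2)] by auto
    then obtain E where E: "finite E" "F = blinfun_apply ` E"
      unfolding range by (metis finite_subset_image)
    have "h \<in> blinfun_apply ` cvec.span E" if "h \<in> cvec.span F" for h
      using that
    proof (induction rule: cvec.span_induct_alt)
      case base
      show ?case unfolding zero by (intro imageI cvec.span_zero)
    next
      case (step c x y)
      then obtain S T where "x = blinfun_apply S" "S \<in> E" "y = blinfun_apply T" "T \<in> cvec.span E" by (auto simp: E)
      then have "c *\<^sub>C x + y = blinfun_apply (c *\<^sub>C S + T)" by (simp only: add scale)
      moreover have "c *\<^sub>C S + T \<in> cvec.span E"
        using \<open>S \<in> E\<close> \<open>T \<in> cvec.span E\<close> by (intro cvec.span_add[OF cvec.span_scale[OF cvec.span_base]])
      ultimately show ?case by (metis imageI)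
    qed
    then have "koopman_algebra \<subseteq> cvec.span E"
      using F(3) unfolding range by (fastforce simp: blinfun_apply_inject)
    then show False using algebra_infinite_dim E(1) by (auto simp: cfinite_dim_def)
  qed
  ultimately show False by blast
qed

section \<open>Finite codimension, scalar entries and just-infiniteness\<close>

section \<open>Finite codimension\<close>

lemma left_mult_span:
  fixes T :: "l2 \<Rightarrow>\<^sub>L l2"
  assumes "clinear_op S" "T \<in> cvec.span X" "\<And>x. x \<in> X \<Longrightarrow> S o\<^sub>L x \<in> cvec.span Y"
  shows "S o\<^sub>L T \<in> cvec.span Y"
  by (rule span_linear_image[where L = "\<lambda>T. S o\<^sub>L T", OF assms(2,3)])
    (simp_all add: compose_add_right compose_scaleC assms(1))

text \<open>A span containing the identity and stable under left multiplication by generators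
  contains every group element. The generator c is omitted because c = bd.\<close>

lemma algebra_subset_span:
  assumes id: "id_blinfun \<in> cvec.span X"
    and gen: "\<And>s x. s \<in> {gen\<^sub>a, gen\<^sub>b, gen\<^sub>d} \<Longrightarrow> x \<in> X \<Longrightarrow> koopman s o\<^sub>L x \<in> cvec.span X"
  shows "koopman_algebra \<subseteq> cvec.span X"
proof -
  have gens: "koopman s o\<^sub>L T \<in> cvec.span X" if "s \<in> {gen\<^sub>a, gen\<^sub>b, gen\<^sub>d}" "T \<in> cvec.span X" for s T
    by (rule left_mult_span[OF clinear_op_koopman that(2) gen[OF that(1)]])
  have "\<forall>T\<in>cvec.span X. koopman g o\<^sub>L T \<in> cvec.span X" for g
  proof (induction g rule: grigorchuk_induct)
    case gen_c
    have "koopman gen\<^sub>c o\<^sub>L T = koopman gen\<^sub>b o\<^sub>L (koopman gen\<^sub>d o\<^sub>L T)" for T :: "l2 \<Rightarrow>\<^sub>L l2"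
      by (simp add: koopman_add flip: comp_assoc grigorchuk_b_d(1))
    then show ?case using gens by auto
  next
    case (add g h)
    then show ?case by (simp add: koopman_add comp_assoc)
  qed (use gens in \<open>auto simp: koopman_zero\<close>)
  then have "range koopman \<subseteq> cvec.span X" using id by force
  then show ?thesis unfolding koopman_algebra_eq_span by (intro cvec.span_minimal) simp_all
qed

text \<open>
  Modulo \<open>ab - ba\<close> the element \<open>b\<close> is central, and \<open>a\<close>, \<open>d\<close> generate a dihedral group of order 8.
\<close>

lemma comm_ideal_finite_codim:
  "\<exists>F. finite F \<and> id_blinfun \<in> F \<and> koopman_algebra \<subseteq> cvec.span (F \<union> comm_ideal)"
proof -
  \<comment> \<open>These words exhaust the dihedral group generated by a and d. As b is central
    modulo the ideal and an involution, D and b D suffice.\<close>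
  define D where "D = {0, gen\<^sub>a, gen\<^sub>d, gen\<^sub>a + gen\<^sub>d, gen\<^sub>d + gen\<^sub>a, gen\<^sub>a + (gen\<^sub>d + gen\<^sub>a),
    gen\<^sub>d + (gen\<^sub>a + gen\<^sub>d), gen\<^sub>a + (gen\<^sub>d + (gen\<^sub>a + gen\<^sub>d))}"
  define E where "E = D \<union> (+) gen\<^sub>b ` D"
  define F where "F = koopman ` E"
  have aD: "gen\<^sub>a + y \<in> D" if "y \<in> D" for y
    using that by (auto simp: D_def grigorchuk_relations grigorchuk_cancel)
  have dD: "gen\<^sub>d + y \<in> D" if "y \<in> D" for y
    using that by (auto simp: D_def grigorchuk_relations grigorchuk_cancel dihedral_relation dihedral_relation')
  have bE: "gen\<^sub>b + y \<in> E" if "y \<in> E" for y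
    using that by (auto simp: E_def grigorchuk_cancel)
  have dE: "gen\<^sub>d + y \<in> E" if y: "y \<in> E" for y
  proof (cases "y \<in> D")
    case False
    then obtain z where z: "y = gen\<^sub>b + z" "z \<in> D" using y by (auto simp: E_def)
    have "gen\<^sub>d + gen\<^sub>b = gen\<^sub>b + gen\<^sub>d" by (simp add: grigorchuk_relations grigorchuk_b_d)
    then have "gen\<^sub>d + y = gen\<^sub>b + (gen\<^sub>d + z)" unfolding z by (metis add.assoc)
    then show ?thesis using dD[OF z(2)] by (auto simp: E_def)
  qed (use dD in \<open>auto simp: E_def\<close>)
  let ?X = "F \<union> comm_ideal"
  have "koopman_algebra \<subseteq> cvec.span ?X"
  proof (rule algebra_subset_span)
    have "koopman 0 \<in> F" by (auto simp: F_def E_def D_def)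
    then show "id_blinfun \<in> cvec.span ?X" by (simp add: koopman_zero cvec.span_base)
    fix s x assume s: "s \<in> {gen\<^sub>a, gen\<^sub>b, gen\<^sub>d}" and x: "x \<in> ?X"
    show "koopman s o\<^sub>L x \<in> cvec.span ?X"
    proof (cases "x \<in> comm_ideal")
      case True
      then show ?thesis using comm_ideal_left koopman_in_algebra by (intro cvec.span_base) blast
    next
      case False
      then obtain y where y: "x = koopman y" "y \<in> E" using x by (auto simp: F_def)
      \<comment> \<open>Only a multiplied by b z can leave E. Exchanging a and b there costs (ab -
        ba) z, an element of the ideal.\<close>
      consider "s + y \<in> E" | z where "s = gen\<^sub>a" "y = gen\<^sub>b + z" "z \<in> D"
        using s y(2) aD bE dE by (auto simp: E_def)
      then show ?thesis
      proof cases
        case 1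
        then have "koopman s o\<^sub>L x \<in> F" by (simp add: F_def y koopman_add[symmetric])
        then show ?thesis by (intro cvec.span_base) blast
      next
        case 2
        have "koopman s o\<^sub>L x = (comm_ab o\<^sub>L koopman z) + koopman (gen\<^sub>b + (gen\<^sub>a + z))"
          by (simp add: 2 y comm_ab_def compose_diff_left add.assoc flip: koopman_add)
        moreover have "comm_ab o\<^sub>L koopman z \<in> comm_ideal"
          by (intro comm_ideal_right comm_ab_in_ideal koopman_in_algebra)
        moreover have "koopman (gen\<^sub>b + (gen\<^sub>a + z)) \<in> F" using aD[OF 2(3)] by (auto simp: F_def E_def)
        ultimately show ?thesis by (simp add: cvec.span_add cvec.span_base)
      qed
    qed
  qed
  moreover have "finite F" by (simp add: F_def E_def D_def)
  moreover have "id_blinfun \<in> F"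
    unfolding F_def by (rule image_eqI[of _ _ 0]) (simp_all add: koopman_zero E_def D_def)
  ultimately show ?thesis by blast
qed

definition comm_ideal_sq :: "(l2 \<Rightarrow>\<^sub>L l2) set" where
  "comm_ideal_sq = cvec.span {x o\<^sub>L y | x y. x \<in> comm_ideal \<and> y \<in> comm_ideal}"

lemma compose_in_sq: "x \<in> comm_ideal \<Longrightarrow> y \<in> comm_ideal \<Longrightarrow> x o\<^sub>L y \<in> comm_ideal_sq"
  unfolding comm_ideal_sq_def by (rule cvec.span_base) blast

text \<open>
  If \<open>F\<close> spans the algebra modulo the ideal \<open>I\<close> and \<open>s f = u(s,f) + i(s,f)\<close> with \<open>u(s,f)\<close> in the
  span of \<open>F\<close> and \<open>i(s,f) \<in> I\<close>, then \<open>F\<close> and the products \<open>f i(s,f')\<close> span it modulo \<open>I\<^sup>2\<close>.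
\<close>

lemma comm_ideal_sq_finite_codim:
  "\<exists>G. finite G \<and> koopman_algebra \<subseteq> cvec.span (G \<union> comm_ideal_sq)"
proof -
  obtain F where F: "finite F" "id_blinfun \<in> F" "koopman_algebra \<subseteq> cvec.span (F \<union> comm_ideal)"
    using comm_ideal_finite_codim by blast
  obtain F' where F': "finite F'" "F' \<subseteq> koopman_algebra" "koopman_algebra \<subseteq> cvec.span (F' \<union> comm_ideal)"
    using finite_complement[OF F(1) subspace_algebra F(3)] by blast
  \<comment> \<open>The spanning set is moved into B so that a generator times one of its elements
    can be expanded again. The identity is restored because it provides the left factor when the
    error i(s,f) itself has to be a listed product.\<close>
  define E where "E = insert id_blinfun F'"
  have E: "finite E" "id_blinfun \<in> E" "E \<subseteq> koopman_algebra" "koopman_algebra \<subseteq> cvec.span (E \<union> comm_ideal)"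
    using F' id_in_algebra cvec.span_mono[of "F' \<union> comm_ideal" "E \<union> comm_ideal"] by (auto simp: E_def)
  let ?S = "{gen\<^sub>a, gen\<^sub>b, gen\<^sub>d}"
  have "\<exists>u i. koopman s o\<^sub>L f = u + i \<and> u \<in> cvec.span E \<and> i \<in> comm_ideal" if "f \<in> E" for s f
  proof -
    have "koopman s o\<^sub>L f \<in> cvec.span (E \<union> comm_ideal)"
      using E(3,4) that algebra_compose koopman_in_algebra by blast
    then show ?thesis
      unfolding cvec.span_Un cvec.span_eq_iff[THEN iffD2, OF subspace_comm_ideal] by auto
  qed
  then have ex: "\<exists>i. i \<in> comm_ideal \<and> (koopman s o\<^sub>L f) - i \<in> cvec.span E" if "f \<in> E" for s f
    using that by (metis add_diff_cancel_right')
  define i where "i s f = (SOME i. i \<in> comm_ideal \<and> (koopman s o\<^sub>L f) - i \<in> cvec.span E)" for s f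
  define u where "u s f = (koopman s o\<^sub>L f) - i s f" for s f
  have ui: "koopman s o\<^sub>L f = u s f + i s f" "f \<in> E \<Longrightarrow> u s f \<in> cvec.span E" "f \<in> E \<Longrightarrow> i s f \<in> comm_ideal" for s f
    using someI_ex[OF ex, of f s] by (simp_all add: u_def i_def)
  define P where "P = (\<lambda>(f, s, f'). f o\<^sub>L i s f') ` (E \<times> ?S \<times> E)"
  define X where "X = E \<union> P \<union> comm_ideal_sq"
  have "koopman_algebra \<subseteq> cvec.span X"
  proof (rule algebra_subset_span)
    show "id_blinfun \<in> cvec.span X" using E(2) by (intro cvec.span_base) (simp add: X_def)
    fix s x assume s: "s \<in> ?S" and "x \<in> X"
    then consider "x \<in> E" | f t f' where "x = f o\<^sub>L i t f'" "f \<in> E" "t \<in> ?S" "f' \<in> E" | "x \<in> comm_ideal_sq"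
      by (auto simp: X_def P_def)
    then show "koopman s o\<^sub>L x \<in> cvec.span X"
    proof cases
      case 1
      have "id_blinfun o\<^sub>L i s x \<in> P" unfolding P_def using E(2) s 1 by (intro image_eqI[of _ _ "(id_blinfun, s, x)"]) auto
      then have "i s x \<in> cvec.span X" by (intro cvec.span_base) (simp add: X_def)
      moreover have "u s x \<in> cvec.span X" using ui(2)[OF 1] cvec.span_mono[of E X] by (auto simp: X_def)
      ultimately show ?thesis by (simp add: ui(1) cvec.span_add)
    next
      case 2
      have "u s f o\<^sub>L i t f' \<in> cvec.span X"
      proof (rule span_linear_image[where L = "\<lambda>v. v o\<^sub>L i t f'", OF ui(2)[OF 2(2)]])
        fix v assume "v \<in> E"
        then have "v o\<^sub>L i t f' \<in> P" unfolding P_def using 2 by (intro image_eqI[of _ _ "(v, t, f')"]) auto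
        then show "v o\<^sub>L i t f' \<in> cvec.span X" by (intro cvec.span_base) (simp add: X_def)
      qed (simp_all add: compose_add_left scaleC_compose)
      moreover have "i s f o\<^sub>L i t f' \<in> cvec.span X"
        using compose_in_sq[OF ui(3)[OF 2(2)] ui(3)[OF 2(4)]] by (intro cvec.span_base) (simp add: X_def)
      moreover have "koopman s o\<^sub>L x = (u s f o\<^sub>L i t f') + (i s f o\<^sub>L i t f')"
        by (simp add: 2(1) ui(1) flip: comp_assoc compose_add_left)
      ultimately show ?thesis by (simp add: cvec.span_add)
    next
      case 3
      then have "koopman s o\<^sub>L x \<in> comm_ideal_sq"
        unfolding comm_ideal_sq_def
      proof (rule left_mult_span[OF clinear_op_koopman])
        fix z assume "z \<in> {x o\<^sub>L y | x y. x \<in> comm_ideal \<and> y \<in> comm_ideal}"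
        then obtain v w where "z = v o\<^sub>L w" "v \<in> comm_ideal" "w \<in> comm_ideal" by blast
        then have "koopman s o\<^sub>L z \<in> comm_ideal_sq"
          using compose_in_sq[OF comm_ideal_left[OF _ koopman_in_algebra]] by (simp add: comp_assoc[symmetric])
        then show "koopman s o\<^sub>L z \<in> cvec.span {x o\<^sub>L y | x y. x \<in> comm_ideal \<and> y \<in> comm_ideal}"
          by (simp only: comm_ideal_sq_def)
      qed
      then show ?thesis by (intro cvec.span_base) (simp add: X_def)
    qed
  qed
  moreover have "finite (E \<union> P)" using E(1) by (simp add: P_def)
  ultimately show ?thesis unfolding X_def by (intro exI[of _ "E \<union> P"]) simp
qed

section \<open>Scalar matrix entries\<close>

text \<open>The vertex is sought below an arbitrary word u for the sake of products: first it is
  made deep enough for h, then extended for g at its image. Below it h merely copies the extension,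
  so triviality for h persists.\<close>

lemma trivial_section: "\<exists>w. section_at g (u @ w) = 0"
proof (induction g arbitrary: u rule: grigorchuk_induct)
  case zero
  then show ?case by simp
next
  case (add g h)
  obtain w where w: "section_at h (u @ w) = 0" using add.IH(2) by blast
  obtain w' where w': "section_at g (act h (u @ w) @ w') = 0" using add.IH(1) by blast
  have "act h (u @ w @ w') = act h (u @ w) @ w'"
    using act_append[of h "u @ w" w'] w by (simp add: act_zero)
  moreover have "section_at h (u @ w @ w') = 0"
    using section_at_append[of h "u @ w" w'] w by simp
  ultimately have "section_at (g + h) (u @ w @ w') = 0"
    using w' by (simp add: section_at_add)
  then show ?case by metis
next
  let ?N = "{0, gen\<^sub>a, gen\<^sub>b, gen\<^sub>c, gen\<^sub>d}"
  have letter: "section_at g [i] \<in> ?N" if "g \<in> ?N" for g i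
    using that by (cases i) (auto simp: section_at_gen section_at_gen_a)
  have sec: "section_at g u \<in> ?N" if "g \<in> ?N" for g u
    using that
  proof (induction u arbitrary: g)
    case (Cons i u)
    from Cons.IH[OF letter[OF Cons.prems, of i]] show ?case
      using section_at_append[of g "[i]" u] by simp
  qed simp
  \<comment> \<open>Sections of generators are generators or trivial. At 0 each of these becomes a
    or trivial, and a itself has a trivial section at 0.\<close>
  have "section_at g [False, False] = 0" if "g \<in> ?N" for g
    using that section_at_append[of g "[False]" "[False]"] by (auto simp: section_at_gen section_at_gen_a)
  then have *: "\<exists>w. section_at g (u @ w) = 0" if "g \<in> ?N" for g u
    using sec[OF that, of u] section_at_append by metis
  {
    case gen_a
    show ?case by (rule *) simp
  next
    case gen_b
    show ?case by (rule *) simp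
  next
    case gen_c
    show ?case by (rule *) simp
  next
    case gen_d
    show ?case by (rule *) simp
  }
qed

lemma trivial_sections:
  assumes "finite A" shows "\<exists>w. \<forall>g\<in>A. section_at g (u @ w) = 0"
  using assms
proof (induction A rule: finite_induct)
  case (insert g A)
  then obtain w where w: "\<forall>g\<in>A. section_at g (u @ w) = 0" by blast
  obtain w' where w': "section_at g ((u @ w) @ w') = 0" using trivial_section by blast
  have "section_at h (u @ w @ w') = 0" if "h \<in> A" for h
    using section_at_append[of h "u @ w" w'] w that by simp
  with w' show ?case by (intro exI[of _ "w @ w'"]) simp
qed simp

lemma cinner_cyl_one: "cinner (cyl z) const_one = complex_of_real (1 / sqrt 2) ^ length z"
proof (induction z)
  case Nil
  then show ?case by (simp add: cyl_Nil cinner_const_one)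
next
  case (Cons i z)
  then show ?case
    by (simp add: cyl_Cons cinner_branch cobranch_const_one cinner_scaleC_right)
qed

lemma cinner_cyl_prefix:
  assumes "length y = length u"
  shows "cinner (cyl (y @ z)) (cyl u) = complex_of_real (1 / sqrt 2) ^ length z * cinner (cyl y) (cyl u)"
proof -
  have "cinner (cyl (y @ z)) (cyl u) = cinner (word_isometry y (cyl z)) (word_isometry u const_one)"
    by (simp add: cyl_append) (simp add: cyl_def)
  also have "\<dots> = (if y = u then cinner (cyl z) const_one else 0)"
    using assms by (simp add: cinner_word_isometry coword_word_isometry)
  finally show ?thesis using assms by (simp add: cinner_cyl cinner_cyl_one)
qed

text \<open>At a word q where all occurring group elements have trivial sections, each entry S_p^* g
  S_q is 1 or 0. The danger is cancellation of all entries in that column after refining v to q;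
  pairing with the shorter cylinder function of u excludes it.\<close>

lemma scalar_entry:
  assumes x: "x \<in> koopman_algebra" "x \<noteq> 0"
  obtains p q \<kappa> where "length p = length q" "\<kappa> \<noteq> 0" "\<And>f. coword p (x (word_isometry q f)) = \<kappa> *\<^sub>C f"
proof -
  have cs: "x \<in> koopman_cstar" using x(1) algebra_subset_cstar by blast
  obtain u v where uv: "length u = length v" "cinner (x (cyl v)) (cyl u) \<noteq> 0"
    by (rule cstar_nonzero_coefficient[OF cs x(2)])
  obtain \<xi> where \<xi>: "x = extend_rep koopman \<xi>" using x(1) by (auto simp: koopman_algebra_def)
  define A where "A = Poly_Mapping.keys \<xi>"
  define c where "c = Poly_Mapping.lookup \<xi>"
  have xf: "x f = (\<Sum>g\<in>A. c g *\<^sub>C koopman g f)" for f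
    by (simp add: \<xi> extend_rep_def A_def c_def blinfun.sum_left)
  obtain w where w: "\<And>g. g \<in> A \<Longrightarrow> section_at g (v @ w) = 0"
    using trivial_sections[of A v] by (auto simp: A_def)
  define q where "q = v @ w"
  \<comment> \<open>Appending letters multiplies the coefficient of every group element by the same
    power of 1 / \<open>sqrt 2\<close>, since the image of v @ w extends the image of v. A nonzero
    sum therefore stays nonzero.\<close>
  have "cinner (x (cyl q)) (cyl u) = complex_of_real (1 / sqrt 2) ^ length w * cinner (x (cyl v)) (cyl u)"
  proof -
    have "cinner (cyl (act g (v @ w))) (cyl u) = complex_of_real (1 / sqrt 2) ^ length w * cinner (cyl (act g v)) (cyl u)" for g
      using cinner_cyl_prefix[of "act g v" u "act (section_at g v) w"] uv(1) by (simp add: act_append)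
    then show ?thesis
      by (simp add: q_def xf cinner_sum_left cinner_scaleC_left koopman_cyl sum_distrib_left mult.left_commute)
  qed
  then have "cinner (x (cyl q)) (cyl u) \<noteq> 0" using uv(2) by simp
  then have xq: "x (cyl q) \<noteq> 0" by auto
  have "\<exists>p\<in>words (length q). cinner (x (cyl q)) (cyl p) \<noteq> 0"
  proof (rule ccontr)
    assume "\<not> ?thesis"
    then have "x (cyl q) = 0" by (subst cstar_cyl_expansion[OF cs]) simp
    with xq show False by simp
  qed
  then obtain p where p: "length p = length q" "cinner (x (cyl q)) (cyl p) \<noteq> 0" by auto
  have "coword p (x (word_isometry q f)) = cinner (x (cyl q)) (cyl p) *\<^sub>C f" for f
  proof -
    have "coword p (koopman g (word_isometry q f)) = cinner (koopman g (cyl q)) (cyl p) *\<^sub>C f" if "g \<in> A" for g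
      using w[OF that] p(1)
      by (auto simp: koopman_word_isometry koopman_cyl cinner_cyl koopman_zero coword_word_isometry q_def[symmetric] scaleC_one)
    then show ?thesis
      by (simp add: xf blinfun.sum_right clinear_opD[OF clinear_op_coword] cinner_sum_left cinner_scaleC_left
          cvec.scale_sum_left scaleC_scaleC cong: sum.cong)
  qed
  then show ?thesis using that p by blast
qed

section \<open>Just-infiniteness\<close>

lemma matrix_entry_in_algebra:
  assumes x: "x \<in> koopman_algebra" and "length r = length s"
  shows "coword r o\<^sub>L x o\<^sub>L word_isometry s \<in> koopman_algebra"
  using x
proof (induction rule: algebra_induct)
  case (koopman g)
  have "coword r o\<^sub>L koopman g o\<^sub>L word_isometry s = (if r = act g s then koopman (section_at g s) else 0)"
    using assms(2) by (intro blinfun_eqI) (simp add: koopman_word_isometry coword_word_isometry)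
  then show ?case using koopman_in_algebra cvec.subspace_0[OF subspace_algebra] by simp
qed (simp_all add: compose_add_left compose_add_right scaleC_compose compose_scaleC[OF clinear_op_coword]
    cvec.subspace_add[OF subspace_algebra] cvec.subspace_scale[OF subspace_algebra])

lemma ideal_properties:
  assumes J: "ideal J (operator_ring koopman_algebra)"
  shows "cvec.subspace J" "J \<subseteq> koopman_algebra"
    "\<And>x T. x \<in> J \<Longrightarrow> T \<in> koopman_algebra \<Longrightarrow> T o\<^sub>L x \<in> J"
    "\<And>x T. x \<in> J \<Longrightarrow> T \<in> koopman_algebra \<Longrightarrow> x o\<^sub>L T \<in> J"
proof -
  interpret J: ideal J "operator_ring koopman_algebra" by (rule J)
  show left: "T o\<^sub>L x \<in> J" if "x \<in> J" "T \<in> koopman_algebra" for x T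
    using J.I_l_closed[of x T] that by (simp add: operator_ring_def)
  show "x o\<^sub>L T \<in> J" if "x \<in> J" "T \<in> koopman_algebra" for x T
    using J.I_r_closed[of x T] that by (simp add: operator_ring_def)
  show "J \<subseteq> koopman_algebra" using J.a_subset by (simp add: operator_ring_def)
  show "cvec.subspace J"
    unfolding cvec.subspace_def
  proof (intro conjI ballI allI)
    show "0 \<in> J" using additive_subgroup.zero_closed[OF J.additive_subgroup_axioms] by (simp add: operator_ring_def)
    show "x + y \<in> J" if "x \<in> J" "y \<in> J" for x y
      using additive_subgroup.a_closed[OF J.additive_subgroup_axioms that] by (simp add: operator_ring_def)
    show "c *\<^sub>C x \<in> J" if "x \<in> J" for c x
      using left[OF that cvec.subspace_scale[OF subspace_algebra id_in_algebra, of c]] by (simp add: scaleC_compose)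
  qed
qed

text \<open>For k, k' in the commutator ideal, S_r k S_p^* x S_q k' S_s^* belongs to J and equals
  the scalar entry times S_r k k' S_s^*. The level n is the length of q.\<close>

lemma ideal_contains_corner:
  assumes J: "ideal J (operator_ring koopman_algebra)" "J \<noteq> {0}"
  obtains n where "\<And>r s z. length r = n \<Longrightarrow> length s = n \<Longrightarrow> z \<in> comm_ideal_sq \<Longrightarrow>
    word_isometry r o\<^sub>L z o\<^sub>L coword s \<in> J"
proof -
  note Jp = ideal_properties[OF J(1)]
  have "0 \<in> J" by (rule cvec.subspace_0[OF Jp(1)])
  then obtain x where x: "x \<in> J" "x \<noteq> 0" using J(2) by blast
  obtain p q \<kappa> where pq: "length p = length q" "\<kappa> \<noteq> 0" "\<And>f. coword p (x (word_isometry q f)) = \<kappa> *\<^sub>C f"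
    using scalar_entry[of x] x Jp(2) by blast
  show ?thesis
  proof (rule that[of "length q"])
    fix r s :: "bool list" and z assume rs: "length r = length q" "length s = length q" and z: "z \<in> comm_ideal_sq"
    have "word_isometry r o\<^sub>L z o\<^sub>L coword s \<in> cvec.span J"
    proof (rule span_linear_image[where L = "\<lambda>z. word_isometry r o\<^sub>L z o\<^sub>L coword s", OF z[unfolded comm_ideal_sq_def]])
      fix z assume "z \<in> {x o\<^sub>L y | x y. x \<in> comm_ideal \<and> y \<in> comm_ideal}"
      then obtain k k' where z: "z = k o\<^sub>L k'" and k: "k \<in> comm_ideal" "k' \<in> comm_ideal" by blast
      have "word_isometry r o\<^sub>L k o\<^sub>L coword p \<in> koopman_algebra" "word_isometry q o\<^sub>L k' o\<^sub>L coword s \<in> koopman_algebra"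
        using word_comm_ideal k comm_ideal_subset rs pq(1) by (metis subsetD)+
      then have "(word_isometry r o\<^sub>L k o\<^sub>L coword p) o\<^sub>L (x o\<^sub>L (word_isometry q o\<^sub>L k' o\<^sub>L coword s)) \<in> J"
        by (intro Jp(3,4) x(1))
      then have "inverse \<kappa> *\<^sub>C ((word_isometry r o\<^sub>L k o\<^sub>L coword p) o\<^sub>L (x o\<^sub>L (word_isometry q o\<^sub>L k' o\<^sub>L coword s))) \<in> J"
        by (rule cvec.subspace_scale[OF Jp(1)])
      also have "inverse \<kappa> *\<^sub>C ((word_isometry r o\<^sub>L k o\<^sub>L coword p) o\<^sub>L (x o\<^sub>L (word_isometry q o\<^sub>L k' o\<^sub>L coword s))) =
        word_isometry r o\<^sub>L z o\<^sub>L coword s"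
        using k comm_ideal_subset pq(2)
        by (intro blinfun_eqI)
          (simp add: z pq(3) word_isometry_scaleC clinear_opD[OF algebra_clinear] subset_iff scaleC_scaleC scaleC_one)
      finally show "word_isometry r o\<^sub>L z o\<^sub>L coword s \<in> cvec.span J" by (rule cvec.span_base)
    qed (simp_all add: blinfun_eqI blinfun.add_left blinfun.add_right word_isometry_scaleC)
    then show "word_isometry r o\<^sub>L z o\<^sub>L coword s \<in> J" using Jp(1) cvec.span_eq_iff by blast
  qed
qed

text \<open>The element x is the sum of S_r (S_r^* x S_s) S_s^* over words of length n, and the
  entries lie in B by self-similarity. Expanding them modulo \<open>comm_ideal_sq\<close> leaves,
  modulo J, only the finitely many S_r z S_s^* with z in G. As these may lie outside B,
  \<open>finite_complement\<close> replaces them.\<close>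

lemma ideal_finite_codim:
  assumes J: "ideal J (operator_ring koopman_algebra)" "J \<noteq> {0}"
  shows "\<exists>F. finite F \<and> F \<subseteq> koopman_algebra \<and> koopman_algebra \<subseteq> cvec.span (F \<union> J)"
proof -
  obtain n where n: "\<And>r s z. length r = n \<Longrightarrow> length s = n \<Longrightarrow> z \<in> comm_ideal_sq \<Longrightarrow>
    word_isometry r o\<^sub>L z o\<^sub>L coword s \<in> J"
    using ideal_contains_corner[OF J] by blast
  obtain G where G: "finite G" "koopman_algebra \<subseteq> cvec.span (G \<union> comm_ideal_sq)"
    using comm_ideal_sq_finite_codim by blast
  define H where "H = (\<lambda>(r, s, z). word_isometry r o\<^sub>L z o\<^sub>L coword s) ` (words n \<times> words n \<times> G)"
  have "koopman_algebra \<subseteq> cvec.span (H \<union> J)"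
  proof
    fix x assume x: "x \<in> koopman_algebra"
    have "word_isometry r o\<^sub>L (coword r o\<^sub>L x o\<^sub>L word_isometry s) o\<^sub>L coword s \<in> cvec.span (H \<union> J)"
      if rs: "r \<in> words n" "s \<in> words n" for r s
    proof (rule span_linear_image[where L = "\<lambda>z. word_isometry r o\<^sub>L z o\<^sub>L coword s"])
      show "coword r o\<^sub>L x o\<^sub>L word_isometry s \<in> cvec.span (G \<union> comm_ideal_sq)"
        using matrix_entry_in_algebra[OF x] rs G(2) by auto
      fix z assume "z \<in> G \<union> comm_ideal_sq"
      then have "word_isometry r o\<^sub>L z o\<^sub>L coword s \<in> H \<union> J"
        using n rs by (force simp: H_def)
      then show "word_isometry r o\<^sub>L z o\<^sub>L coword s \<in> cvec.span (H \<union> J)" by (rule cvec.span_base)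
    qed (simp_all add: blinfun_eqI blinfun.add_left blinfun.add_right word_isometry_scaleC)
    then have "(\<Sum>r\<in>words n. \<Sum>s\<in>words n. word_isometry r o\<^sub>L (coword r o\<^sub>L x o\<^sub>L word_isometry s) o\<^sub>L coword s) \<in> cvec.span (H \<union> J)"
      by (intro cvec.span_sum) blast
    also have "(\<Sum>r\<in>words n. \<Sum>s\<in>words n. word_isometry r o\<^sub>L (coword r o\<^sub>L x o\<^sub>L word_isometry s) o\<^sub>L coword s) = x"
      by (rule blinfun_eqI)
        (simp add: blinfun.sum_left blinfun.sum_right[symmetric] sum_word_isometry_coword)
    finally show "x \<in> cvec.span (H \<union> J)" .
  qed
  moreover have "finite H" using G(1) by (simp add: H_def)
  ultimately show ?thesis using finite_complement[OF _ subspace_algebra] by blast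
qed

lemma just_infinite_koopman: "just_infinite koopman_algebra"
  unfolding just_infinite_def
proof (intro conjI allI impI algebra_infinite_dim, elim conjE)
  fix J assume J: "ideal J (operator_ring koopman_algebra)" "J \<noteq> {0}"
  note Jp = ideal_properties[OF J(1)]
  obtain F where F: "finite F" "F \<subseteq> koopman_algebra" "koopman_algebra \<subseteq> cvec.span (F \<union> J)"
    using ideal_finite_codim[OF J] by blast
  have coset: "J +>\<^bsub>operator_ring koopman_algebra\<^esub> x = (\<lambda>j. j + x) ` J" for x
    by (auto simp: a_r_coset_def' operator_ring_def)
  have carrier: "carrier (operator_ring koopman_algebra Quot J) =
    (\<lambda>x. J +>\<^bsub>operator_ring koopman_algebra\<^esub> x) ` koopman_algebra"
    by (auto simp: FactRing_def A_RCOSETS_def' operator_ring_def)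
  have span_alg: "cvec.span F \<subseteq> koopman_algebra" using F(2) subspace_algebra by (rule cvec.span_minimal)
  have rep: "\<exists>f\<in>cvec.span F. (\<lambda>j. j + x) ` J = (\<lambda>j. j + f) ` J" if "x \<in> koopman_algebra" for x
  proof -
    have "x \<in> cvec.span (F \<union> J)" using F(3) that by blast
    then obtain f j where fj: "f \<in> cvec.span F" "j \<in> J" "x = f + j"
      unfolding cvec.span_Un cvec.span_eq_iff[THEN iffD2, OF Jp(1)] by auto
    have "(\<lambda>j. j + x) ` J = (\<lambda>j. j + f) ` J"
    proof (intro Set.equalityI image_subsetI)
      fix k assume k: "k \<in> J"
      show "k + x \<in> (\<lambda>j. j + f) ` J"
        by (rule image_eqI[of _ _ "k + j"]) (simp_all add: fj cvec.subspace_add[OF Jp(1)] k)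
      show "k + f \<in> (\<lambda>j. j + x) ` J"
        by (rule image_eqI[of _ _ "k - j"]) (simp_all add: fj cvec.subspace_diff[OF Jp(1)] k)
    qed
    with fj(1) show ?thesis by blast
  qed
  have "(\<lambda>x. (\<lambda>j. j + x) ` J) ` koopman_algebra = (\<lambda>x. (\<lambda>j. j + x) ` J) ` cvec.span F"
  proof (rule Set.equalityI)
    show "(\<lambda>x. (\<lambda>j. j + x) ` J) ` koopman_algebra \<subseteq> (\<lambda>x. (\<lambda>j. j + x) ` J) ` cvec.span F"
    proof (rule image_subsetI)
      fix x assume "x \<in> koopman_algebra"
      then obtain f where "f \<in> cvec.span F" "(\<lambda>j. j + x) ` J = (\<lambda>j. j + f) ` J" using rep by blast
      then show "(\<lambda>j. j + x) ` J \<in> (\<lambda>x. (\<lambda>j. j + x) ` J) ` cvec.span F" by (rule image_eqI[rotated])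
    qed
    show "(\<lambda>x. (\<lambda>j. j + x) ` J) ` cvec.span F \<subseteq> (\<lambda>x. (\<lambda>j. j + x) ` J) ` koopman_algebra"
      by (rule image_mono[OF span_alg])
  qed
  then show "finite_dim_quotient koopman_algebra J"
    unfolding finite_dim_quotient_def carrier coset using F(1,2) by blast
qed

lemma cstar_infinite_dim: "\<not> cfinite_dim koopman_cstar"
  using algebra_infinite_dim algebra_subset_cstar unfolding cfinite_dim_def by (meson order_trans)

theorem theorem7p2:
  shows
    "(self_similar koopman \<and>
      \<not> cfinite_dim koopman_algebra \<and>
      residually_finite_dim TYPE(l2) koopman_algebra) \<and>
     (self_similar koopman \<and>
      \<not> cfinite_dim koopman_cstar \<and>
      residually_finite_dim TYPE(l2) koopman_cstar \<and>
      (\<exists>\<tau>. faithful_trace koopman_cstar \<tau>)) \<and>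
     (\<not> inj (extend_rep koopman) \<and>
      \<not> star_just_infinite TYPE(l2)) \<and>
     just_infinite koopman_algebra"
  using self_similar_koopman algebra_infinite_dim cstar_infinite_dim residually_finite_dim_cstar
    residually_finite_dim_subset[OF residually_finite_dim_cstar algebra_subset_cstar]
    faithful_koopman_trace extend_rep_not_inj not_star_just_infinite just_infinite_koopman
  by blast

end
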